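(* Let $p(\cdot):\mathbb{R}^n\to[1,\infty)$ be a measurable function with $1<p_-\le p_+<\infty$. Then the Hardy--Littlewood maximal operator $M$ is bounded on $L^{p(\cdot)}$ (i.e. $p(\cdot)\in\mathcal{P}$) if and only if $p(\cdot)$ satisfies both the $A_{p(\cdot)}$ condition and the $S_\infty$ condition.
   Context: Here $p_-:=\operatorname{ess\,inf}_{\mathbb{R}^n}p$ and $p_+:=\operatorname{ess\,sup}_{\mathbb{R}^n}p$. $L^{p(\cdot)}$ is the space of real-valued measurable $f$ on $\mathbb{R}^n$ with $\|f\|_{L^{p(\cdot)}}:=\inf\{\lambda>0:\int_{\mathbb{R}^n}(|f(x)|/\lambda)^{p(x)}dx\le1\}<\infty$. Cubes have sides parallel to the coordinate axes. $Mf(x):=\sup_{Q\ni x}\frac1{|Q|}\int_Q|f(y)|dy$, the supremum over all cubes $Q\subset\mathbb{R}^n$ containing $x$. $\mathcal{P}$ is the class of exponents for which $M$ is bounded on $L^{p(\cdot)}$. Conjugate exponent: $p'(x):=\frac{p(x)}{p(x)-1}$. $A_{p(\cdot)}$ condition: $\sup_Q\frac{\|\chi_Q\|_{L^{p(\cdot)}}\|\chi_Q\|_{L^{p'(\cdot)}}}{|Q|}<\infty$, the supremum over all cubes $Q\subset\mathbb{R}^n$. $S_\infty$ condition: there exist $r>1$, $0<\lambda_0<1$ and $C>0$ such that for every $0<\lambda<\lambda_0$, for any finite family $\mathcal{F}$ of pairwise disjoint cubes, and for every sequence $\{\alpha_Q\}_{Q\in\mathcal{F}}$ with $0<\alpha_Q<1$,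 the following holds: for any measurable subsets $E_Q\subset Q$ with $|E_Q|=\lambda|Q|$, $Q\in\mathcal{F}$, $$\sum_{Q\in\mathcal{F}}\int_{E_Q}\alpha_Q^{p(x)}dx\le1\ \Longrightarrow\ \sum_{Q\in\mathcal{F}}\int_Q(\lambda^{1/r}\alpha_Q)^{p(x)}dx\le C.$$ *)

theory Defs
  imports "HOL-Analysis.Analysis" "HOL-Probability.Essential_Supremum"
begin

text \<open>
  Throughout, \<open>\<real>\<^sup>n\<close> is \<^typ>\<open>real ^ 'n\<close>, and measurability and measure are those of Lebesgue.
  Norms, maximal functions and modulars take values in \<^typ>\<open>ennreal\<close>, so that infinite values
  are genuine and the infimum over the empty set is \<open>\<infinity>\<close>.
\<close>

definition p_minus :: "(real ^ 'n \<Rightarrow> real) \<Rightarrow> ereal" where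
  "p_minus p = - esssup lebesgue (\<lambda>x. - ereal (p x))"

definition p_plus :: "(real ^ 'n \<Rightarrow> real) \<Rightarrow> ereal" where
  "p_plus p = esssup lebesgue (\<lambda>x. ereal (p x))"

text \<open>
  Non-degenerate cubes are products of intervals with a common length \<open>l\<close>. Each interval may contain
  either, both or none of its endpoints, so closed, open and half-open (e.g. dyadic) cubes are all
  included.
\<close>
definition cube :: "(real ^ 'n) set \<Rightarrow> bool" where
  "cube Q \<longleftrightarrow> (\<exists>a l I. 0 < l \<and>
     (\<forall>i. {a $ i <..< a $ i + l} \<subseteq> I i \<and> I i \<subseteq> {a $ i .. a $ i + l}) \<and>
     Q = {x. \<forall>i. x $ i \<in> I i})"

definition Lp_norm :: "(real ^ 'n \<Rightarrow> real) \<Rightarrow> (real ^ 'n \<Rightarrow> real) \<Rightarrow> ennreal" where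
  "Lp_norm p f =
     (INF t\<in>{t::real. 0 < t \<and>
        (\<integral>\<^sup>+x. ennreal ((\<bar>f x\<bar> / t) powr p x) \<partial>lebesgue) \<le> 1}. ennreal t)"

definition Lp_space :: "(real ^ 'n \<Rightarrow> real) \<Rightarrow> (real ^ 'n \<Rightarrow> real) set" where
  "Lp_space p = {f \<in> borel_measurable lebesgue. Lp_norm p f < \<infinity>}"

definition maximal :: "(real ^ 'n \<Rightarrow> real) \<Rightarrow> real ^ 'n \<Rightarrow> ennreal" where
  "maximal f x =
     (SUP Q\<in>{Q. cube Q \<and> x \<in> Q}. (\<integral>\<^sup>+y\<in>Q. ennreal \<bar>f y\<bar> \<partial>lebesgue) / emeasure lebesgue Q)"

text \<open>
  The elements of \<open>L\<^sup>p\<close> are real-valued, whereas \<open>M f\<close> may be infinite on a null set even when \<open>M\<close> is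
  bounded. Boundedness therefore requires \<open>M f\<close> to be finite almost everywhere; its real-valued
  version (\<^const>\<open>enn2real\<close> sends \<open>\<infinity>\<close> to \<open>0\<close>) then differs from \<open>M f\<close> on a null set only.
\<close>
definition maximal_bounded :: "(real ^ 'n \<Rightarrow> real) \<Rightarrow> bool" where
  "maximal_bounded p \<longleftrightarrow> (\<exists>C::real. 0 \<le> C \<and> (\<forall>f\<in>Lp_space p.
     (AE x in lebesgue. maximal f x < \<infinity>) \<and>
     (\<lambda>x. enn2real (maximal f x)) \<in> Lp_space p \<and>
     Lp_norm p (\<lambda>x. enn2real (maximal f x)) \<le> ennreal C * Lp_norm p f))"

text \<open>
  If \<open>p\<^sub>- > 1\<close>, the division by zero in the next definition can only occur on a null set.
\<close>
definition conj_exponent :: "(real ^ 'n \<Rightarrow> real) \<Rightarrow> real ^ 'n \<Rightarrow> real" where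
  "conj_exponent p x = p x / (p x - 1)"

definition A_condition :: "(real ^ 'n \<Rightarrow> real) \<Rightarrow> bool" where
  "A_condition p \<longleftrightarrow>
     (SUP Q\<in>{Q. cube Q}. Lp_norm p (indicator Q) * Lp_norm (conj_exponent p) (indicator Q)
        / emeasure lebesgue Q) < \<infinity>"

text \<open>
  Here \<open>s\<close>, \<open>s0\<close> are the mathematical \<open>\<lambda>\<close>, \<open>\<lambda>\<^sub>0\<close>.
\<close>
definition S_infty_condition :: "(real ^ 'n \<Rightarrow> real) \<Rightarrow> bool" where
  "S_infty_condition p \<longleftrightarrow>
     (\<exists>(r::real) (s0::real) (C::real). 1 < r \<and> 0 < s0 \<and> s0 < 1 \<and> 0 < C \<and>
       (\<forall>(s::real) (F :: (real ^ 'n) set set) (\<alpha> :: (real ^ 'n) set \<Rightarrow> real)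
          (E :: (real ^ 'n) set \<Rightarrow> (real ^ 'n) set).
          0 < s \<longrightarrow> s < s0 \<longrightarrow>
          finite F \<longrightarrow> (\<forall>Q\<in>F. cube Q) \<longrightarrow> disjoint F \<longrightarrow>
          (\<forall>Q\<in>F. 0 < \<alpha> Q \<and> \<alpha> Q < 1) \<longrightarrow>
          (\<forall>Q\<in>F. E Q \<in> sets lebesgue \<and> E Q \<subseteq> Q \<and>
             measure lebesgue (E Q) = s * measure lebesgue Q) \<longrightarrow>
          (\<Sum>Q\<in>F. \<integral>\<^sup>+x\<in>E Q. ennreal (\<alpha> Q powr p x) \<partial>lebesgue) \<le> 1 \<longrightarrow>
          (\<Sum>Q\<in>F. \<integral>\<^sup>+x\<in>Q. ennreal ((s powr (1 / r) * \<alpha> Q) powr p x) \<partial>lebesgue) \<le> ennreal C))"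

end

theory Submission
  imports Defs
begin

text \<open>
  Necessity of the \<open>A\<close> condition follows by testing \<open>M\<close> on \<open>b\<^bsup>1-p'\<^esup>\<chi>\<^sub>Q\<close>. For the \<open>S\<^sub>\<infinity>\<close> condition, majorise
  \<open>f = \<Sum> \<alpha>\<^sub>Q \<chi>\<^bsub>E\<^sub>Q\<^esub>\<close> by an \<open>A\<^sub>1\<close> weight of comparable norm and apply the reverse Hoelder inequality.

  For sufficiency, let \<open>Q\<close> be a dyadic cube with average \<open>f\<^sub>Q > t = 2\<^sup>k\<close>. Some superlevel set
  \<open>E = Q \<inter> {f > \<alpha>}\<close> with \<open>\<alpha> = 2\<^bsup>m-1\<^esup>t\<close> has proportion at least about \<open>2\<^bsup>-m(1+\<delta>)\<^esup>\<close>, and one wants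
  \<open>\<integral>\<^sub>Q t\<^sup>p \<le> C 2\<^bsup>-\<theta>m\<^esup> \<integral>\<^sub>E \<alpha>\<^sup>p\<close>, which can be summed over \<open>Q\<close>, \<open>k\<close> and \<open>m\<close>. If \<open>\<alpha> \<ge> 1\<close>, the \<open>A\<close> condition
  shows that powers \<open>\<alpha>\<^sup>p\<close> and \<open>\<kappa>\<^bsup>p'\<^esup>\<close> are comparable on \<open>Q\<close> to their values at the median of \<open>p\<close>, hence
  satisfy reverse Hoelder inequalities, and the estimate holds. If \<open>\<alpha> < 1\<close>, it can fail, but only
  on cubes where the \<open>S\<^sub>\<infinity>\<close> inequality is violated in homogeneous form. Disjoint families of such
  cubes have bounded total mass, since small masses can be accumulated until the
  normalisation is reached. Applying this at the level \<open>\<alpha>\<^bsup>1/(1+\<epsilon>)\<^esup>\<close>, with a reverse Hoelder inequality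
  off the union of the bad cubes, gains a positive power of \<open>\<alpha>\<close>, so the bad cubes of all
  levels can be summed although they are nested.
\<close>

subsection \<open>Cubes and shifted dyadic grids\<close>

text \<open>The modular is not homogeneous, and this shapes everything. The S-infinity hypothesis
  concerns only levels below \<open>1\<close> and, under a normalisation, returns a bounded quantity
  instead of a multiple of its left-hand side; as it stands it cannot be summed over levels. Levels
  from \<open>1\<close> on have to come from the A condition alone. All three uses of the reverse
  Hoelder inequality have one hypothesis: the average over a cube is at most \<open>c\<close>, and
  the weight is at least \<open>\<delta> * c\<close> on a proportion \<open>\<kappa>\<close>. For
  powers of a constant this suits quantiles of \<open>p\<close>: on the right side of a quantile the
  weight is at least its value there, so only the bound for the average needs work. The parameter
  \<open>\<delta>\<close> in the proportion of \<open>E\<close> is needed to find a large superlevel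
  set at all, but it makes the proportion smaller than the ratio of heights
  \<open>2 powr (- real m)\<close>. It is fixed after all gains are known, so small that the loss
  \<open>2 powr (\<delta> * b * real m)\<close> is absorbed. Grid cubes are nested or disjoint, so
  unions reduce to disjoint families without covering constants; general cubes return through the
  \<open>2 ^ CARD('n)\<close> shifts.\<close>

lemma cube_bounds:
  fixes Q :: "(real ^ 'n) set"
  assumes "cube Q"
  obtains a l where "0 < l" "box a (\<chi> i. a $ i + l) \<subseteq> Q" "Q \<subseteq> cbox a (\<chi> i. a $ i + l)"
proof -
  from assms obtain a l I where *: "0 < l"
    "\<And>i. {a $ i <..< a $ i + l} \<subseteq> I i \<and> I i \<subseteq> {a $ i .. a $ i + l}" "Q = {x. \<forall>i. x $ i \<in> I i}"
    unfolding cube_def by blast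
  have "box a (\<chi> i. a $ i + l) \<subseteq> Q"
    using * by (force simp: mem_box_cart)
  moreover have "Q \<subseteq> cbox a (\<chi> i. a $ i + l)"
  proof
    fix x assume "x \<in> Q"
    then have "x $ i \<in> {a $ i .. a $ i + l}" for i using *(2)[of i] *(3) by blast
    then show "x \<in> cbox a (\<chi> i. a $ i + l)" by (auto simp: mem_box_cart)
  qed
  ultimately show ?thesis using that * by blast
qed

lemma emeasure_box_side:
  fixes a :: "real ^ 'n" assumes "0 < l"
  shows "emeasure lebesgue (box a (\<chi> i. a $ i + l)) = ennreal (l ^ CARD('n))"
    and "emeasure lebesgue (cbox a (\<chi> i. a $ i + l)) = ennreal (l ^ CARD('n))"
proof -
  have p: "(\<Prod>b\<in>Basis. ((\<chi> i. a $ i + l) - a) \<bullet> b) = l ^ CARD('n)"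
  proof -
    have "(\<Prod>b\<in>Basis. ((\<chi> i. a $ i + l) - a) \<bullet> b) = (\<Prod>b\<in>(Basis::(real^'n) set). l)"
      by (intro prod.cong refl) (auto simp: Basis_vec_def inner_axis)
    then show ?thesis by simp
  qed
  have le: "a \<bullet> b \<le> (\<chi> i. a $ i + l) \<bullet> b" if "b \<in> Basis" for b
    using that assms by (auto simp: Basis_vec_def inner_axis)
  show "emeasure lebesgue (box a (\<chi> i. a $ i + l)) = ennreal (l ^ CARD('n))"
    using emeasure_lborel_box[OF le] p by simp
  show "emeasure lebesgue (cbox a (\<chi> i. a $ i + l)) = ennreal (l ^ CARD('n))"
    using emeasure_lborel_cbox[OF le] p by simp
qed

lemma cube_lebesgue:
  fixes Q :: "(real ^ 'n) set"
  assumes "cube Q"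
  shows "Q \<in> sets lebesgue"
    and "\<exists>l>0. emeasure lebesgue Q = ennreal (l ^ CARD('n))"
proof -
  obtain a l where l: "0 < l" and b: "box a (\<chi> i. a $ i + l) \<subseteq> Q" "Q \<subseteq> cbox a (\<chi> i. a $ i + l)"
    using cube_bounds[OF assms] .
  have "negligible (Q - box a (\<chi> i. a $ i + l))"
    using negligible_frontier_interval[of a "\<chi> i. a $ i + l"] by (rule negligible_subset) (use b in auto)
  then have "Q - box a (\<chi> i. a $ i + l) \<in> sets lebesgue"
    by (simp add: negligible_imp_sets)
  then have "box a (\<chi> i. a $ i + l) \<union> (Q - box a (\<chi> i. a $ i + l)) \<in> sets lebesgue"
    by (intro sets.Un) auto
  moreover have "box a (\<chi> i. a $ i + l) \<union> (Q - box a (\<chi> i. a $ i + l)) = Q" using b by auto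
  ultimately show Q: "Q \<in> sets lebesgue" by simp
  have "emeasure lebesgue Q = ennreal (l ^ CARD('n))"
    using emeasure_mono[OF b(1), of lebesgue] emeasure_mono[OF b(2), of lebesgue] Q
    by (simp add: emeasure_box_side[OF l])
  then show "\<exists>l>0. emeasure lebesgue Q = ennreal (l ^ CARD('n))" using l by blast
qed

lemma cube_emeasure:
  assumes "cube Q"
  shows "0 < emeasure lebesgue Q" "emeasure lebesgue Q < \<infinity>"
    "emeasure lebesgue Q = ennreal (measure lebesgue Q)" "0 < measure lebesgue Q"
proof -
  obtain l where l: "l > 0" "emeasure lebesgue Q = ennreal (l ^ CARD('a))"
    using cube_lebesgue(2)[OF assms] by blast
  show 1: "0 < emeasure lebesgue Q" "emeasure lebesgue Q < \<infinity>" using l by auto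
  show 2: "emeasure lebesgue Q = ennreal (measure lebesgue Q)"
    using 1 by (intro emeasure_eq_ennreal_measure) auto
  show "0 < measure lebesgue Q" using 1 2 by (metis ennreal_0 less_irrefl zero_less_measure_iff)
qed

text \<open>The offsets \<open>\<plusminus>1/3\<close> alternate in sign so that consecutive generations of a shifted grid are
  nested; the faces of shifted and unshifted cubes of side \<open>2\<^sup>-\<^sup>k\<close> stay \<open>2\<^sup>-\<^sup>k/3\<close> apart.\<close>
definition grid_offset :: "bool \<Rightarrow> int \<Rightarrow> real" where
  "grid_offset s k = (if s then (if even k then 1/3 else -1/3) else 0)"

definition grid_index :: "('n \<Rightarrow> bool) \<Rightarrow> int \<Rightarrow> real ^ 'n \<Rightarrow> 'n \<Rightarrow> int" where
  "grid_index s k x i = \<lfloor>2 powi k * x $ i + grid_offset (s i) k\<rfloor>"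

text \<open>Describing a cube as a fibre of an integer-valued index makes each generation a
  partition by construction and turns nesting into integer division.\<close>

definition grid_cube :: "('n \<Rightarrow> bool) \<Rightarrow> int \<Rightarrow> real ^ 'n \<Rightarrow> (real ^ 'n) set" where
  "grid_cube s k x = {y. grid_index s k y = grid_index s k x}"

definition grid :: "('n \<Rightarrow> bool) \<Rightarrow> (real ^ 'n) set set" where
  "grid s = {grid_cube s k x | k x. True}"

lemma grid_cube_self [simp]: "x \<in> grid_cube s k x"
  by (simp add: grid_cube_def)

lemma grid_cube_eq: "y \<in> grid_cube s k x \<Longrightarrow> grid_cube s k y = grid_cube s k x"
  by (simp add: grid_cube_def)

lemma grid_cube_in_grid [simp, intro]: "grid_cube s k x \<in> grid s"
  by (auto simp: grid_def)

lemma grid_nonempty: "V \<in> grid s \<Longrightarrow> \<exists>x. x \<in> V"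
  by (auto simp: grid_def) (metis grid_cube_self)

lemma floor_half: "\<lfloor>z\<rfloor> = \<lfloor>2 * z\<rfloor> div 2" for z :: real
proof -
  have "\<lfloor>(2*z) / real_of_int 2\<rfloor> = \<lfloor>2*z\<rfloor> div 2" by (rule floor_divide_real_eq_div) simp
  then show ?thesis by simp
qed

lemma grid_cube_Suc: "grid_cube s (k + 1) x \<subseteq> grid_cube s k x"
proof -
  have *: "\<exists>c. \<forall>x. grid_index s k x i = (grid_index s (k + 1) x i + c) div 2" for i
  proof -
    \<comment> \<open>Since \<open>2 * (1/3) = -1/3 + 1\<close>, and likewise with signs reversed,
      doubling an offset gives the next one up to an integer; the coarse index is then a function of
      the fine one.\<close>
    have "\<exists>c::int. 2 * grid_offset (s i) k = grid_offset (s i) (k + 1) + real_of_int c"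
    proof (cases "s i")
      case True
      show ?thesis using True
        by (intro exI[of _ "if even k then 1 else -1"]) (simp add: grid_offset_def)
    qed (auto simp: grid_offset_def intro!: exI[of _ 0])
    then obtain c :: int where c: "2 * grid_offset (s i) k = grid_offset (s i) (k + 1) + real_of_int c"
      by blast
    have "grid_index s k x i = (grid_index s (k + 1) x i + c) div 2" for x
    proof -
      have "2 * (2 powi k * x $ i + grid_offset (s i) k)
          = (2 powi (k + 1) * x $ i + grid_offset (s i) (k + 1)) + real_of_int c"
        using c by (simp add: power_int_add algebra_simps)
      then show ?thesis unfolding grid_index_def by (subst floor_half) simp
    qed
    then show ?thesis by blast
  qed
  show ?thesis
  proof
    fix y assume "y \<in> grid_cube s (k + 1) x"
    then have e: "grid_index s (k + 1) y = grid_index s (k + 1) x" by (simp add: grid_cube_def)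
    have "grid_index s k y i = grid_index s k x i" for i using *[of i] e by metis
    then show "y \<in> grid_cube s k x" by (auto simp: grid_cube_def)
  qed
qed

lemma grid_cube_mono: "k \<le> l \<Longrightarrow> grid_cube s l x \<subseteq> grid_cube s k x"
proof (induction l rule: int_ge_induct)
  case (step i)
  then show ?case using grid_cube_Suc[of s i x] by blast
qed simp

lemma grid_cube_interval:
  "y \<in> grid_cube s k x \<longleftrightarrow>
    (\<forall>i. y $ i \<in> {(grid_index s k x i - grid_offset (s i) k) / 2 powi k
            ..< (grid_index s k x i - grid_offset (s i) k) / 2 powi k + 1 / 2 powi k})"
proof -
  have "grid_index s k y i = j \<longleftrightarrow>
     y $ i \<in> {(j - grid_offset (s i) k) / 2 powi k ..< (j - grid_offset (s i) k) / 2 powi k + 1 / 2 powi k}" for i j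
  proof -
    have "grid_index s k y i = j \<longleftrightarrow> j \<le> 2 powi k * y $ i + grid_offset (s i) k \<and> 2 powi k * y $ i + grid_offset (s i) k < j + 1"
      unfolding grid_index_def by linarith
    also have "\<dots> \<longleftrightarrow> (j - grid_offset (s i) k) / 2 powi k \<le> y $ i \<and> y $ i < (j - grid_offset (s i) k + 1) / 2 powi k"
      by (auto simp: field_simps)
    finally show ?thesis by (simp add: add_divide_distrib diff_divide_distrib)
  qed
  then show ?thesis unfolding grid_cube_def fun_eq_iff mem_Collect_eq by blast
qed

lemma cube_grid_cube: "cube (grid_cube s k x)"
  unfolding cube_def
proof (intro exI conjI allI)
  let ?a = "\<lambda>i. (grid_index s k x i - grid_offset (s i) k) / 2 powi k"
  show "0 < 1 / (2::real) powi k" by simp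
  fix i
  show "{(\<chi> i. ?a i) $ i<..<(\<chi> i. ?a i) $ i + 1 / 2 powi k} \<subseteq> {?a i ..< ?a i + 1 / 2 powi k}" by auto
  show "{?a i ..< ?a i + 1 / 2 powi k} \<subseteq> {(\<chi> i. ?a i) $ i..(\<chi> i. ?a i) $ i + 1 / 2 powi k}" by auto
  show "grid_cube s k x = {x'. \<forall>i. x' $ i \<in> {?a i ..< ?a i + 1 / 2 powi k}}"
    using grid_cube_interval by blast
qed

lemma cube_grid: "V \<in> grid s \<Longrightarrow> cube V"
  by (auto simp: grid_def cube_grid_cube)

lemma emeasure_grid_cube:
  fixes x :: "real ^ 'n"
  shows "emeasure lebesgue (grid_cube s k x) = ennreal ((1 / 2 powi k) ^ CARD('n))"
proof -
  define a :: "real ^ 'n" where "a = (\<chi> i. (grid_index s k x i - grid_offset (s i) k) / 2 powi k)"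
  let ?l = "1 / (2::real) powi k"
  have b: "box a (\<chi> i. a $ i + ?l) \<subseteq> grid_cube s k x" "grid_cube s k x \<subseteq> cbox a (\<chi> i. a $ i + ?l)"
    unfolding grid_cube_interval subset_iff mem_box_cart a_def by (auto intro: less_imp_le)
  have l: "0 < ?l" by simp
  show ?thesis
    using emeasure_mono[OF b(1), of lebesgue] emeasure_mono[OF b(2), of lebesgue]
      cube_lebesgue(1)[OF cube_grid_cube[of s k x]]
    by (simp add: emeasure_box_side[OF l] del: power_one_over)
qed

lemma emeasure_grid_cube_Suc:
  fixes x :: "real ^ 'n"
  shows "emeasure lebesgue (grid_cube s k x) = 2 ^ CARD('n) * emeasure lebesgue (grid_cube s (k + 1) x)"
proof -
  have "(1 / 2 powi k) ^ CARD('n) = (2::real) ^ CARD('n) * (1 / 2 powi (k+1)) ^ CARD('n)"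
    by (simp add: power_int_add power_mult_distrib power_divide)
  moreover have "(2::ennreal) ^ CARD('n) = ennreal (2 ^ CARD('n))"
    by (simp add: ennreal_power[symmetric])
  ultimately show ?thesis unfolding emeasure_grid_cube
    by (simp add: ennreal_mult'[symmetric] del: power_one_over)
qed

lemma grid_nested:
  assumes "A \<in> grid s" "B \<in> grid s" "A \<inter> B \<noteq> {}"
  shows "A \<subseteq> B \<or> B \<subseteq> A"
proof -
  obtain x where x: "x \<in> A" "x \<in> B" using assms(3) by blast
  obtain k l where "A = grid_cube s k x" "B = grid_cube s l x"
    using assms(1,2) x unfolding grid_def by (auto dest: grid_cube_eq)
  then show ?thesis using grid_cube_mono[of k l s x] grid_cube_mono[of l k s x] by force
qed

lemma countable_grid: "countable (grid s)" for s :: "'n::finite \<Rightarrow> bool"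
proof -
  obtain D :: "(real ^ 'n) set" where D: "countable D" "\<And>X. open X \<Longrightarrow> X \<noteq> {} \<Longrightarrow> \<exists>d\<in>D. d \<in> X"
    using countable_dense_exists by blast
  have "grid s \<subseteq> (\<lambda>(k, x). grid_cube s k x) ` (UNIV \<times> D)"
  proof
    fix V assume "V \<in> grid s"
    then obtain k x where V: "V = grid_cube s k x" by (auto simp: grid_def)
    obtain a l where l: "0 < l" "box a (\<chi> i. a $ i + l) \<subseteq> V"
      using cube_bounds[OF cube_grid[OF \<open>V \<in> grid s\<close>]] by metis
    have "box a (\<chi> i. a $ i + l) \<noteq> {}" using l(1) by (simp add: interval_ne_empty_cart)
    then obtain d where "d \<in> D" "d \<in> V" using D(2)[OF open_box] l(2) by blast
    then show "V \<in> (\<lambda>(k, x). grid_cube s k x) ` (UNIV \<times> D)"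
      unfolding V using grid_cube_eq[of d s k x] by (intro image_eqI[of _ _ "(k, d)"]) auto
  qed
  then show ?thesis using D(1) by (meson countable_SIGMA countable_image countable_subset uncountable_def countableI_type)
qed

lemma grid_sets [measurable]: "V \<in> grid s \<Longrightarrow> V \<in> sets lebesgue"
  by (simp add: cube_grid cube_lebesgue(1))

lemma grid_cube_sets [measurable, simp]: "grid_cube s k x \<in> sets lebesgue"
  by (rule grid_sets) auto

lemma exists_dyadic_scale: "0 < l \<Longrightarrow> \<exists>k::int. l < 1 / 2 powi k \<and> 1 / 2 powi k \<le> 2 * l" for l :: real
proof -
  assume l: "0 < l"
  define k where "k = - (\<lfloor>log 2 l\<rfloor> + 1)"
  have e: "1 / 2 powi k = 2 powr (\<lfloor>log 2 l\<rfloor> + 1)"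
    unfolding k_def power_int_minus by (subst powr_real_of_int'[symmetric]) (auto simp: divide_simps)
  have "2 powr (log 2 l) < 2 powr (\<lfloor>log 2 l\<rfloor> + 1)"
    by (intro powr_less_mono) (auto, linarith?)
  moreover have "2 powr (\<lfloor>log 2 l\<rfloor> + 1) \<le> 2 powr (log 2 l + 1)"
    by (intro powr_mono) (auto, linarith?)
  ultimately have "l < 1 / 2 powi k \<and> 1 / 2 powi k \<le> 2 * l" using l unfolding e by (simp add: powr_add)
  then show ?thesis by blast
qed

text \<open>The one-third trick: an interval shorter than a third of the grid length cannot contain
  breakpoints of both the shifted and the unshifted grid. Each coordinate picks its own grid, which
  is why a shift is a function on \<open>'n\<close>. The scale with
  \<open>3 * l < 1 / 2 powi k \<le> 6 * l\<close> accounts for the factor \<open>6\<close> per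
  dimension.\<close>

lemma cube_subset_grid_cube:
  fixes Q :: "(real ^ 'n) set"
  assumes "cube Q"
  shows "\<exists>s. \<exists>P\<in>grid s. Q \<subseteq> P \<and> emeasure lebesgue P \<le> 6 ^ CARD('n) * emeasure lebesgue Q"
proof -
  obtain a l where l: "0 < l" and b: "box a (\<chi> i. a $ i + l) \<subseteq> Q" "Q \<subseteq> cbox a (\<chi> i. a $ i + l)"
    using cube_bounds[OF assms] .
  obtain k :: int where k: "3 * l < 1 / 2 powi k" "1 / 2 powi k \<le> 6 * l"
    using exists_dyadic_scale[of "3*l"] l by auto
  have k': "2 powi k * l < 1/3" using k(1) by (simp add: field_simps)
  have "\<exists>\<sigma>. \<lfloor>2 powi k * (a $ i + l) + grid_offset \<sigma> k\<rfloor> = \<lfloor>2 powi k * a $ i + grid_offset \<sigma> k\<rfloor>" for i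
  proof (rule ccontr)
    define A where "A = 2 powi k * a $ i"
    define h where "h = 2 powi k * l"
    define d :: real where "d = grid_offset True k"
    assume "\<nexists>\<sigma>. \<lfloor>2 powi k * (a $ i + l) + grid_offset \<sigma> k\<rfloor> = \<lfloor>2 powi k * a $ i + grid_offset \<sigma> k\<rfloor>"
    then have n: "\<lfloor>A + h + grid_offset \<sigma> k\<rfloor> \<noteq> \<lfloor>A + grid_offset \<sigma> k\<rfloor>" for \<sigma>
      by (auto simp: A_def h_def distrib_left)
    have h: "0 < h" "h < 1/3" using k' l by (auto simp: h_def)
    have n0: "\<lfloor>A + h\<rfloor> \<noteq> \<lfloor>A\<rfloor>" using n[of False] by (simp add: grid_offset_def)
    have n1: "\<lfloor>A + h + d\<rfloor> \<noteq> \<lfloor>A + d\<rfloor>" using n[of True] by (simp add: d_def)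
    have d: "d = 1/3 \<or> d = -1/3" by (auto simp: d_def grid_offset_def)
    define j where "j = \<lfloor>A + h\<rfloor>"
    have j: "A < j" "j \<le> A + h" using n0 h unfolding j_def by linarith+
    define j' where "j' = \<lfloor>A + h + d\<rfloor>"
    have j': "A + d < j'" "j' \<le> A + h + d" using n1 h unfolding j'_def by linarith+
    \<comment> \<open>\<open>j\<close> and \<open>j' - d\<close> are breakpoints of the two grids in
      the same interval of length \<open>h < 1/3\<close>, while \<open>d\<close> has distance at
      least \<open>1/3\<close> from every integer.\<close>
    have "\<bar>real_of_int j' - real_of_int j - d\<bar> < 1/3" using j j' h by linarith
    moreover have "j' - j \<le> -1 \<or> j' - j = 0 \<or> j' - j \<ge> 1" by linarith
    ultimately show False using d by linarith
  qed
  then obtain s where s: "\<And>i. \<lfloor>2 powi k * (a $ i + l) + grid_offset (s i) k\<rfloor> = \<lfloor>2 powi k * a $ i + grid_offset (s i) k\<rfloor>"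
    by metis
  have "Q \<subseteq> grid_cube s k a"
  proof
    fix x assume "x \<in> Q"
    then have x: "a $ i \<le> x $ i" "x $ i \<le> a $ i + l" for i
      using b(2) by (auto simp: mem_box_cart dest!: subsetD)
    have "grid_index s k x i = grid_index s k a i" for i
    proof -
      have "2 powi k * a $ i \<le> 2 powi k * x $ i" "2 powi k * x $ i \<le> 2 powi k * (a $ i + l)"
        using x[of i] by (auto intro: mult_left_mono)
      then show ?thesis using s[of i] unfolding grid_index_def by linarith
    qed
    then show "x \<in> grid_cube s k a" by (auto simp: grid_cube_def)
  qed
  moreover have "emeasure lebesgue (grid_cube s k a) \<le> 6 ^ CARD('n) * emeasure lebesgue Q"
  proof -
    have "emeasure lebesgue (grid_cube s k a) \<le> ennreal ((6 * l) ^ CARD('n))"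
      unfolding emeasure_grid_cube using k(2) by (intro ennreal_leI power_mono) auto
    also have "\<dots> = 6 ^ CARD('n) * ennreal (l ^ CARD('n))"
      using l by (simp add: power_mult_distrib ennreal_mult' ennreal_power[symmetric])
    also have "\<dots> \<le> 6 ^ CARD('n) * emeasure lebesgue Q"
      using emeasure_mono[OF b(1), of lebesgue] cube_lebesgue(1)[OF assms]
      by (intro mult_left_mono) (auto simp: emeasure_box_side[OF l])
    finally show ?thesis .
  qed
  ultimately show ?thesis by blast
qed

subsection \<open>Families of grid cubes\<close>

lemma emeasure_disjoint_Union_mono:
  assumes "countable \<G>" "disjoint \<G>" "\<G> \<subseteq> sets M" "\<G> \<subseteq> sets N"
    and "\<And>V. V \<in> \<G> \<Longrightarrow> emeasure M V \<le> emeasure N V"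
  shows "emeasure M (\<Union>\<G>) \<le> emeasure N (\<Union>\<G>)"
proof -
  have d: "disjoint_family_on (\<lambda>V. V) \<G>"
    using assms(2) by (auto simp: disjoint_family_on_def disjoint_def pairwise_def disjnt_def)
  have "emeasure M (\<Union>\<G>) = (\<integral>\<^sup>+V. emeasure M V \<partial>count_space \<G>)"
    using emeasure_UN_countable[of \<G> "\<lambda>V. V" M] assms(1,3) d by (auto simp: subset_iff)
  also have "\<dots> \<le> (\<integral>\<^sup>+V. emeasure N V \<partial>count_space \<G>)"
    using assms(5) by (intro nn_integral_mono) auto
  also have "\<dots> = emeasure N (\<Union>\<G>)"
    using emeasure_UN_countable[of \<G> "\<lambda>V. V" N] assms(1,4) d by (auto simp: subset_iff)
  finally show ?thesis .
qed

lemma sum_emeasure_disjoint: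
  assumes "finite F" "disjoint F" "F \<subseteq> sets M"
  shows "(\<Sum>V\<in>F. emeasure M V) = emeasure M (\<Union>F)"
proof -
  have "disjoint_family_on (\<lambda>V. V) F"
    using assms(2) by (auto simp: disjoint_family_on_def disjoint_def pairwise_def disjnt_def)
  then show ?thesis using sum_emeasure[of "\<lambda>V. V" F M] assms(1,3) by simp
qed

text \<open>The maximal members are disjoint because grid cubes are nested, and by finiteness every
  member lies in a maximal one.\<close>

lemma grid_finite_disjoint_subfamily:
  assumes "finite H" "H \<subseteq> grid s"
  shows "\<exists>F\<subseteq>H. disjoint F \<and> \<Union>F = \<Union>H"
proof (intro exI[of _ "{V\<in>H. \<forall>W\<in>H. V \<subseteq> W \<longrightarrow> W = V}"] conjI)
  let ?F = "{V\<in>H. \<forall>W\<in>H. V \<subseteq> W \<longrightarrow> W = V}"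
  show "?F \<subseteq> H" by simp
  show "disjoint ?F"
  proof (rule disjointI)
    fix A B assume "A \<in> ?F" "B \<in> ?F" "A \<noteq> B"
    then show "A \<inter> B = {}" using grid_nested[of A s B] assms(2) by blast
  qed
  show "\<Union>?F = \<Union>H"
  proof
    show "\<Union>H \<subseteq> \<Union>?F"
    proof
      fix x assume "x \<in> \<Union>H"
      then obtain V where V: "V \<in> H" "x \<in> V" by blast
      obtain W where W: "W \<in> H" "V \<subseteq> W" "\<And>B. B \<in> H \<Longrightarrow> W \<subseteq> B \<Longrightarrow> W = B"
        using finite_has_maximal2[OF assms(1) V(1)] by metis
      have "W \<in> ?F" using W(1) W(3)[symmetric] by simp
      moreover have "x \<in> W" using V(2) W(2) by (rule subsetD[rotated])
      ultimately show "x \<in> \<Union>?F" by (rule UnionI)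
    qed
    show "\<Union>?F \<subseteq> \<Union>H" by (rule Union_mono) simp
  qed
qed

text \<open>This replaces a covering lemma. The family is exhausted by finite ones, and each of
  these has the same union as a disjoint subfamily. A bound known only for finite disjoint families,
  as in the S-infinity condition, thus passes to unions of nested families with the same
  constant.\<close>

lemma emeasure_grid_Union_le:
  fixes s :: "'n::finite \<Rightarrow> bool"
  assumes G: "\<G> \<subseteq> grid s" and M: "sets M = sets lebesgue"
    and le: "\<And>F. finite F \<Longrightarrow> F \<subseteq> \<G> \<Longrightarrow> disjoint F \<Longrightarrow> (\<Sum>V\<in>F. emeasure M V) \<le> B"
  shows "emeasure M (\<Union>\<G>) \<le> B"
proof (cases "\<G> = {}")
  case False
  have c: "countable \<G>" using countable_grid G countable_subset by blast
  define X where "X = (\<lambda>n. \<Union>(from_nat_into \<G> ` {..n::nat}))"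
  have sub: "from_nat_into \<G> ` {..n} \<subseteq> \<G>" for n
    using from_nat_into[OF False] by blast
  have s: "V \<in> sets M" if "V \<in> \<G>" for V using that G M grid_sets by blast
  have U: "(\<Union>n. X n) = \<Union>\<G>"
  proof -
    have "range (from_nat_into \<G>) = \<G>" using range_from_nat_into[OF False c] .
    moreover have "(\<Union>n. X n) = \<Union>(range (from_nat_into \<G>))" unfolding X_def by auto
    ultimately show ?thesis by simp
  qed
  have "emeasure M (\<Union>\<G>) = (SUP n. emeasure M (X n))"
    unfolding U[symmetric]
  proof (rule SUP_emeasure_incseq[symmetric])
    show "range X \<subseteq> sets M" using sub s unfolding X_def by (fastforce intro!: sets.finite_Union)
    show "incseq X" unfolding X_def by (force simp: incseq_def)
  qed
  also have "\<dots> \<le> B"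
  proof (rule SUP_least)
    fix n
    obtain F where F: "F \<subseteq> from_nat_into \<G> ` {..n}" "disjoint F" "\<Union>F = X n"
      using grid_finite_disjoint_subfamily[of "from_nat_into \<G> ` {..n}" s] sub G unfolding X_def by blast
    have fin: "finite F" using F(1) finite_surj by blast
    have FG: "F \<subseteq> \<G>" using F(1) sub by blast
    have "emeasure M (X n) = (\<Sum>V\<in>F. emeasure M V)"
      using sum_emeasure_disjoint[OF fin F(2)] F(3) FG s by (metis subsetD subsetI)
    then show "emeasure M (X n) \<le> B" using le[OF fin FG F(2)] by simp
  qed
  finally show ?thesis .
qed simp

section \<open>Differentiation along a grid\<close>

lemma grid_cube_dist:
  fixes x :: "real ^ 'n"
  assumes "y \<in> grid_cube s k x"
  shows "dist y x \<le> real CARD('n) * (1 / 2 powi k)"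
proof -
  have "\<bar>(y - x) $ i\<bar> \<le> 1 / 2 powi k" for i
  proof -
    obtain A :: real where "y $ i \<in> {A ..< A + 1 / 2 powi k}" "x $ i \<in> {A ..< A + 1 / 2 powi k}"
      using assms[unfolded grid_cube_interval] grid_cube_self[of x s k, unfolded grid_cube_interval] by blast
    then show ?thesis by (simp only: vector_minus_component atLeastLessThan_iff) linarith
  qed
  then have "norm (y - x) \<le> (\<Sum>i\<in>(UNIV::'n set). 1 / 2 powi k)"
    using norm_le_l1_cart[of "y - x"] by (meson order_trans sum_mono)
  then show ?thesis by (simp add: dist_norm)
qed

lemma grid_cube_subset_open:
  fixes x :: "real ^ 'n"
  assumes "open S" "x \<in> S"
  shows "\<exists>k\<ge>k0. grid_cube s k x \<subseteq> S"
proof -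
  obtain e where e: "e > 0" "\<And>y. dist y x < e \<Longrightarrow> y \<in> S"
    using assms unfolding open_dist by blast
  have "\<exists>k::int. 1 / 2 powi k \<le> e / (2 * real CARD('n))"
    using exists_dyadic_scale[of "e / (4 * real CARD('n))"] e(1) by auto
  then obtain k :: int where k: "1 / 2 powi k \<le> e / (2 * real CARD('n))" by blast
  define m where "m = max k k0"
  have "1 / 2 powi m \<le> (1::real) / 2 powi k"
    by (intro divide_left_mono power_int_increasing) (auto simp: m_def)
  then have "real CARD('n) * (1 / 2 powi m) \<le> real CARD('n) * (e / (2 * real CARD('n)))"
    using k by (intro mult_left_mono) auto
  also have "\<dots> < e" using e(1) by simp
  finally have "grid_cube s m x \<subseteq> S" using grid_cube_dist[of _ s m x] e(2) by fastforce
  then show ?thesis unfolding m_def by (intro exI[of _ m]) (auto simp: m_def)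
qed

lemma grid_cube_generation:
  assumes "V \<in> grid s" "Q = grid_cube s k x" "V \<subseteq> Q" "x \<in> V"
  shows "\<exists>l\<ge>k. V = grid_cube s l x"
proof -
  obtain l where l: "V = grid_cube s l x" using assms(1,4) by (auto simp: grid_def dest: grid_cube_eq)
  show ?thesis
  proof (cases "l \<ge> k")
    case False
    then have "Q \<subseteq> V" using grid_cube_mono[of l k s x] assms(2) l by auto
    then show ?thesis using assms by auto
  qed (use l in auto)
qed

text \<open>A one-sided differentiation theorem, obtained by covering and without integrability of
  \<open>u\<close>. Let \<open>u > t + e\<close> on \<open>Z\<close> although no cube around a point
  of \<open>Z\<close> is bad. Grid cubes meeting \<open>Z\<close> inside an open set barely larger
  than \<open>Z\<close> cover it, and on each of them \<open>t + e\<close> times the volume of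
  \<open>Z\<close> is at most \<open>t\<close> times the volume of the cube; hence
  \<open>(t + e) * z \<le> t * (z + \<eta>)\<close>.\<close>

lemma grid_differentiation:
  fixes u :: "real ^ 'n \<Rightarrow> ennreal" and t :: real
  assumes u: "u \<in> borel_measurable lebesgue" and Q: "Q \<in> grid s" and t: "0 \<le> t"
  shows "AE x in lebesgue. x \<in> Q \<longrightarrow>
    (\<forall>V\<in>grid s. x \<in> V \<longrightarrow> V \<subseteq> Q \<longrightarrow> (\<integral>\<^sup>+y\<in>V. u y \<partial>lebesgue) \<le> ennreal t * emeasure lebesgue V) \<longrightarrow> u x \<le> ennreal t"
proof -
  define \<B> where "\<B> = {V\<in>grid s. V \<subseteq> Q \<and> \<not> (\<integral>\<^sup>+y\<in>V. u y \<partial>lebesgue) \<le> ennreal t * emeasure lebesgue V}"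
  have cB: "countable \<B>" unfolding \<B>_def using countable_grid by (rule countable_subset[rotated]) auto
  have Qs [measurable]: "Q \<in> sets lebesgue" using Q by (rule grid_sets)
  have Bs [measurable]: "\<Union>\<B> \<in> sets lebesgue"
    using cB by (intro sets.countable_Union) (auto simp: \<B>_def grid_sets)
  note u [measurable]
  have *: "emeasure lebesgue {x\<in>Q - \<Union>\<B>. u x > ennreal (t + e)} = 0" if e: "e > 0" for e :: real
  proof -
    define Z where "Z = {x\<in>Q - \<Union>\<B>. u x > ennreal (t + e)}"
    have Zs [measurable]: "Z \<in> sets lebesgue"
    proof -
      have "Z = (Q - \<Union>\<B>) \<inter> {x \<in> space lebesgue. u x > ennreal (t + e)}" by (auto simp: Z_def)
      then show ?thesis by simp
    qed
    have "emeasure lebesgue Z \<le> emeasure lebesgue Q" by (intro emeasure_mono) (auto simp: Z_def)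
    then have Zf: "emeasure lebesgue Z < \<infinity>" using cube_emeasure(2)[OF cube_grid[OF Q]] by auto
    then obtain z where z: "0 \<le> z" "emeasure lebesgue Z = ennreal z" by (cases "emeasure lebesgue Z") auto
    define M where "M = density lebesgue (\<lambda>x. ennreal (t + e) * indicator Z x)"
    have M: "emeasure M A = ennreal (t + e) * emeasure lebesgue (A \<inter> Z)" if "A \<in> sets lebesgue" for A
    proof -
      have "emeasure M A = (\<integral>\<^sup>+x. ennreal (t + e) * indicator (A \<inter> Z) x \<partial>lebesgue)"
        unfolding M_def using that
        by (subst emeasure_density) (auto intro!: nn_integral_cong simp: indicator_def)
      also have "\<dots> = ennreal (t + e) * emeasure lebesgue (A \<inter> Z)"
        using that by (subst nn_integral_cmult_indicator) auto
      finally show ?thesis .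
    qed
    have "(t + e) * z \<le> t * (z + \<eta>)" if \<eta>: "\<eta> > 0" for \<eta>
    proof -
      obtain S where S: "open S" "Z \<subseteq> S" "emeasure lebesgue (S - Z) < ennreal \<eta>"
        using sets_lebesgue_outer_open[OF Zs \<eta>] by metis
      have Ss [measurable]: "S \<in> sets lebesgue" using S(1) by (simp add: borel_open)
      define \<G> where "\<G> = {V\<in>grid s. V \<subseteq> S \<inter> Q \<and> V \<inter> Z \<noteq> {}}"
      have cover: "Z \<subseteq> \<Union>\<G>"
      proof
        fix x assume x: "x \<in> Z"
        then obtain k where k: "Q = grid_cube s k x" using Q by (auto simp: Z_def grid_def dest: grid_cube_eq)
        obtain l where "l \<ge> k" "grid_cube s l x \<subseteq> S" using grid_cube_subset_open[OF S(1), of x k s] x S(2) by blast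
        moreover have "grid_cube s l x \<subseteq> Q" unfolding k using \<open>l \<ge> k\<close> by (rule grid_cube_mono)
        ultimately have "grid_cube s l x \<in> \<G>" unfolding \<G>_def using x by (force simp: grid_cube_self)
        then show "x \<in> \<Union>\<G>" using grid_cube_self by blast
      qed
      have Gs: "\<Union>\<G> \<in> sets lebesgue"
        by (intro sets.countable_Union countable_subset[OF _ countable_grid[of s]]) (auto simp: \<G>_def grid_sets)
      have "emeasure M (\<Union>\<G>) \<le> ennreal t * emeasure lebesgue S"
      proof (rule emeasure_grid_Union_le[of _ s])
        show "\<G> \<subseteq> grid s" by (auto simp: \<G>_def)
        show "sets M = sets lebesgue" by (simp add: M_def)
        fix F assume F: "finite F" "F \<subseteq> \<G>" "disjoint F"
        have V: "emeasure M V \<le> ennreal t * emeasure lebesgue V" if "V \<in> F" for V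
        proof -
          have VG: "V \<in> grid s" "V \<subseteq> Q" "V \<inter> Z \<noteq> {}" using that F(2) by (auto simp: \<G>_def)
          have Vs: "V \<in> sets lebesgue" using VG(1) grid_sets by blast
          have "emeasure M V = (\<integral>\<^sup>+x. ennreal (t + e) * indicator (V \<inter> Z) x \<partial>lebesgue)"
            unfolding M[OF Vs] using Vs by (subst nn_integral_cmult_indicator) auto
          also have "\<dots> \<le> (\<integral>\<^sup>+y\<in>V. u y \<partial>lebesgue)"
            by (intro nn_integral_mono) (auto simp: indicator_def Z_def)
          also have "\<dots> \<le> ennreal t * emeasure lebesgue V"
            using VG unfolding Z_def \<B>_def by blast
          finally show ?thesis .
        qed
        have "(\<Sum>V\<in>F. emeasure M V) \<le> (\<Sum>V\<in>F. ennreal t * emeasure lebesgue V)"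
          using V by (rule sum_mono)
        also have "\<dots> = ennreal t * (\<Sum>V\<in>F. emeasure lebesgue V)" by (simp add: sum_distrib_left)
        also have "(\<Sum>V\<in>F. emeasure lebesgue V) = emeasure lebesgue (\<Union>F)"
          using F by (intro sum_emeasure_disjoint) (auto simp: \<G>_def grid_sets)
        also have "\<dots> \<le> emeasure lebesgue S"
          using F(2) by (intro emeasure_mono) (auto simp: \<G>_def)
        finally show "(\<Sum>V\<in>F. emeasure M V) \<le> ennreal t * emeasure lebesgue S" by (simp add: mult_left_mono)
      qed
      moreover have "emeasure M (\<Union>\<G>) = ennreal (t + e) * ennreal z"
        using M[OF Gs] cover z(2) by (simp add: Int_absorb1)
      moreover have "emeasure lebesgue S \<le> ennreal (z + \<eta>)"
      proof -
        have "emeasure lebesgue S = emeasure lebesgue Z + emeasure lebesgue (S - Z)"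
          using S(2) by (subst plus_emeasure) (auto simp: Un_absorb1)
        also have "\<dots> \<le> ennreal z + ennreal \<eta>" using S(3) z(2) by (intro add_mono) auto
        finally show ?thesis using z(1) \<eta> by simp
      qed
      ultimately have "ennreal (t + e) * ennreal z \<le> ennreal t * ennreal (z + \<eta>)"
        using mult_left_mono[of "emeasure lebesgue S" "ennreal (z + \<eta>)" "ennreal t"] by auto
      then show ?thesis using t e z(1) \<eta> by (simp add: ennreal_mult'[symmetric] del: ennreal_plus)
    qed
    then have "e * z \<le> t * \<eta>" if "\<eta> > 0" for \<eta> using that by (auto simp: algebra_simps)
    then have "e * z \<le> 0 + d" if "d > 0" for d
    proof -
      have "e * z \<le> t * (d / (t + 1))"
        using that t by (intro \<open>\<And>\<eta>. 0 < \<eta> \<Longrightarrow> e * z \<le> t * \<eta>\<close>) simp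
      also have "\<dots> \<le> d" using t that by (simp add: field_simps)
      finally show ?thesis by simp
    qed
    then have "e * z \<le> 0" by (rule field_le_epsilon)
    then have "z = 0" using e z(1) by (simp add: mult_le_0_iff)
    then show ?thesis using z(2) by (simp add: Z_def)
  qed
  have "AE x in lebesgue. \<not> (x \<in> Q - \<Union>\<B> \<and> u x > ennreal (t + 1 / real (Suc j)))" for j
  proof (rule AE_I)
    show "{x \<in> space lebesgue. \<not> \<not> (x \<in> Q - \<Union>\<B> \<and> u x > ennreal (t + 1 / real (Suc j)))}
       \<subseteq> {x\<in>Q - \<Union>\<B>. u x > ennreal (t + 1 / real (Suc j))}" by auto
    show "{x\<in>Q - \<Union>\<B>. u x > ennreal (t + 1 / real (Suc j))} \<in> sets lebesgue"
    proof -
      have "{x\<in>Q - \<Union>\<B>. u x > ennreal (t + 1 / real (Suc j))} = (Q - \<Union>\<B>) \<inter> {x \<in> space lebesgue. u x > ennreal (t + 1 / real (Suc j))}"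
        by auto
      then show ?thesis by simp
    qed
  qed (rule *, simp)
  then have "AE x in lebesgue. \<forall>j. \<not> (x \<in> Q - \<Union>\<B> \<and> u x > ennreal (t + 1 / real (Suc j)))"
    unfolding AE_all_countable by blast
  then show ?thesis
  proof eventually_elim
    case (elim x)
    show ?case
    proof (intro impI)
      assume "x \<in> Q" "\<forall>V\<in>grid s. x \<in> V \<longrightarrow> V \<subseteq> Q \<longrightarrow> (\<integral>\<^sup>+y\<in>V. u y \<partial>lebesgue) \<le> ennreal t * emeasure lebesgue V"
      then have "x \<in> Q - \<Union>\<B>" by (auto simp: \<B>_def)
      then have le: "u x \<le> ennreal (t + 1 / real (Suc j))" for j using elim by (meson not_le)
      have "(\<lambda>j. ennreal (t + 1 / real (Suc j))) \<longlonglongrightarrow> ennreal (t + 0)"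
        by (intro tendsto_ennrealI tendsto_add tendsto_const LIMSEQ_Suc[OF lim_1_over_n])
      then show "u x \<le> ennreal t" using le by (intro LIMSEQ_le_const[of "\<lambda>j. ennreal (t + 1 / real (Suc j))"]) auto
    qed
  qed
qed

subsection \<open>A reverse Hoelder inequality\<close>

declare emeasure_completion [simp del]

text \<open>Stop at the maximal cubes on which the average of \<open>u\<close> reaches \<open>T a\<^sup>j\<close>. A stopping cube not
  contained in \<open>U\<close> has a fixed proportion of its mass outside the next generation, so the mass
  of these cubes decays geometrically in \<open>j\<close>.\<close>
lemma reverse_Hoelder_aux:
  fixes s :: "'n::finite \<Rightarrow> bool" and Q U :: "(real ^ 'n) set" and u :: "real ^ 'n \<Rightarrow> real"
  assumes \<kappa>: "0 < \<kappa>" "\<kappa> \<le> 1" and \<delta>: "0 < \<delta>" "\<delta> \<le> 1"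
    and a_def: "a = 2 * 2 ^ CARD('n) / \<kappa>" and \<eta>_def: "\<eta> = \<delta> * \<kappa> / 2"
    and Q: "Q \<in> grid s" and U [measurable]: "U \<in> sets lebesgue"
    and u [measurable]: "u \<in> borel_measurable lebesgue" and u0: "\<And>x. 0 \<le> u x"
    and T: "0 < T" "(\<integral>\<^sup>+x\<in>Q. ennreal (u x) \<partial>lebesgue) = ennreal T * emeasure lebesgue Q"
    and good: "\<And>V. V \<in> grid s \<Longrightarrow> V \<subseteq> Q \<Longrightarrow> \<not> V \<subseteq> U \<Longrightarrow>
      \<exists>c\<ge>0. (\<integral>\<^sup>+x\<in>V. ennreal (u x) \<partial>lebesgue) \<le> ennreal c * emeasure lebesgue V \<and>
        ennreal \<kappa> * emeasure lebesgue V \<le> emeasure lebesgue {x\<in>V. \<delta> * c \<le> u x}"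
    and \<epsilon>: "0 < \<epsilon>" "a powr \<epsilon> * (1 - \<eta>) \<le> r" "r < 1"
  shows "(\<integral>\<^sup>+x\<in>Q - U. ennreal (u x powr (1 + \<epsilon>)) \<partial>lebesgue)
    \<le> ennreal (a powr \<epsilon> * T powr (1 + \<epsilon>) / (1 - r)) * emeasure lebesgue Q"
proof -
  define N :: real where "N = 2 ^ CARD('n)"
  have N: "N \<ge> 1" by (simp add: N_def)
  have aN: "a = 2 * N / \<kappa>" by (simp add: a_def N_def)
  have a2: "a \<ge> 2" using \<kappa> N unfolding aN by (simp add: field_simps)
  have \<eta>: "0 < \<eta>" "\<eta> \<le> 1/2" using \<kappa> \<delta> mult_mono[of \<delta> 1 \<kappa> 1] by (auto simp: \<eta>_def)
  define t where "t = (\<lambda>j::nat. T * a ^ j)"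
  have t: "t j > 0" "t (Suc j) = a * t j" "t 0 = T" for j using T a2 by (auto simp: t_def)
  have t_le: "t j \<le> t (Suc j)" for j using a2 t(1)[of j] t(2)[of j] by (simp add: mult_le_cancel_right1)
  have tT: "T \<le> t j" for j
  proof (induction j)
    case (Suc j) then show ?case using t_le[of j] by linarith
  qed (simp add: t)
  define \<nu> where "\<nu> = density lebesgue (\<lambda>x. ennreal (u x))"
  have \<nu>: "emeasure \<nu> A = (\<integral>\<^sup>+x\<in>A. ennreal (u x) \<partial>lebesgue)" if "A \<in> sets lebesgue" for A
    unfolding \<nu>_def using that by (simp add: emeasure_density)
  have s\<nu> [simp, measurable_cong]: "sets \<nu> = sets lebesgue" by (simp add: \<nu>_def)
  have gs: "V \<in> sets lebesgue" if "V \<in> grid s" for V using that by (rule grid_sets)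
  have Qs [measurable]: "Q \<in> sets lebesgue" using Q gs by blast
  have \<nu>Q: "emeasure \<nu> Q = ennreal T * emeasure lebesgue Q" using T(2) \<nu> by simp
  have Qe: "0 < emeasure lebesgue Q" "emeasure lebesgue Q < \<infinity>"
    using cube_emeasure[OF cube_grid[OF Q]] by auto
  have \<nu>fin: "emeasure \<nu> A < \<infinity>" if "A \<subseteq> Q" for A
    using emeasure_mono[OF that, of \<nu>] \<nu>Q Qe(2) by (auto simp: ennreal_mult_less_top intro: le_less_trans)
  have Vpos: "0 < emeasure lebesgue V" "emeasure lebesgue V < \<infinity>" if "V \<in> grid s" for V
    using cube_emeasure[OF cube_grid[OF that]] by auto
  obtain k0 where k0: "\<And>x. x \<in> Q \<Longrightarrow> Q = grid_cube s k0 x"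
    using Q by (auto simp: grid_def dest: grid_cube_eq)
  define heavy where "heavy = (\<lambda>j V. ennreal (t j) * emeasure lebesgue V \<le> emeasure \<nu> V)"
  define \<G> where "\<G> = (\<lambda>j. {V\<in>grid s. V \<subseteq> Q \<and> heavy j V \<and> (\<forall>W\<in>grid s. V \<subset> W \<longrightarrow> W \<subseteq> Q \<longrightarrow> \<not> heavy j W)})"
  define D where "D = (\<lambda>j. \<Union>(\<G> j))"
  define G where "G = (\<lambda>j. \<Union>{V\<in>\<G> j. \<not> V \<subseteq> U})"
  have heavy_le: "heavy j V" if "heavy (Suc j) V" for j V
    using that t_le[of j] unfolding heavy_def
    by (meson ennreal_leI mult_right_mono order_trans zero_le)
  have cG: "countable (\<G> j)" for j
    by (rule countable_subset[OF _ countable_grid[of s]]) (auto simp: \<G>_def)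
  have Ggrid: "V \<in> grid s" "V \<subseteq> Q" "V \<in> sets lebesgue" if "V \<in> \<G> j" for V j
    using that gs by (auto simp: \<G>_def)
  have Ds [measurable]: "D j \<in> sets lebesgue" for j
    unfolding D_def using cG Ggrid(3) by (intro sets.countable_Union) auto
  have Gs [measurable]: "G j \<in> sets lebesgue" for j
    unfolding G_def using Ggrid(3) by (intro sets.countable_Union countable_subset[OF _ cG[of j]]) auto
  have disj: "disjoint (\<G> j)" for j
  proof (rule disjointI)
    fix A B assume "A \<in> \<G> j" "B \<in> \<G> j" "A \<noteq> B"
    then show "A \<inter> B = {}" using grid_nested[of A s B] unfolding \<G>_def by blast
  qed
  have inD: "\<exists>W\<in>\<G> j. V \<subseteq> W" if V: "V \<in> grid s" "V \<subseteq> Q" "heavy j V" for V j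
  proof -
    obtain x where x: "x \<in> V" using grid_nonempty[OF V(1)] by blast
    then have Qx: "Q = grid_cube s k0 x" using k0 V(2) by blast
    obtain l where l: "l \<ge> k0" "V = grid_cube s l x"
      using grid_cube_generation[OF V(1) Qx V(2) x] by blast
    define P where "P = (\<lambda>i::nat. heavy j (grid_cube s (k0 + int i) x))"
    define i where "i = (LEAST i. P i)"
    have P: "P (nat (l - k0))" using l V(3) by (simp add: P_def)
    have Pi: "P i" unfolding i_def using P by (rule LeastI)
    have il: "i \<le> nat (l - k0)" unfolding i_def using P by (rule Least_le)
    define W where "W = grid_cube s (k0 + int i) x"
    have VW: "V \<subseteq> W" unfolding W_def l(2) using il l(1) by (intro grid_cube_mono) auto
    have WQ: "W \<subseteq> Q" unfolding W_def Qx by (intro grid_cube_mono) auto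
    have "\<not> heavy j W'" if W': "W' \<in> grid s" "W \<subset> W'" "W' \<subseteq> Q" for W'
    proof
      assume h: "heavy j W'"
      have xW': "x \<in> W'" using W'(2) grid_cube_self[of x s "k0 + int i"] unfolding W_def by blast
      obtain m where m: "m \<ge> k0" "W' = grid_cube s m x"
        using grid_cube_generation[OF W'(1) Qx W'(3) xW'] by blast
      have "\<not> k0 + int i \<le> m" using grid_cube_mono[of "k0 + int i" m s x] W'(2) m(2) by (auto simp: W_def)
      then have "nat (m - k0) < i" using m(1) by linarith
      moreover have "P (nat (m - k0))" using h m by (simp add: P_def)
      ultimately show False unfolding i_def using not_less_Least by blast
    qed
    then have "W \<in> \<G> j" unfolding \<G>_def using WQ Pi by (auto simp: W_def P_def)
    then show ?thesis using VW by blast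
  qed
  \<comment> \<open>By maximality the grid parent of a stopping cube is not heavy, which costs the
    factor \<open>N\<close>. Only \<open>Q\<close> itself has no parent to test, and its average is
    exactly \<open>T\<close>.\<close>
  have upper: "emeasure \<nu> V \<le> ennreal (N * t j) * emeasure lebesgue V" if V: "V \<in> \<G> j" for V j
  proof (cases "V = Q")
    case True
    have "T \<le> N * t j" using tT[of j] N mult_right_mono[of 1 N "t j"] t(1)[of j] by linarith
    then show ?thesis unfolding True \<nu>Q by (intro mult_right_mono ennreal_leI) auto
  next
    case False
    obtain x where x: "x \<in> V" using grid_nonempty[OF Ggrid(1)[OF V]] by blast
    then have Qx: "Q = grid_cube s k0 x" using k0 Ggrid(2)[OF V] by blast
    obtain l where l: "l \<ge> k0" "V = grid_cube s l x"
      using grid_cube_generation[OF Ggrid(1)[OF V] Qx Ggrid(2)[OF V] x] by blast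
    have lk: "l - 1 \<ge> k0" using l False Qx by (cases "l = k0") auto
    define W where "W = grid_cube s (l - 1) x"
    have W: "W \<in> grid s" "W \<subseteq> Q" "V \<subseteq> W"
      unfolding W_def Qx l(2) using lk grid_cube_mono[of k0 "l - 1" s x] grid_cube_mono[of "l - 1" l s x] by auto
    have mW: "emeasure lebesgue W = ennreal N * emeasure lebesgue V"
      using emeasure_grid_cube_Suc[of s "l - 1" x] unfolding W_def l(2) N_def
      by (simp add: ennreal_power[symmetric])
    have "V \<noteq> W"
    proof
      assume "V = W"
      then have "V = grid_cube s (l - 1) x" by (simp add: W_def)
      then have e: "emeasure lebesgue (grid_cube s l x) = emeasure lebesgue (grid_cube s (l - 1) x)" using l(2) by simp
      have "(1 / 2 powi l) ^ CARD('n) < ((1::real) / 2 powi (l - 1)) ^ CARD('n)"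
        by (intro power_strict_mono divide_strict_left_mono power_int_strict_increasing) auto
      then show False using e unfolding emeasure_grid_cube by simp
    qed
    then have "\<not> heavy j W" using V W unfolding \<G>_def by blast
    then have "emeasure \<nu> W \<le> ennreal (t j) * emeasure lebesgue W" unfolding heavy_def by simp
    moreover have "emeasure \<nu> V \<le> emeasure \<nu> W" using W gs by (intro emeasure_mono) auto
    ultimately show ?thesis unfolding mW using t(1)[of j] N
      by (simp add: ennreal_mult' mult_ac)
  qed
  have nest: "V' \<subseteq> V" if "V \<in> \<G> j" "V' \<in> \<G> (Suc j)" "V \<inter> V' \<noteq> {}" for V V' j
  proof (rule ccontr)
    assume n: "\<not> V' \<subseteq> V"
    then have "V \<subset> V'" using grid_nested[of V s V'] that Ggrid by blast
    moreover have "heavy j V'" using that(2) heavy_le by (auto simp: \<G>_def)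
    ultimately show False using that(1) Ggrid[OF that(2)] unfolding \<G>_def by blast
  qed
  \<comment> \<open>By the choice of \<open>a\<close>, the quotient
    \<open>N * t j / t (Suc j)\<close> equals \<open>\<kappa> / 2\<close>, half of the proportion on
    which \<open>u\<close> is known to be large.\<close>
  have small: "emeasure lebesgue (V \<inter> D (Suc j)) \<le> ennreal (\<kappa> / 2) * emeasure lebesgue V" if V: "V \<in> \<G> j" for V j
  proof -
    define \<H> where "\<H> = {V'\<in>\<G> (Suc j). V \<inter> V' \<noteq> {}}"
    have VD: "V \<inter> D (Suc j) = \<Union>\<H>" using nest[OF V] by (auto simp: D_def \<H>_def)
    have "emeasure (scale_measure (ennreal (t (Suc j))) lebesgue) (\<Union>\<H>) \<le> emeasure \<nu> (\<Union>\<H>)"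
    proof (rule emeasure_disjoint_Union_mono)
      show "countable \<H>" using cG by (rule countable_subset[rotated]) (auto simp: \<H>_def)
      show "disjoint \<H>" using disj[of "Suc j"] by (auto simp: \<H>_def disjoint_def pairwise_def)
      show "\<H> \<subseteq> sets \<nu>" "\<H> \<subseteq> sets (scale_measure (ennreal (t (Suc j))) lebesgue)"
        using Ggrid by (auto simp: \<H>_def)
      fix W assume "W \<in> \<H>"
      then show "emeasure (scale_measure (ennreal (t (Suc j))) lebesgue) W \<le> emeasure \<nu> W"
        by (auto simp: \<H>_def \<G>_def heavy_def)
    qed
    then have "ennreal (t (Suc j)) * emeasure lebesgue (V \<inter> D (Suc j)) \<le> emeasure \<nu> (V \<inter> D (Suc j))"
      by (simp add: VD)
    also have "\<dots> \<le> emeasure \<nu> V" using Ggrid[OF V] by (intro emeasure_mono) auto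
    also have "\<dots> \<le> ennreal (N * t j) * emeasure lebesgue V" using upper[OF V] .
    also have "N * t j = t (Suc j) * (\<kappa> / 2)" using \<kappa> by (simp add: t aN)
    finally have "ennreal (t (Suc j)) * emeasure lebesgue (V \<inter> D (Suc j))
        \<le> ennreal (t (Suc j)) * (ennreal (\<kappa> / 2) * emeasure lebesgue V)"
      using t(1)[of "Suc j"] \<kappa> ennreal_mult[of "t (Suc j)" "\<kappa> / 2"] by (simp add: mult.assoc less_imp_le)
    then show ?thesis using t(1)[of "Suc j"] by (subst (asm) ennreal_mult_le_mult_iff) auto
  qed
  \<comment> \<open>After removal of the next generation, \<open>u \<ge> \<delta> * c\<close> still
    holds on a proportion \<open>\<kappa> / 2\<close> of \<open>V\<close>, so the fraction
    \<open>\<eta> = \<delta> * \<kappa> / 2\<close> of the mass stays outside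
    \<open>D (Suc j)\<close>.\<close>
  have decay1: "emeasure \<nu> (V \<inter> D (Suc j)) \<le> ennreal (1 - \<eta>) * emeasure \<nu> V" if V: "V \<in> \<G> j" "\<not> V \<subseteq> U" for V j
  proof -
    have Vs [measurable]: "V \<in> sets lebesgue" using Ggrid[OF V(1)] by auto
    obtain c where c: "c \<ge> 0" "emeasure \<nu> V \<le> ennreal c * emeasure lebesgue V"
        "ennreal \<kappa> * emeasure lebesgue V \<le> emeasure lebesgue {x\<in>V. \<delta> * c \<le> u x}"
      using good[OF Ggrid(1,2)[OF V(1)] V(2)] \<nu>[OF Vs] by auto
    define W where "W = {x\<in>V. \<delta> * c \<le> u x} - D (Suc j)"
    have W0s [measurable]: "{x\<in>V. \<delta> * c \<le> u x} \<in> sets lebesgue"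
    proof -
      have "{x\<in>V. \<delta> * c \<le> u x} = V \<inter> {x\<in>space lebesgue. \<delta> * c \<le> u x}" by auto
      then show ?thesis by simp
    qed
    have Ws [measurable]: "W \<in> sets lebesgue" unfolding W_def by simp
    obtain v where v: "emeasure lebesgue V = ennreal v" "v > 0"
      using Vpos[OF Ggrid(1)[OF V(1)]] by (cases "emeasure lebesgue V") auto
    have "ennreal \<kappa> * ennreal v \<le> emeasure lebesgue {x\<in>V. \<delta> * c \<le> u x}" using c(3) v by simp
    also have "\<dots> \<le> emeasure lebesgue (W \<union> (V \<inter> D (Suc j)))" by (intro emeasure_mono) (auto simp: W_def)
    also have "\<dots> \<le> emeasure lebesgue W + emeasure lebesgue (V \<inter> D (Suc j))" by (rule emeasure_subadditive) auto
    also have "\<dots> \<le> emeasure lebesgue W + ennreal (\<kappa> / 2) * ennreal v" using small[OF V(1)] v by (simp add: add_left_mono)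
    finally have "ennreal (\<kappa> * v) \<le> emeasure lebesgue W + ennreal (\<kappa> / 2 * v)"
      using \<kappa> v ennreal_mult[of \<kappa> v] ennreal_mult[of "\<kappa> / 2" v] by simp
    then have W: "ennreal (\<kappa> / 2 * v) \<le> emeasure lebesgue W"
      using \<kappa> v(2) by (cases "emeasure lebesgue W") (auto simp: ennreal_plus[symmetric] simp del: ennreal_plus)
    have "ennreal \<eta> * emeasure \<nu> V \<le> ennreal \<eta> * (ennreal c * ennreal v)"
      using c(2) v by (intro mult_left_mono) auto
    also have "\<dots> = ennreal (\<delta> * c) * ennreal (\<kappa> / 2 * v)"
      using \<eta> c(1) v(2) \<delta> \<kappa> by (simp add: ennreal_mult[symmetric] \<eta>_def)
    also have "\<dots> \<le> ennreal (\<delta> * c) * emeasure lebesgue W" using W by (rule mult_left_mono) simp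
    also have "\<dots> = (\<integral>\<^sup>+x. ennreal (\<delta> * c) * indicator W x \<partial>lebesgue)"
      by (subst nn_integral_cmult_indicator) auto
    also have "\<dots> \<le> (\<integral>\<^sup>+x\<in>W. ennreal (u x) \<partial>lebesgue)"
      by (intro nn_integral_mono) (auto simp: W_def indicator_def intro: ennreal_leI)
    also have "\<dots> = emeasure \<nu> W" by (simp add: \<nu>)
    also have "\<dots> \<le> emeasure \<nu> (V - D (Suc j))" by (intro emeasure_mono) (auto simp: W_def)
    finally have 1: "ennreal \<eta> * emeasure \<nu> V \<le> emeasure \<nu> (V - D (Suc j))" .
    have 2: "emeasure \<nu> V = emeasure \<nu> (V \<inter> D (Suc j)) + emeasure \<nu> (V - D (Suc j))"
      by (subst plus_emeasure) (auto simp: Int_Diff_Un)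
    obtain A where A: "emeasure \<nu> (V \<inter> D (Suc j)) = ennreal A" "0 \<le> A"
      using \<nu>fin[of "V \<inter> D (Suc j)"] Ggrid(2)[OF V(1)] by (cases "emeasure \<nu> (V \<inter> D (Suc j))") auto
    obtain B where B: "emeasure \<nu> (V - D (Suc j)) = ennreal B" "0 \<le> B"
      using \<nu>fin[of "V - D (Suc j)"] Ggrid(2)[OF V(1)] by (cases "emeasure \<nu> (V - D (Suc j))") auto
    have "\<eta> * (A + B) \<le> B"
      using 1 \<eta> A B unfolding 2 by (simp add: ennreal_plus[symmetric] ennreal_mult[symmetric] del: ennreal_plus)
    then have "A \<le> (1 - \<eta>) * (A + B)" by (simp add: algebra_simps)
    then show ?thesis using \<eta> A B unfolding 2
      by (simp add: ennreal_plus[symmetric] ennreal_mult[symmetric] del: ennreal_plus)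
  qed
  have inG: "x \<in> G j" if "x \<in> D j" "x \<notin> U" for x j
    using that by (auto simp: D_def G_def)
  have DSuc: "D (Suc j) \<subseteq> D j" for j
  proof
    fix x assume "x \<in> D (Suc j)"
    then obtain V where V: "V \<in> \<G> (Suc j)" "x \<in> V" by (auto simp: D_def)
    then have "heavy j V" by (auto simp: \<G>_def heavy_le)
    then show "x \<in> D j" using inD[OF Ggrid(1,2)[OF V(1)], of j] V(2) by (auto simp: D_def)
  qed
  have decay: "emeasure \<nu> (G (Suc j)) \<le> ennreal (1 - \<eta>) * emeasure \<nu> (G j)" for j
  proof -
    define \<H> where "\<H> = {V\<in>\<G> j. \<not> V \<subseteq> U}"
    define M where "M = density \<nu> (indicator (G (Suc j)))"
    have M: "emeasure M A = emeasure \<nu> (A \<inter> G (Suc j))" if "A \<in> sets lebesgue" for A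
      unfolding M_def using that by (subst emeasure_density) (auto simp: indicator_inter_arith[symmetric] Int_commute)
    have GU: "G j = \<Union>\<H>" by (simp add: G_def \<H>_def)
    \<comment> \<open>A stopping cube not inside \<open>U\<close> lies in a cube of the previous
      generation that is not inside \<open>U\<close> either. This is what lets the decay be
      iterated.\<close>
    have sub: "G (Suc j) \<subseteq> G j"
    proof
      fix x assume "x \<in> G (Suc j)"
      then obtain V' where V': "V' \<in> \<G> (Suc j)" "x \<in> V'" "\<not> V' \<subseteq> U" by (auto simp: G_def)
      have "x \<in> D j" using V' DSuc by (auto simp: D_def)
      then obtain V where V: "V \<in> \<G> j" "x \<in> V" by (auto simp: D_def)
      have "V' \<subseteq> V" using nest[OF V(1) V'(1)] V(2) V'(2) by blast
      then show "x \<in> G j" using V V' by (auto simp: G_def)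
    qed
    have "emeasure M (\<Union>\<H>) \<le> emeasure (scale_measure (ennreal (1 - \<eta>)) \<nu>) (\<Union>\<H>)"
    proof (rule emeasure_disjoint_Union_mono)
      show "countable \<H>" using cG by (rule countable_subset[rotated]) (auto simp: \<H>_def)
      show "disjoint \<H>" using disj[of j] by (auto simp: \<H>_def disjoint_def pairwise_def)
      show "\<H> \<subseteq> sets M" "\<H> \<subseteq> sets (scale_measure (ennreal (1 - \<eta>)) \<nu>)"
        using Ggrid by (auto simp: \<H>_def M_def)
      fix V assume V: "V \<in> \<H>"
      then have Vs: "V \<in> sets lebesgue" using Ggrid by (auto simp: \<H>_def)
      have "emeasure M V \<le> emeasure \<nu> (V \<inter> D (Suc j))"
        unfolding M[OF Vs]
      proof (rule emeasure_mono)
        show "V \<inter> G (Suc j) \<subseteq> V \<inter> D (Suc j)" by (auto simp: G_def D_def)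
        show "V \<inter> D (Suc j) \<in> sets \<nu>" using Vs Ds by simp
      qed
      also have "\<dots> \<le> ennreal (1 - \<eta>) * emeasure \<nu> V" using V by (intro decay1) (auto simp: \<H>_def)
      finally show "emeasure M V \<le> emeasure (scale_measure (ennreal (1 - \<eta>)) \<nu>) V" by simp
    qed
    moreover have "emeasure M (\<Union>\<H>) = emeasure \<nu> (G (Suc j))"
      unfolding GU[symmetric] using sub by (simp add: M Int_absorb1)
    ultimately show ?thesis by (simp add: GU)
  qed
  have G_le: "emeasure \<nu> (G j) \<le> ennreal ((1 - \<eta>) ^ j) * emeasure \<nu> Q" for j
  proof (induction j)
    case 0
    show ?case using Ggrid(2) by (auto intro!: emeasure_mono simp: G_def)
  next
    case (Suc j)
    have "emeasure \<nu> (G (Suc j)) \<le> ennreal (1 - \<eta>) * (ennreal ((1 - \<eta>) ^ j) * emeasure \<nu> Q)"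
      using decay[of j] Suc by (meson mult_left_mono order_trans zero_le)
    then show ?case using \<eta> by (simp add: ennreal_mult mult.assoc)
  qed
  \<comment> \<open>The mass of \<open>D j\<close> is at least \<open>t j\<close> times its volume
    and at most the mass of \<open>Q\<close>, so \<open>a ^ j\<close> times the volume stays
    bounded.\<close>
  have null: "emeasure lebesgue (\<Inter>j. D j) = 0"
  proof -
    obtain q where q: "emeasure lebesgue Q = ennreal q" "q > 0" using Qe by (cases "emeasure lebesgue Q") auto
    have h1: "ennreal (t j) * emeasure lebesgue (D j) \<le> emeasure \<nu> (D j)" for j
    proof -
      have "emeasure (scale_measure (ennreal (t j)) lebesgue) (\<Union>(\<G> j)) \<le> emeasure \<nu> (\<Union>(\<G> j))"
      proof (rule emeasure_disjoint_Union_mono[OF cG disj])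
        show "\<G> j \<subseteq> sets (scale_measure (ennreal (t j)) lebesgue)" "\<G> j \<subseteq> sets \<nu>"
          using Ggrid(3) by auto
        show "emeasure (scale_measure (ennreal (t j)) lebesgue) V \<le> emeasure \<nu> V" if "V \<in> \<G> j" for V
          using that by (simp add: \<G>_def heavy_def)
      qed
      then show ?thesis by (simp add: D_def)
    qed
    have h2: "emeasure \<nu> (D j) \<le> ennreal (T * q)" for j
    proof -
      have "D j \<subseteq> Q" using Ggrid(2) by (auto simp: D_def)
      from emeasure_mono[OF this, of \<nu>] show ?thesis using \<nu>Q q T(1) by (simp add: ennreal_mult)
    qed
    have *: "ennreal (t j) * emeasure lebesgue (\<Inter>j. D j) \<le> ennreal (T * q)" for j
    proof -
      have "emeasure lebesgue (\<Inter>j. D j) \<le> emeasure lebesgue (D j)" by (intro emeasure_mono) auto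
      then have "ennreal (t j) * emeasure lebesgue (\<Inter>j. D j) \<le> ennreal (t j) * emeasure lebesgue (D j)"
        by (rule mult_left_mono) simp
      then show ?thesis using h1 h2 by (meson order_trans)
    qed
    have "emeasure lebesgue (\<Inter>j. D j) \<le> emeasure lebesgue Q"
    proof (rule emeasure_mono)
      have "D 0 \<subseteq> Q" using Ggrid(2) by (auto simp: D_def)
      then show "(\<Inter>j. D j) \<subseteq> Q" by blast
    qed simp
    then obtain d where d: "emeasure lebesgue (\<Inter>j. D j) = ennreal d" "d \<ge> 0"
      using q by (cases "emeasure lebesgue (\<Inter>j. D j)") (auto simp: top_unique)
    have le: "2 ^ j * d \<le> q" for j
    proof -
      have "T * (a ^ j * d) \<le> T * q" using *[of j] d t(1)[of j] by (simp add: t_def ennreal_mult[symmetric] mult.assoc T(1) less_imp_le q(2))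
      then have "a ^ j * d \<le> q" using T(1) by simp
      moreover have "2 ^ j * d \<le> a ^ j * d" using a2 d by (intro mult_right_mono power_mono) auto
      ultimately show ?thesis by linarith
    qed
    have "d = 0"
    proof (rule ccontr)
      assume "d \<noteq> 0"
      then have "d > 0" using d by simp
      obtain j where "q / d < 2 ^ j" using real_arch_pow[of 2 "q / d"] by auto
      then show False using le[of j] \<open>d > 0\<close> by (simp add: field_simps)
    qed
    then show ?thesis using d by simp
  qed
  have off: "AE x in lebesgue. \<forall>j. x \<in> Q \<longrightarrow> x \<notin> D j \<longrightarrow> ennreal (u x) \<le> ennreal (t j)"
    unfolding AE_all_countable
  proof
    fix j
    have "AE x in lebesgue. x \<in> Q \<longrightarrow>
      (\<forall>V\<in>grid s. x \<in> V \<longrightarrow> V \<subseteq> Q \<longrightarrow> (\<integral>\<^sup>+y\<in>V. ennreal (u y) \<partial>lebesgue) \<le> ennreal (t j) * emeasure lebesgue V) \<longrightarrow> ennreal (u x) \<le> ennreal (t j)"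
      using Q t(1)[of j] by (intro grid_differentiation) auto
    then show "AE x in lebesgue. x \<in> Q \<longrightarrow> x \<notin> D j \<longrightarrow> ennreal (u x) \<le> ennreal (t j)"
    proof eventually_elim
      case (elim x)
      show ?case
      proof (intro impI)
        assume x: "x \<in> Q" "x \<notin> D j"
        have "(\<integral>\<^sup>+y\<in>V. ennreal (u y) \<partial>lebesgue) \<le> ennreal (t j) * emeasure lebesgue V"
          if "V \<in> grid s" "x \<in> V" "V \<subseteq> Q" for V
        proof -
          have "\<not> heavy j V" using inD[OF that(1,3)] x that(2) by (auto simp: D_def)
          then show ?thesis using \<nu>[OF gs[OF that(1)]] by (simp add: heavy_def)
        qed
        then show "ennreal (u x) \<le> ennreal (t j)" using elim x(1) by blast
      qed
    qed
  qed
  have nullAE: "AE x in lebesgue. x \<notin> (\<Inter>j. D j)"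
    using null by (intro AE_not_in) (auto simp: null_sets_def)
  have QD: "Q \<subseteq> D 0"
  proof -
    have "heavy 0 Q" by (simp add: heavy_def t \<nu>Q)
    then show ?thesis using inD[OF Q, of 0] by (auto simp: D_def)
  qed
  \<comment> \<open>Almost every point of \<open>Q - U\<close> leaves the sets \<open>D j\<close>
    for the first time at some \<open>Suc m\<close>. There \<open>u \<le> t (Suc m)\<close> by
    differentiation, and a point outside \<open>U\<close> has its stopping cube counted in
    \<open>G m\<close>.\<close>
  have pt: "AE x in lebesgue. ennreal (u x powr (1 + \<epsilon>)) * indicator (Q - U) x
      \<le> (\<Sum>j. ennreal (t (Suc j) powr \<epsilon>) * (ennreal (u x) * indicator (G j) x))"
    using off nullAE
  proof eventually_elim
    case (elim x)
    show ?case
    proof (cases "x \<in> Q - U")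
      case True
      obtain j where "x \<notin> D j" using elim(2) by blast
      define i where "i = (LEAST j. x \<notin> D j)"
      have i: "x \<notin> D i" unfolding i_def using \<open>x \<notin> D j\<close> by (rule LeastI)
      have "i \<noteq> 0" using i QD True by (cases i) auto
      then obtain m where m: "i = Suc m" by (cases i) auto
      have "x \<in> D m" using not_less_Least[of m "\<lambda>j. x \<notin> D j"] m by (simp add: i_def)
      then have xG: "x \<in> G m" using True inG by blast
      have "ennreal (u x) \<le> ennreal (t (Suc m))" using elim(1) i m True by auto
      then have ut: "u x \<le> t (Suc m)" using t(1)[of "Suc m"] by (simp add: ennreal_le_iff2)
      have "u x powr (1 + \<epsilon>) = u x powr \<epsilon> * u x"
        using u0[of x] \<epsilon>(1) by (cases "u x = 0") (auto simp: powr_add)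
      also have "\<dots> \<le> t (Suc m) powr \<epsilon> * u x"
        using ut u0[of x] \<epsilon>(1) by (intro mult_right_mono powr_mono2) auto
      finally have "ennreal (u x powr (1 + \<epsilon>)) \<le> ennreal (t (Suc m) powr \<epsilon>) * (ennreal (u x) * indicator (G m) x)"
        using xG u0[of x] by (simp add: ennreal_mult[symmetric] ennreal_leI)
      also have "\<dots> = (\<Sum>j\<in>{m}. ennreal (t (Suc j) powr \<epsilon>) * (ennreal (u x) * indicator (G j) x))" by simp
      also have "\<dots> \<le> (\<Sum>j. ennreal (t (Suc j) powr \<epsilon>) * (ennreal (u x) * indicator (G j) x))"
        by (rule sum_le_suminf) auto
      finally show ?thesis using True by simp
    qed simp
  qed
  have geo: "ennreal (t (Suc j) powr \<epsilon>) * emeasure \<nu> (G j) \<le> ennreal (a powr \<epsilon> * T powr \<epsilon> * r ^ j) * emeasure \<nu> Q" for j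
  proof -
    have "t (Suc j) powr \<epsilon> * (1 - \<eta>) ^ j = T powr \<epsilon> * (a powr \<epsilon>) * (a powr \<epsilon> * (1 - \<eta>)) ^ j"
    proof -
      have "t (Suc j) powr \<epsilon> = T powr \<epsilon> * (a ^ Suc j) powr \<epsilon>" using T a2 by (simp add: t_def powr_mult)
      also have "(a ^ Suc j) powr \<epsilon> = (a powr \<epsilon>) ^ Suc j"
        using a2 by (simp add: powr_powr powr_realpow[symmetric] powr_mult mult.commute powr_add)
      finally show ?thesis by (simp add: power_mult_distrib)
    qed
    also have "\<dots> \<le> T powr \<epsilon> * (a powr \<epsilon>) * r ^ j"
      using \<epsilon>(2) \<eta> by (intro mult_left_mono power_mono) auto
    finally have *: "t (Suc j) powr \<epsilon> * (1 - \<eta>) ^ j \<le> a powr \<epsilon> * T powr \<epsilon> * r ^ j" by (simp add: mult_ac)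
    have "ennreal (t (Suc j) powr \<epsilon>) * emeasure \<nu> (G j)
        \<le> ennreal (t (Suc j) powr \<epsilon>) * (ennreal ((1 - \<eta>) ^ j) * emeasure \<nu> Q)"
      using G_le by (rule mult_left_mono) simp
    also have "\<dots> = ennreal (t (Suc j) powr \<epsilon> * (1 - \<eta>) ^ j) * emeasure \<nu> Q"
      using \<eta> by (simp add: ennreal_mult mult.assoc)
    also have "\<dots> \<le> ennreal (a powr \<epsilon> * T powr \<epsilon> * r ^ j) * emeasure \<nu> Q"
      using * by (intro mult_right_mono ennreal_leI) auto
    finally show ?thesis .
  qed
  have "0 \<le> a powr \<epsilon> * (1 - \<eta>)" using \<eta> by (intro mult_nonneg_nonneg) auto
  then have r0: "0 \<le> r" using \<epsilon>(2) by linarith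
  have "(\<integral>\<^sup>+x\<in>Q - U. ennreal (u x powr (1 + \<epsilon>)) \<partial>lebesgue)
      \<le> (\<integral>\<^sup>+x. (\<Sum>j. ennreal (t (Suc j) powr \<epsilon>) * (ennreal (u x) * indicator (G j) x)) \<partial>lebesgue)"
    using pt by (rule nn_integral_mono_AE)
  also have "\<dots> = (\<Sum>j. ennreal (t (Suc j) powr \<epsilon>) * emeasure \<nu> (G j))"
    by (subst nn_integral_suminf) (auto simp: nn_integral_cmult \<nu>)
  also have "\<dots> \<le> (\<Sum>j. ennreal (a powr \<epsilon> * T powr \<epsilon> * r ^ j) * emeasure \<nu> Q)"
    using geo by (intro suminf_le) auto
  also have "\<dots> = (\<Sum>j. ennreal (a powr \<epsilon> * T powr \<epsilon> * r ^ j)) * emeasure \<nu> Q" by simp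
  also have "(\<Sum>j. ennreal (a powr \<epsilon> * T powr \<epsilon> * r ^ j)) = ennreal (a powr \<epsilon> * T powr \<epsilon> * (1 / (1 - r)))"
    using r0 \<epsilon>(3) by (intro suminf_ennreal_eq sums_mult geometric_sums) auto
  also have "\<dots> * emeasure \<nu> Q = ennreal (a powr \<epsilon> * T powr (1 + \<epsilon>) / (1 - r)) * emeasure lebesgue Q"
  proof -
    have "a powr \<epsilon> * T powr (1 + \<epsilon>) / (1 - r) = (a powr \<epsilon> * T powr \<epsilon> * (1 / (1 - r))) * T"
      using T(1) by (simp add: powr_add)
    moreover have "0 \<le> a powr \<epsilon> * T powr \<epsilon> * (1 / (1 - r))" using \<epsilon>(3) by simp
    ultimately have "ennreal (a powr \<epsilon> * T powr (1 + \<epsilon>) / (1 - r))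
        = ennreal (a powr \<epsilon> * T powr \<epsilon> * (1 / (1 - r))) * ennreal T"
      using ennreal_mult[OF _ less_imp_le[OF T(1)]] by metis
    then show ?thesis unfolding \<nu>Q by (simp only: mult.assoc)
  qed
  finally show ?thesis .
qed

text \<open>Here \<open>c\<close> is an upper bound for the average of \<open>u\<close> over \<open>V\<close>; cubes inside the exceptional set
  \<open>U\<close> are exempt.\<close>
definition A_infinity_on ::
  "real \<Rightarrow> real \<Rightarrow> ('n::finite \<Rightarrow> bool) \<Rightarrow> (real ^ 'n) set \<Rightarrow> (real ^ 'n) set \<Rightarrow> (real ^ 'n \<Rightarrow> real) \<Rightarrow> bool" where
  "A_infinity_on \<kappa> \<delta> s Q U u \<longleftrightarrow> Q \<in> grid s \<and> U \<in> sets lebesgue \<and>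
     u \<in> borel_measurable lebesgue \<and> (\<forall>x. 0 \<le> u x) \<and>
     (\<forall>V\<in>grid s. V \<subseteq> Q \<longrightarrow> \<not> V \<subseteq> U \<longrightarrow>
        (\<exists>c\<ge>0. (\<integral>\<^sup>+x\<in>V. ennreal (u x) \<partial>lebesgue) \<le> ennreal c * emeasure lebesgue V \<and>
          ennreal \<kappa> * emeasure lebesgue V \<le> emeasure lebesgue {x\<in>V. \<delta> * c \<le> u x}))"

text \<open>The gain is in the quantifiers: \<open>\<epsilon>0\<close> and \<open>C\<close> depend
  only on \<open>\<kappa>\<close>, \<open>\<delta>\<close> and the dimension, so one choice serves a
  whole family of weights. Smaller exponents are allowed with the same \<open>C\<close> because the
  small levels need \<open>1 + \<epsilon> < r\<close>.\<close>

lemma reverse_Hoelder: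
  fixes \<kappa> \<delta> :: real
  assumes \<kappa>: "0 < \<kappa>" "\<kappa> \<le> 1" and \<delta>: "0 < \<delta>" "\<delta> \<le> 1"
  shows "\<exists>\<epsilon>0>0. \<exists>C>0. \<forall>(s :: 'n::finite \<Rightarrow> bool) Q U u T \<epsilon>. A_infinity_on \<kappa> \<delta> s Q U u \<longrightarrow>
    0 < T \<longrightarrow> (\<integral>\<^sup>+x\<in>Q. ennreal (u x) \<partial>lebesgue) = ennreal T * emeasure lebesgue Q \<longrightarrow>
    0 < \<epsilon> \<longrightarrow> \<epsilon> \<le> \<epsilon>0 \<longrightarrow>
    (\<integral>\<^sup>+x\<in>Q - U. ennreal (u x powr (1 + \<epsilon>)) \<partial>lebesgue) \<le> ennreal (C * T powr (1 + \<epsilon>)) * emeasure lebesgue Q"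
proof -
  define a where "a = 2 * 2 ^ CARD('n) / \<kappa>"
  define \<eta> where "\<eta> = \<delta> * \<kappa> / 2"
  have a: "a > 1"
  proof -
    have "\<kappa> < 2 * 2 ^ CARD('n)" using \<kappa>(2) one_le_power[of "2::real" "CARD('n)"] by linarith
    then show ?thesis using \<kappa> by (simp add: a_def)
  qed
  have \<eta>: "0 < \<eta>" "\<eta> \<le> 1/2" using \<kappa> \<delta> mult_mono[of \<delta> 1 \<kappa> 1] by (auto simp: \<eta>_def)
  \<comment> \<open>Solves \<open>a powr \<epsilon>0 * (1 - \<eta>) = 1 - \<eta> / 2\<close>: the
    growth of the heights consumes only part of the decay of the masses.\<close>
  define \<epsilon>0 where "\<epsilon>0 = log a ((1 - \<eta> / 2) / (1 - \<eta>))"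
  have q: "(1 - \<eta> / 2) / (1 - \<eta>) > 1" using \<eta> by simp
  have \<epsilon>0: "\<epsilon>0 > 0" using a q unfolding \<epsilon>0_def by simp
  have ae: "a powr \<epsilon>0 * (1 - \<eta>) = 1 - \<eta> / 2"
    using a q \<eta> unfolding \<epsilon>0_def by simp
  have r: "1 - \<eta> / 2 < 1" using \<eta> by simp
  show ?thesis
  proof (rule exI[of _ \<epsilon>0], rule conjI[OF \<epsilon>0], rule exI[of _ "a powr \<epsilon>0 / (1 - (1 - \<eta> / 2))"],
      intro conjI allI impI)
    show "0 < a powr \<epsilon>0 / (1 - (1 - \<eta> / 2))" using a \<eta> by simp
    fix s :: "'n \<Rightarrow> bool" and Q U u T \<epsilon>
    assume A: "A_infinity_on \<kappa> \<delta> s Q U u" and T: "0 < T" "(\<integral>\<^sup>+x\<in>Q. ennreal (u x) \<partial>lebesgue) = ennreal T * emeasure lebesgue Q"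
      and \<epsilon>: "0 < \<epsilon>" "\<epsilon> \<le> \<epsilon>0"
    have *: "Q \<in> grid s" "U \<in> sets lebesgue" "u \<in> borel_measurable lebesgue" "\<And>x. 0 \<le> u x"
      "\<And>V. V \<in> grid s \<Longrightarrow> V \<subseteq> Q \<Longrightarrow> \<not> V \<subseteq> U \<Longrightarrow>
        \<exists>c\<ge>0. (\<integral>\<^sup>+x\<in>V. ennreal (u x) \<partial>lebesgue) \<le> ennreal c * emeasure lebesgue V \<and>
          ennreal \<kappa> * emeasure lebesgue V \<le> emeasure lebesgue {x\<in>V. \<delta> * c \<le> u x}"
      using A unfolding A_infinity_on_def by blast+
    have ale: "a powr \<epsilon> \<le> a powr \<epsilon>0" using \<epsilon> a by (intro powr_mono) auto
    have "a powr \<epsilon> * (1 - \<eta>) \<le> 1 - \<eta> / 2"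
      using mult_right_mono[OF ale, of "1 - \<eta>"] ae \<eta> by simp
    from reverse_Hoelder_aux[OF \<kappa> \<delta> a_def \<eta>_def *(1-4) T *(5) \<epsilon>(1) this r]
    have "(\<integral>\<^sup>+x\<in>Q - U. ennreal (u x powr (1 + \<epsilon>)) \<partial>lebesgue)
       \<le> ennreal (a powr \<epsilon> * T powr (1 + \<epsilon>) / (1 - (1 - \<eta> / 2))) * emeasure lebesgue Q" .
    also have "\<dots> \<le> ennreal (a powr \<epsilon>0 / (1 - (1 - \<eta> / 2)) * T powr (1 + \<epsilon>)) * emeasure lebesgue Q"
    proof (intro mult_right_mono ennreal_leI)
      have "a powr \<epsilon> * (T powr (1 + \<epsilon>) / (1 - (1 - \<eta> / 2))) \<le> a powr \<epsilon>0 * (T powr (1 + \<epsilon>) / (1 - (1 - \<eta> / 2)))"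
        using ale \<eta> by (intro mult_right_mono) auto
      then show "a powr \<epsilon> * T powr (1 + \<epsilon>) / (1 - (1 - \<eta> / 2)) \<le> a powr \<epsilon>0 / (1 - (1 - \<eta> / 2)) * T powr (1 + \<epsilon>)"
        by (simp add: mult_ac)
    qed simp
    finally show "(\<integral>\<^sup>+x\<in>Q - U. ennreal (u x powr (1 + \<epsilon>)) \<partial>lebesgue)
       \<le> ennreal (a powr \<epsilon>0 / (1 - (1 - \<eta> / 2)) * T powr (1 + \<epsilon>)) * emeasure lebesgue Q" .
  qed
qed

subsection \<open>Modulars\<close>

text \<open>The bounds are assumed everywhere, not almost everywhere, which spares null sets in all
  pointwise estimates. The final theorem reaches this situation by clipping
  \<open>p\<close>.\<close>

locale exponent =
  fixes p :: "real ^ 'n::finite \<Rightarrow> real" and a b :: real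
  assumes p_meas [measurable]: "p \<in> borel_measurable lebesgue"
    and a1: "1 < a" and p_ge: "\<And>x. a \<le> p x" and p_le: "\<And>x. p x \<le> b"
begin

lemma p_gt1: "1 < p x" using a1 p_ge[of x] by linarith

lemma p_pos: "0 < p x" "0 \<le> p x" using p_gt1[of x] by auto

lemma a_le_b: "a \<le> b" using p_ge p_le order_trans by blast

lemma b1: "1 < b" using a1 a_le_b by linarith

text \<open>Together with \<open>powr_scale_down\<close> this stands in for homogeneity: a dilation
  by \<open>c \<ge> 1\<close> costs at most \<open>c powr b\<close>, and a contraction by
  \<open>c \<le> 1\<close> gains at least the factor \<open>c\<close>.\<close>

lemma powr_scale_up:
  assumes "1 \<le> c" "0 \<le> t" shows "(c * t) powr p x \<le> c powr b * t powr p x"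
proof -
  have "(c * t) powr p x = c powr p x * t powr p x" using assms by (simp add: powr_mult)
  also have "\<dots> \<le> c powr b * t powr p x" using assms p_le by (intro mult_right_mono powr_mono) auto
  finally show ?thesis .
qed

lemma powr_scale_down:
  assumes "0 \<le> c" "c \<le> 1" "0 \<le> t" shows "(c * t) powr p x \<le> c * t powr p x"
proof -
  have "(c * t) powr p x = c powr p x * t powr p x" using assms by (simp add: powr_mult)
  also have "\<dots> \<le> c powr 1 * t powr p x" using assms p_gt1[of x] by (intro mult_right_mono powr_mono') auto
  finally show ?thesis using assms by (cases "c = 0") auto
qed

text \<open>The modular of \<open>t\<close> times the indicator of \<open>A\<close>.\<close>

definition pmass :: "(real ^ 'n) set \<Rightarrow> real \<Rightarrow> ennreal" where
  "pmass A t = (\<integral>\<^sup>+x\<in>A. ennreal (t powr p x) \<partial>lebesgue)"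

lemma pmass_scale_up:
  assumes "1 \<le> c" "0 \<le> t" "A \<in> sets lebesgue"
  shows "pmass A (c * t) \<le> ennreal (c powr b) * pmass A t"
proof -
  note assms(3) [measurable]
  have "pmass A (c * t) \<le> (\<integral>\<^sup>+x. ennreal (c powr b) * (ennreal (t powr p x) * indicator A x) \<partial>lebesgue)"
    unfolding pmass_def using powr_scale_up[OF assms(1,2)]
    by (intro nn_integral_mono) (auto simp: indicator_def ennreal_mult[symmetric] intro!: ennreal_leI)
  also have "\<dots> = ennreal (c powr b) * pmass A t"
    unfolding pmass_def by (rule nn_integral_cmult) simp
  finally show ?thesis .
qed

lemma pmass_scale_down:
  assumes "0 \<le> c" "c \<le> 1" "0 \<le> t" "A \<in> sets lebesgue"
  shows "pmass A (c * t) \<le> ennreal c * pmass A t"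
proof -
  note assms(4) [measurable]
  have "pmass A (c * t) \<le> (\<integral>\<^sup>+x. ennreal c * (ennreal (t powr p x) * indicator A x) \<partial>lebesgue)"
    unfolding pmass_def using powr_scale_down[OF assms(1-3)] assms(1)
    by (intro nn_integral_mono) (auto simp: indicator_def ennreal_mult[symmetric] intro!: ennreal_leI)
  also have "\<dots> = ennreal c * pmass A t"
    unfolding pmass_def by (rule nn_integral_cmult) simp
  finally show ?thesis .
qed

lemma pmass_mono:
  assumes "0 \<le> t" "t \<le> t'" "A \<subseteq> B" shows "pmass A t \<le> pmass B t'"
  unfolding pmass_def
  using assms p_pos by (intro nn_integral_mono) (auto simp: indicator_def intro!: ennreal_leI powr_mono2)

lemma Lp_norm_le:
  "0 < t \<Longrightarrow> (\<integral>\<^sup>+x. ennreal ((\<bar>f x\<bar> / t) powr p x) \<partial>lebesgue) \<le> 1 \<Longrightarrow> Lp_norm p f \<le> ennreal t"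
  unfolding Lp_norm_def by (intro INF_lower) auto

lemma Lp_norm_less:
  assumes "Lp_norm p f < ennreal t"
  shows "(\<integral>\<^sup>+x. ennreal ((\<bar>f x\<bar> / t) powr p x) \<partial>lebesgue) \<le> 1"
proof -
  obtain t' where t': "0 < t'" "(\<integral>\<^sup>+x. ennreal ((\<bar>f x\<bar> / t') powr p x) \<partial>lebesgue) \<le> 1" "ennreal t' < ennreal t"
    using assms unfolding Lp_norm_def INF_less_iff by auto
  have "t' < t" using t'(3) t'(1) by (simp add: ennreal_less_iff)
  have "(\<integral>\<^sup>+x. ennreal ((\<bar>f x\<bar> / t) powr p x) \<partial>lebesgue) \<le> (\<integral>\<^sup>+x. ennreal ((\<bar>f x\<bar> / t') powr p x) \<partial>lebesgue)"
    using \<open>t' < t\<close> t'(1) p_pos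
    by (intro nn_integral_mono ennreal_leI powr_mono2 divide_left_mono) auto
  then show ?thesis using t'(2) by simp
qed

lemma modular_indicator:
  "0 < t \<Longrightarrow> (\<integral>\<^sup>+x. ennreal ((indicator Q x / t) powr p x) \<partial>lebesgue) = pmass Q (1 / t)"
  unfolding pmass_def by (intro nn_integral_cong) (auto simp: indicator_def)

lemma Lp_norm_indicator_cube:
  assumes "cube Q"
  shows "\<exists>\<nu>>0. Lp_norm p (indicator Q) = ennreal \<nu>"
proof -
  define v where "v = measure lebesgue Q"
  have v: "emeasure lebesgue Q = ennreal v" "v > 0" using cube_emeasure[OF assms] by (auto simp: v_def)
  have Qs [measurable]: "Q \<in> sets lebesgue" using assms by (rule cube_lebesgue)
  have cI: "(\<integral>\<^sup>+x. ennreal c * indicator Q x \<partial>lebesgue) = ennreal c * ennreal v" for c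
    using v by (subst nn_integral_cmult_indicator) auto
  have "pmass Q (1 / max 1 v) \<le> (\<integral>\<^sup>+x. ennreal (1 / max 1 v) * indicator Q x \<partial>lebesgue)"
    unfolding pmass_def
  proof (intro nn_integral_mono mult_right_mono ennreal_leI)
    fix x
    show "(1 / max 1 v) powr p x \<le> 1 / max 1 v"
      using powr_scale_down[of "1 / max 1 v" 1 x] v by (simp add: field_simps)
  qed simp
  also have "\<dots> = ennreal (1 / max 1 v * v)" using v unfolding cI by (subst ennreal_mult[symmetric]) auto
  also have "\<dots> \<le> ennreal 1" using v by (intro ennreal_leI) (simp add: field_simps)
  finally have "Lp_norm p (indicator Q) \<le> ennreal (max 1 v)"
    using v by (intro Lp_norm_le) (auto simp: modular_indicator)
  then have fin: "Lp_norm p (indicator Q) < \<infinity>" by (simp add: le_less_trans)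
  \<comment> \<open>Below the volume and at most \<open>1\<close>, so
    \<open>(1 / t0) powr p x \<ge> 1 / t0 > 1 / v\<close> forces the modular above
    \<open>1\<close>.\<close>
  define t0 where "t0 = min 1 v / 2"
  have t0: "0 < t0" "t0 \<le> 1" "t0 < v" using v by (auto simp: t0_def)
  have big: "1 < pmass Q (1 / t0)"
  proof -
    have "ennreal 1 < ennreal (1 / t0 * v)" using t0 by (intro ennreal_lessI) (auto simp: field_simps)
    also have "\<dots> = (\<integral>\<^sup>+x. ennreal (1 / t0) * indicator Q x \<partial>lebesgue)"
      using v t0 unfolding cI by (subst ennreal_mult[symmetric]) auto
    also have "\<dots> \<le> pmass Q (1 / t0)"
      unfolding pmass_def
    proof (intro nn_integral_mono mult_right_mono ennreal_leI)
      fix x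
      show "1 / t0 \<le> (1 / t0) powr p x"
        using powr_mono[of 1 "p x" "1 / t0"] t0 p_gt1[of x] by simp
    qed simp
    finally show ?thesis by simp
  qed
  have "\<not> Lp_norm p (indicator Q) < ennreal t0"
    using Lp_norm_less[of "indicator Q" t0] big modular_indicator[OF t0(1)] by (auto simp: not_le[symmetric])
  then have "ennreal t0 \<le> Lp_norm p (indicator Q)" by simp
  then show ?thesis using fin t0(1)
    by (cases "Lp_norm p (indicator Q)") (auto simp: ennreal_le_iff2 intro: less_le_trans)
qed

section \<open>The conjugate exponent\<close>

abbreviation q :: "real ^ 'n \<Rightarrow> real" where "q \<equiv> conj_exponent p"

lemma conj_minus_one: "q x - 1 = 1 / (p x - 1)" "(q x - 1) * p x = q x"
  using p_gt1[of x] by (auto simp: conj_exponent_def field_simps)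

lemma exponent_conj: "exponent q (b / (b - 1)) (a / (a - 1))"
proof
  show "q \<in> borel_measurable lebesgue" unfolding conj_exponent_def by measurable
  show "1 < b / (b - 1)" using b1 by simp
  fix x
  have "b / (b - 1) = 1 + 1 / (b - 1)" "q x = 1 + 1 / (p x - 1)" "a / (a - 1) = 1 + 1 / (a - 1)"
    using b1 a1 p_gt1[of x] by (auto simp: conj_exponent_def field_simps)
  moreover have "1 / (b - 1) \<le> 1 / (p x - 1)" "1 / (p x - 1) \<le> 1 / (a - 1)"
    using b1 a1 p_gt1[of x] p_ge[of x] p_le[of x] by (auto intro!: divide_left_mono)
  ultimately show "b / (b - 1) \<le> q x" "q x \<le> a / (a - 1)" by auto
qed

lemma conj_conj: "conj_exponent q = p"
proof
  fix x show "conj_exponent q x = p x" using p_gt1[of x] by (simp add: conj_exponent_def field_simps)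
qed

end

lemma average_le_maximal:
  "cube Q \<Longrightarrow> x \<in> Q \<Longrightarrow> (\<integral>\<^sup>+y\<in>Q. ennreal \<bar>f y\<bar> \<partial>lebesgue) / emeasure lebesgue Q \<le> maximal f x"
  unfolding maximal_def by (intro SUP_upper) auto

subsection \<open>Necessity\<close>

context exponent begin

lemma maximal_bounded_imp_A_condition:
  assumes "maximal_bounded p"
  shows "A_condition p"
proof -
  interpret q: exponent q "b / (b - 1)" "a / (a - 1)" by (rule exponent_conj)
  obtain C where C: "0 \<le> C" and bd: "\<And>f. f \<in> Lp_space p \<Longrightarrow> AE x in lebesgue. maximal f x < \<infinity>"
    "\<And>f. f \<in> Lp_space p \<Longrightarrow> Lp_norm p (\<lambda>x. enn2real (maximal f x)) \<le> ennreal C * Lp_norm p f"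
    using assms unfolding maximal_bounded_def by blast
  define B where "B = a / (a - 1)"
  have B: "B > 1" using a1 by (simp add: B_def)
  have "Lp_norm p (indicator Q) * Lp_norm q (indicator Q) / emeasure lebesgue Q \<le> ennreal ((C + 1) * 2 powr B)"
    if Q: "cube Q" for Q
  proof -
    have Qs [measurable]: "Q \<in> sets lebesgue" using Q by (rule cube_lebesgue)
    define v where "v = measure lebesgue Q"
    have v: "emeasure lebesgue Q = ennreal v" "v > 0" using cube_emeasure[OF Q] by (auto simp: v_def)
    obtain \<nu> where \<nu>: "\<nu> > 0" "Lp_norm q (indicator Q) = ennreal \<nu>" using q.Lp_norm_indicator_cube[OF Q] by auto
    \<comment> \<open>Strictly between \<open>\<nu>\<close> and \<open>2 * \<nu>\<close>: the
      modular is at most \<open>1\<close> at \<open>t\<close> and exceeds \<open>1\<close> at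
      \<open>t / 2\<close>. By \<open>pmass_scale_up\<close>, its value at \<open>t\<close> is
      pinned between \<open>2 powr (- B)\<close> and \<open>1\<close>.\<close>
    define t where "t = 3/2 * \<nu>"
    have t: "t > 0" "\<nu> \<le> t" using \<nu> by (auto simp: t_def)
    have "Lp_norm q (indicator Q) < ennreal t" using \<nu> by (simp add: t_def ennreal_less_iff)
    from q.Lp_norm_less[OF this] have le1: "q.pmass Q (1 / t) \<le> 1" using t by (simp add: q.modular_indicator)
    have "\<not> q.pmass Q (1 / (t / 2)) \<le> 1"
    proof
      assume "q.pmass Q (1 / (t / 2)) \<le> 1"
      then have "ennreal \<nu> \<le> ennreal (t / 2)"
        using q.Lp_norm_le[of "t / 2" "indicator Q"] q.modular_indicator[of "t / 2" Q] t(1) \<nu> by simp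
      then show False using \<nu> by (simp add: t_def ennreal_le_iff2)
    qed
    then have "1 < q.pmass Q (2 * (1 / t))" by simp
    also have "\<dots> \<le> ennreal (2 powr B) * q.pmass Q (1 / t)"
      unfolding B_def using t by (intro q.pmass_scale_up) auto
    finally have gt: "1 < ennreal (2 powr B) * q.pmass Q (1 / t)" .
    \<comment> \<open>On \<open>Q\<close>, the \<open>p\<close>-th power of \<open>f\<close> is
      \<open>(1 / t) powr q x\<close> and \<open>f\<close> itself is \<open>t\<close> times that, so
      the modular and the integral of \<open>f\<close> are both governed by the pinned
      quantity.\<close>
    define f where "f = (\<lambda>x. t powr (1 - q x) * indicator Q x)"
    have f [measurable]: "f \<in> borel_measurable lebesgue" unfolding f_def by measurable
    have f0: "f x \<ge> 0" for x by (simp add: f_def)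
    have "(\<integral>\<^sup>+x. ennreal ((\<bar>f x\<bar> / 1) powr p x) \<partial>lebesgue) = q.pmass Q (1 / t)"
      unfolding q.pmass_def
    proof (intro nn_integral_cong)
      fix x
      have "(t powr (1 - q x)) powr p x = (1 / t) powr q x"
        using t conj_minus_one(2)[of x] by (simp add: powr_powr powr_minus_divide[symmetric] powr_divide algebra_simps)
      then show "ennreal ((\<bar>f x\<bar> / 1) powr p x) = ennreal ((1 / t) powr q x) * indicator Q x"
        by (simp add: f_def indicator_def)
    qed
    with le1 have fn: "Lp_norm p f \<le> ennreal 1" by (intro Lp_norm_le) auto
    then have fL: "f \<in> Lp_space p" by (auto simp: Lp_space_def intro: le_less_trans)
    have int: "(\<integral>\<^sup>+y\<in>Q. ennreal \<bar>f y\<bar> \<partial>lebesgue) = ennreal t * q.pmass Q (1 / t)"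
    proof -
      have "(\<integral>\<^sup>+y\<in>Q. ennreal \<bar>f y\<bar> \<partial>lebesgue) = (\<integral>\<^sup>+y. ennreal t * (ennreal ((1 / t) powr q y) * indicator Q y) \<partial>lebesgue)"
        using t by (intro nn_integral_cong)
          (auto simp: f_def indicator_def ennreal_mult[symmetric] powr_diff powr_divide)
      then show ?thesis unfolding q.pmass_def by (simp add: nn_integral_cmult)
    qed
    define g where "g = t / (2 powr B * v)"
    have g: "g > 0" using t v by (simp add: g_def)
    have "ennreal (t / 2 powr B) \<le> ennreal t * q.pmass Q (1 / t)"
    proof -
      have "ennreal (t / 2 powr B) = ennreal (t / 2 powr B) * 1" by simp
      also have "\<dots> \<le> ennreal (t / 2 powr B) * (ennreal (2 powr B) * q.pmass Q (1 / t))"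
        using gt by (intro mult_left_mono) auto
      also have "\<dots> = ennreal t * q.pmass Q (1 / t)"
        using t by (simp add: mult.assoc[symmetric] ennreal_mult[symmetric])
      finally show ?thesis .
    qed
    then have "ennreal (t / 2 powr B) / ennreal v \<le> (\<integral>\<^sup>+y\<in>Q. ennreal \<bar>f y\<bar> \<partial>lebesgue) / emeasure lebesgue Q"
      unfolding int v(1) by (rule divide_right_mono_ennreal)
    then have avg: "ennreal g \<le> (\<integral>\<^sup>+y\<in>Q. ennreal \<bar>f y\<bar> \<partial>lebesgue) / emeasure lebesgue Q"
      using t v by (simp add: divide_ennreal g_def)
    define \<tau> where "\<tau> = C + 1"
    have "Lp_norm p (\<lambda>x. enn2real (maximal f x)) \<le> ennreal C * ennreal 1"
      using bd(2)[OF fL] fn by (meson mult_left_mono order_trans zero_le)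
    also have "\<dots> < ennreal \<tau>" using C by (simp add: \<tau>_def ennreal_less_iff del: ennreal_plus)
    finally have M1: "(\<integral>\<^sup>+x. ennreal ((\<bar>enn2real (maximal f x)\<bar> / \<tau>) powr p x) \<partial>lebesgue) \<le> 1"
      by (rule Lp_norm_less)
    have "pmass Q (1 / (\<tau> / g)) \<le> (\<integral>\<^sup>+x. ennreal ((\<bar>enn2real (maximal f x)\<bar> / \<tau>) powr p x) \<partial>lebesgue)"
      unfolding pmass_def
    proof (rule nn_integral_mono_AE)
      show "AE x in lebesgue. ennreal ((1 / (\<tau> / g)) powr p x) * indicator Q x \<le> ennreal ((\<bar>enn2real (maximal f x)\<bar> / \<tau>) powr p x)"
        using bd(1)[OF fL]
      proof eventually_elim
        case (elim x)
        show ?case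
        proof (cases "x \<in> Q")
          case True
          have "ennreal g \<le> maximal f x" using avg average_le_maximal[OF Q True, of f] by (rule order_trans)
          then have "g \<le> enn2real (maximal f x)" using elim g by (cases "maximal f x") (auto simp: ennreal_le_iff2)
          then have "1 / (\<tau> / g) \<le> \<bar>enn2real (maximal f x)\<bar> / \<tau>" using C g by (simp add: \<tau>_def divide_right_mono)
          then show ?thesis using True C g p_pos[of x] by (auto intro!: ennreal_leI powr_mono2 simp: \<tau>_def)
        qed simp
      qed
    qed
    then have "pmass Q (1 / (\<tau> / g)) \<le> 1" using M1 by simp
    moreover have "\<tau> / g > 0" using g C by (simp add: \<tau>_def)
    ultimately have "Lp_norm p (indicator Q) \<le> ennreal (\<tau> / g)"
      using modular_indicator[of "\<tau> / g" Q] by (intro Lp_norm_le) auto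
    then have "Lp_norm p (indicator Q) * Lp_norm q (indicator Q) / emeasure lebesgue Q \<le> ennreal (\<tau> / g) * ennreal \<nu> / ennreal v"
      unfolding \<nu>(2) v(1) by (intro divide_right_mono_ennreal mult_right_mono) auto
    also have "\<dots> = ennreal (\<tau> / g * \<nu> / v)"
      using \<nu> v g C by (simp add: ennreal_mult[symmetric] divide_ennreal \<tau>_def)
    also have "\<dots> \<le> ennreal ((C + 1) * 2 powr B)"
    proof (rule ennreal_leI)
      have "\<tau> / g * \<nu> / v = (C + 1) * 2 powr B * (\<nu> / t)" using v t by (simp add: g_def \<tau>_def field_simps)
      also have "\<dots> \<le> (C + 1) * 2 powr B * 1" using \<nu> t C by (intro mult_left_mono) auto
      finally show "\<tau> / g * \<nu> / v \<le> (C + 1) * 2 powr B" by simp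
    qed
    finally show ?thesis .
  qed
  then have "(SUP Q\<in>{Q. cube Q}. Lp_norm p (indicator Q) * Lp_norm q (indicator Q) / emeasure lebesgue Q)
      \<le> ennreal ((C + 1) * 2 powr B)"
    by (intro SUP_least) auto
  then show ?thesis unfolding A_condition_def by (rule le_less_trans) simp
qed

text \<open>The majorant is \<open>\<Sum>\<^sub>j A\<^sup>-\<^sup>j M\<^sup>j f\<close>, as in the algorithm of Rubio de Francia.\<close>
lemma maximal_bounded_imp_A1_majorant:
  assumes "maximal_bounded p"
  obtains A B :: real where "1 \<le> A" "0 < B"
    "\<And>f :: real ^ 'n \<Rightarrow> real. f \<in> borel_measurable lebesgue \<Longrightarrow> (\<And>x. 0 \<le> f x) \<Longrightarrow>
      (\<integral>\<^sup>+x. ennreal (f x powr p x) \<partial>lebesgue) \<le> 1 \<Longrightarrow>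
      \<exists>w. w \<in> borel_measurable lebesgue \<and> (AE x in lebesgue. w x < \<infinity>) \<and> (\<forall>x. ennreal (f x) \<le> w x) \<and>
        (\<integral>\<^sup>+x. ennreal (enn2real (w x) powr p x) \<partial>lebesgue) \<le> ennreal B \<and>
        (AE x in lebesgue. \<forall>Q. cube Q \<longrightarrow> x \<in> Q \<longrightarrow> (\<integral>\<^sup>+y\<in>Q. w y \<partial>lebesgue) / emeasure lebesgue Q \<le> ennreal A * w x)"
proof -
  obtain C where C: "0 \<le> C" and bd: "\<And>f. f \<in> Lp_space p \<Longrightarrow> AE x in lebesgue. maximal f x < \<infinity>"
    "\<And>f. f \<in> Lp_space p \<Longrightarrow> (\<lambda>x. enn2real (maximal f x)) \<in> Lp_space p"
    "\<And>f. f \<in> Lp_space p \<Longrightarrow> Lp_norm p (\<lambda>x. enn2real (maximal f x)) \<le> ennreal C * Lp_norm p f"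
    using assms unfolding maximal_bounded_def by blast
  define K where "K = C + 1"
  have K: "K \<ge> 1" using C by (simp add: K_def)
  \<comment> \<open>\<open>K ^ j\<close> dominates the norm of the \<open>j\<close>-th iterate; one
    further factor \<open>2 ^ j\<close> makes the modulars summable, and the other makes the
    pointwise series converge.\<close>
  define A where "A = 4 * K"
  have A: "A \<ge> 1" using K by (simp add: A_def)
  show ?thesis
  proof (rule that[OF A, of "2 powr b * 2"])
    show "0 < 2 powr b * (2::real)" by simp
    fix f :: "real ^ 'n \<Rightarrow> real"
    assume f: "f \<in> borel_measurable lebesgue" "\<And>x. 0 \<le> f x" "(\<integral>\<^sup>+x. ennreal (f x powr p x) \<partial>lebesgue) \<le> 1"
    define F where "F = (\<lambda>j. ((\<lambda>g x. enn2real (maximal g x)) ^^ j) f)"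
    have F0: "F 0 = f" and FS: "F (Suc j) = (\<lambda>x. enn2real (maximal (F j) x))" for j
      by (auto simp: F_def)
    have Fpos: "0 \<le> F j x" for j x using f(2) by (cases j) (auto simp: F0 FS)
    have fn: "Lp_norm p f \<le> ennreal 1" using f by (intro Lp_norm_le) auto
    have FL: "F j \<in> Lp_space p \<and> Lp_norm p (F j) \<le> ennreal (C ^ j)" for j
    proof (induction j)
      case 0
      show ?case using fn f by (auto simp: F0 Lp_space_def intro: le_less_trans)
    next
      case (Suc j)
      have "Lp_norm p (F (Suc j)) \<le> ennreal C * ennreal (C ^ j)"
        unfolding FS using bd(3)[of "F j"] Suc by (meson mult_left_mono order_trans zero_le)
      then show ?case using bd(2)[of "F j"] Suc C by (simp add: FS ennreal_mult)
    qed
    have Fm [measurable]: "F j \<in> borel_measurable lebesgue" for j using FL[of j] by (auto simp: Lp_space_def)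
    have mod1: "(\<integral>\<^sup>+x. ennreal ((F j x / K ^ j) powr p x) \<partial>lebesgue) \<le> 1" for j
    proof (cases "j = 0")
      case True
      then show ?thesis using f(3) by (simp add: F0)
    next
      case False
      then have "C ^ j < K ^ j" using C by (intro power_strict_mono) (auto simp: K_def)
      then have "Lp_norm p (F j) < ennreal (K ^ j)"
        using FL[of j] C by (meson ennreal_lessI le_less_trans zero_le_power order.strict_trans1)
      from Lp_norm_less[OF this] show ?thesis using Fpos by simp
    qed
    define h where "h = (\<lambda>j x. F j x / (2 * K) ^ j)"
    have hpos: "0 \<le> h j x" for j x using Fpos[of j x] K by (simp add: h_def)
    have hm [measurable]: "h j \<in> borel_measurable lebesgue" for j unfolding h_def by measurable
    have modh: "(\<integral>\<^sup>+x. ennreal (h j x powr p x) \<partial>lebesgue) \<le> ennreal ((1/2) ^ j)" for j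
    proof -
      have "(\<integral>\<^sup>+x. ennreal (h j x powr p x) \<partial>lebesgue) \<le> (\<integral>\<^sup>+x. ennreal ((1/2) ^ j) * ennreal ((F j x / K ^ j) powr p x) \<partial>lebesgue)"
      proof (rule nn_integral_mono)
        fix x
        have "h j x = (1/2) ^ j * (F j x / K ^ j)" by (simp add: h_def power_mult_distrib power_one_over)
        then have "h j x powr p x \<le> (1/2) ^ j * (F j x / K ^ j) powr p x"
          using powr_scale_down[of "(1/2) ^ j" "F j x / K ^ j" x] Fpos[of j x] K by (simp add: power_le_one)
        then show "ennreal (h j x powr p x) \<le> ennreal ((1/2) ^ j) * ennreal ((F j x / K ^ j) powr p x)"
          by (simp add: ennreal_mult[symmetric] ennreal_leI)
      qed
      also have "\<dots> = ennreal ((1/2) ^ j) * (\<integral>\<^sup>+x. ennreal ((F j x / K ^ j) powr p x) \<partial>lebesgue)"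
        by (rule nn_integral_cmult) simp
      also have "\<dots> \<le> ennreal ((1/2) ^ j) * 1" using mod1 by (rule mult_left_mono) simp
      finally show ?thesis by simp
    qed
    \<comment> \<open>Summing modulars takes the place of a triangle inequality for infinite sums:
      each \<open>h j x\<close> is at most \<open>S x\<close> to the power \<open>1 / p x\<close>,
      so \<open>w x\<close> is at most twice that power and the modular of \<open>w\<close> is
      controlled by the integral of \<open>S\<close>.\<close>
    define S where "S = (\<lambda>x. \<Sum>j. ennreal (h j x powr p x))"
    have Sm [measurable]: "S \<in> borel_measurable lebesgue" unfolding S_def by measurable
    have Sint: "(\<integral>\<^sup>+x. S x \<partial>lebesgue) \<le> ennreal 2"
    proof -
      have "(\<integral>\<^sup>+x. S x \<partial>lebesgue) = (\<Sum>j. \<integral>\<^sup>+x. ennreal (h j x powr p x) \<partial>lebesgue)"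
        unfolding S_def by (rule nn_integral_suminf) simp
      also have "\<dots> \<le> (\<Sum>j. ennreal ((1/2) ^ j))" using modh by (intro suminf_le) auto
      also have "\<dots> = ennreal (1 / (1 - 1/2))" by (intro suminf_ennreal_eq geometric_sums) auto
      finally show ?thesis by simp
    qed
    then have Sfin: "AE x in lebesgue. S x \<noteq> \<infinity>"
      by (intro nn_integral_PInf_AE) (auto simp: top_unique)
    define w where "w = (\<lambda>x. \<Sum>j. ennreal (F j x / A ^ j))"
    have wm [measurable]: "w \<in> borel_measurable lebesgue" unfolding w_def by measurable
    have bound: "w x \<noteq> \<infinity> \<and> enn2real (w x) powr p x \<le> 2 powr b * enn2real (S x)" if S: "S x \<noteq> \<infinity>" for x
    proof -
      define \<sigma> where "\<sigma> = enn2real (S x)"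
      have \<sigma>: "S x = ennreal \<sigma>" "\<sigma> \<ge> 0" using S by (auto simp: \<sigma>_def less_top)
      have "h j x \<le> \<sigma> powr (1 / p x)" for j
      proof -
        have "ennreal (h j x powr p x) = (\<Sum>i\<in>{j}. ennreal (h i x powr p x))" by simp
        also have "\<dots> \<le> S x" unfolding S_def by (rule sum_le_suminf) auto
        finally have "h j x powr p x \<le> \<sigma>" using \<sigma> by simp
        then have "(h j x powr p x) powr (1 / p x) \<le> \<sigma> powr (1 / p x)" using p_pos[of x] by (intro powr_mono2) auto
        then show ?thesis using hpos[of j x] p_pos[of x] by (simp add: powr_powr)
      qed
      then have "F j x / A ^ j \<le> \<sigma> powr (1 / p x) * (1/2) ^ j" for j
      proof -
        have "F j x / A ^ j = h j x * (1/2) ^ j"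
        proof -
          have "A = (2 * K) * 2" by (simp add: A_def)
          then have "A ^ j = (2 * K) ^ j * 2 ^ j" by (simp only: power_mult_distrib)
          then show ?thesis using K by (simp add: h_def power_one_over)
        qed
        then show ?thesis using \<open>\<And>j. h j x \<le> \<sigma> powr (1 / p x)\<close>[of j] by (simp add: mult_right_mono)
      qed
      then have "w x \<le> (\<Sum>j. ennreal (\<sigma> powr (1 / p x) * (1/2) ^ j))"
        unfolding w_def by (intro suminf_le ennreal_leI) auto
      also have "\<dots> = ennreal (\<sigma> powr (1 / p x) * (1 / (1 - 1/2)))"
        by (intro suminf_ennreal_eq sums_mult geometric_sums) auto
      finally have w: "w x \<le> ennreal (2 * \<sigma> powr (1 / p x))" by (simp add: mult.commute)
      then have wr: "enn2real (w x) \<le> 2 * \<sigma> powr (1 / p x)" by (intro enn2real_leI) auto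
      then have "enn2real (w x) powr p x \<le> (2 * \<sigma> powr (1 / p x)) powr p x" using p_pos[of x] by (intro powr_mono2) auto
      also have "\<dots> \<le> 2 powr b * (\<sigma> powr (1 / p x)) powr p x" by (rule powr_scale_up) auto
      also have "\<dots> = 2 powr b * \<sigma>" using p_pos[of x] \<sigma>(2) by (simp add: powr_powr)
      finally show ?thesis using w by (auto simp: \<sigma>_def top_unique)
    qed
    show "\<exists>w. w \<in> borel_measurable lebesgue \<and> (AE x in lebesgue. w x < \<infinity>) \<and> (\<forall>x. ennreal (f x) \<le> w x) \<and>
        (\<integral>\<^sup>+x. ennreal (enn2real (w x) powr p x) \<partial>lebesgue) \<le> ennreal (2 powr b * 2) \<and>
        (AE x in lebesgue. \<forall>Q. cube Q \<longrightarrow> x \<in> Q \<longrightarrow> (\<integral>\<^sup>+y\<in>Q. w y \<partial>lebesgue) / emeasure lebesgue Q \<le> ennreal A * w x)"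
    proof (intro exI[of _ w] conjI)
      show "w \<in> borel_measurable lebesgue" by fact
      show "AE x in lebesgue. w x < \<infinity>" using Sfin bound by (auto simp: less_top)
      show "\<forall>x. ennreal (f x) \<le> w x"
      proof
        fix x
        have "ennreal (f x) = (\<Sum>j\<in>{0}. ennreal (F j x / A ^ j))" by (simp add: F0)
        also have "\<dots> \<le> w x" unfolding w_def by (rule sum_le_suminf) auto
        finally show "ennreal (f x) \<le> w x" .
      qed
      have "(\<integral>\<^sup>+x. ennreal (enn2real (w x) powr p x) \<partial>lebesgue) \<le> (\<integral>\<^sup>+x. ennreal (2 powr b) * S x \<partial>lebesgue)"
      proof (rule nn_integral_mono_AE)
        show "AE x in lebesgue. ennreal (enn2real (w x) powr p x) \<le> ennreal (2 powr b) * S x"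
          using Sfin
        proof eventually_elim
          case (elim x)
          have "ennreal (enn2real (w x) powr p x) \<le> ennreal (2 powr b * enn2real (S x))"
            using bound[OF elim] by (intro ennreal_leI) auto
          also have "\<dots> = ennreal (2 powr b) * S x" using elim by (simp add: ennreal_mult less_top)
          finally show ?case .
        qed
      qed
      also have "\<dots> = ennreal (2 powr b) * (\<integral>\<^sup>+x. S x \<partial>lebesgue)" by (rule nn_integral_cmult) simp
      also have "\<dots> \<le> ennreal (2 powr b) * ennreal 2" using Sint by (rule mult_left_mono) simp
      also have "\<dots> = ennreal (2 powr b * 2)" by (rule ennreal_mult[symmetric]) auto
      finally show "(\<integral>\<^sup>+x. ennreal (enn2real (w x) powr p x) \<partial>lebesgue) \<le> ennreal (2 powr b * 2)" .
      have "AE x in lebesgue. \<forall>j. maximal (F j) x < \<infinity>"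
        unfolding AE_all_countable using bd(1) FL by blast
      then show "AE x in lebesgue. \<forall>Q. cube Q \<longrightarrow> x \<in> Q \<longrightarrow> (\<integral>\<^sup>+y\<in>Q. w y \<partial>lebesgue) / emeasure lebesgue Q \<le> ennreal A * w x"
      proof eventually_elim
        case (elim x)
        show ?case
        proof (intro allI impI)
          fix Q :: "(real ^ 'n) set" assume Q: "cube Q" "x \<in> Q"
          have Qs [measurable]: "Q \<in> sets lebesgue" using Q(1) by (rule cube_lebesgue)
          have "(\<integral>\<^sup>+y\<in>Q. w y \<partial>lebesgue) = (\<integral>\<^sup>+y. (\<Sum>j. ennreal (1 / A ^ j) * (ennreal \<bar>F j y\<bar> * indicator Q y)) \<partial>lebesgue)"
          proof (intro nn_integral_cong)
            fix y
            have "ennreal (F j y / A ^ j) = ennreal (1 / A ^ j) * ennreal \<bar>F j y\<bar>" for j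
              using Fpos[of j y] A by (subst ennreal_mult[symmetric]) auto
            then show "w y * indicator Q y = (\<Sum>j. ennreal (1 / A ^ j) * (ennreal \<bar>F j y\<bar> * indicator Q y))"
              unfolding w_def by (simp add: mult.assoc[symmetric])
          qed
          also have "\<dots> = (\<Sum>j. ennreal (1 / A ^ j) * (\<integral>\<^sup>+y\<in>Q. ennreal \<bar>F j y\<bar> \<partial>lebesgue))"
            by (subst nn_integral_suminf) (auto simp: nn_integral_cmult)
          finally have "(\<integral>\<^sup>+y\<in>Q. w y \<partial>lebesgue) / emeasure lebesgue Q
             = (\<Sum>j. ennreal (1 / A ^ j) * ((\<integral>\<^sup>+y\<in>Q. ennreal \<bar>F j y\<bar> \<partial>lebesgue) / emeasure lebesgue Q))"
            by (simp add: divide_ennreal_def ennreal_suminf_multc[symmetric] mult.assoc)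
          \<comment> \<open>Averages of one iterate are bounded by the next iterate, so the series
            is shifted by one index, and the change from \<open>A ^ j\<close> to
            \<open>A ^ Suc j\<close> is the A1 constant.\<close>
          also have "\<dots> \<le> (\<Sum>j. ennreal A * ennreal (F (Suc j) x / A ^ Suc j))"
          proof (intro suminf_le)
            fix j
            have "ennreal (1 / A ^ j) * ((\<integral>\<^sup>+y\<in>Q. ennreal \<bar>F j y\<bar> \<partial>lebesgue) / emeasure lebesgue Q)
               \<le> ennreal (1 / A ^ j) * maximal (F j) x"
              using average_le_maximal[OF Q, of "F j"] by (rule mult_left_mono) simp
            also have "maximal (F j) x = ennreal (F (Suc j) x)" using elim by (simp add: FS less_top)
            also have "ennreal (1 / A ^ j) * ennreal (F (Suc j) x) = ennreal A * ennreal (F (Suc j) x / A ^ Suc j)"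
              using A Fpos[of "Suc j" x] by (simp add: ennreal_mult[symmetric])
            finally show "ennreal (1 / A ^ j) * ((\<integral>\<^sup>+y\<in>Q. ennreal \<bar>F j y\<bar> \<partial>lebesgue) / emeasure lebesgue Q)
               \<le> ennreal A * ennreal (F (Suc j) x / A ^ Suc j)" .
          qed auto
          also have "\<dots> = ennreal A * (\<Sum>j. ennreal (F (Suc j) x / A ^ Suc j))" by simp
          also have "\<dots> \<le> ennreal A * w x"
          proof (rule mult_left_mono)
            have "w x = (\<Sum>j. ennreal (F (j + 1) x / A ^ (j + 1))) + (\<Sum>j<1. ennreal (F j x / A ^ j))"
              unfolding w_def by (intro suminf_offset summableI)
            then show "(\<Sum>j. ennreal (F (Suc j) x / A ^ Suc j)) \<le> w x" by simp
          qed simp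
          finally show "(\<integral>\<^sup>+y\<in>Q. w y \<partial>lebesgue) / emeasure lebesgue Q \<le> ennreal A * w x" .
        qed
      qed
    qed
  qed
qed


text \<open>The majorant \<open>u\<close> is at least \<open>\<alpha> Q\<close> on
  \<open>E Q\<close>, so reverse Hoelder with exponent \<open>r = 1 + \<epsilon>\<close> bounds
  \<open>s * \<alpha> Q powr r\<close> by a multiple of \<open>T powr r\<close>, where
  \<open>T\<close> is the average of \<open>u\<close> over a grid cube around \<open>Q\<close>.
  Taking roots and using \<open>T \<le> A * u\<close> almost everywhere gives
  \<open>s powr (1 / r) * \<alpha> Q \<le> L * u\<close> on \<open>Q\<close>; the modular of the
  right-hand side adds up over disjoint cubes.\<close>

lemma maximal_bounded_imp_S_infty_condition:
  assumes "maximal_bounded p"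
  shows "S_infty_condition p"
proof -
  obtain A B :: real where A: "1 \<le> A" and B: "0 < B" and maj:
    "\<And>f :: real ^ 'n \<Rightarrow> real. f \<in> borel_measurable lebesgue \<Longrightarrow> (\<And>x. 0 \<le> f x) \<Longrightarrow>
      (\<integral>\<^sup>+x. ennreal (f x powr p x) \<partial>lebesgue) \<le> 1 \<Longrightarrow>
      \<exists>w. w \<in> borel_measurable lebesgue \<and> (AE x in lebesgue. w x < \<infinity>) \<and> (\<forall>x. ennreal (f x) \<le> w x) \<and>
        (\<integral>\<^sup>+x. ennreal (enn2real (w x) powr p x) \<partial>lebesgue) \<le> ennreal B \<and>
        (AE x in lebesgue. \<forall>Q. cube Q \<longrightarrow> x \<in> Q \<longrightarrow> (\<integral>\<^sup>+y\<in>Q. w y \<partial>lebesgue) / emeasure lebesgue Q \<le> ennreal A * w x)"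
    using maximal_bounded_imp_A1_majorant[OF assms] by blast
  \<comment> \<open>An A1 weight is at least \<open>1 / A\<close> times its average on almost all of
    a cube. This is the hypothesis of \<open>reverse_Hoelder\<close> with
    \<open>\<kappa> = 1\<close> and empty exceptional set.\<close>
  have \<delta>: "0 < 1 / A" "1 / A \<le> 1" using A by auto
  obtain \<epsilon> D where \<epsilon>: "0 < \<epsilon>" and D: "0 < D" and RH:
    "\<forall>(s :: 'n \<Rightarrow> bool) Q U u T e. A_infinity_on 1 (1 / A) s Q U u \<longrightarrow>
      0 < T \<longrightarrow> (\<integral>\<^sup>+x\<in>Q. ennreal (u x) \<partial>lebesgue) = ennreal T * emeasure lebesgue Q \<longrightarrow>
      0 < e \<longrightarrow> e \<le> \<epsilon> \<longrightarrow>
      (\<integral>\<^sup>+x\<in>Q - U. ennreal (u x powr (1 + e)) \<partial>lebesgue) \<le> ennreal (D * T powr (1 + e)) * emeasure lebesgue Q"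
    using reverse_Hoelder[OF zero_less_one order_refl \<delta>, where 'n = 'n] by auto
  define N :: real where "N = 6 ^ CARD('n)"
  have N: "N \<ge> 1" by (simp add: N_def)
  define r where "r = 1 + \<epsilon>"
  have r: "1 < r" using \<epsilon> by (simp add: r_def)
  define L where "L = (1 + D * N) powr (1 / r) * A"
  have L: "1 \<le> L"
  proof -
    have "1 \<le> (1 + D * N) powr (1 / r)" using D N r by (intro ge_one_powr_ge_zero) auto
    then show ?thesis unfolding L_def using A mult_mono[of 1 "(1 + D * N) powr (1 / r)" 1 A] by simp
  qed
  have main: "(\<Sum>Q\<in>F. \<integral>\<^sup>+x\<in>Q. ennreal ((s powr (1 / r) * \<alpha> Q) powr p x) \<partial>lebesgue) \<le> ennreal (L powr b * B)"
    if s: "0 < s" "s < 1/2" and F: "finite F" "\<forall>Q\<in>F. cube Q" "disjoint F" and \<alpha>: "\<forall>Q\<in>F. 0 < \<alpha> Q \<and> \<alpha> Q < 1"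
      and E: "\<forall>Q\<in>F. E Q \<in> sets lebesgue \<and> E Q \<subseteq> Q \<and> measure lebesgue (E Q) = s * measure lebesgue Q"
      and le1: "(\<Sum>Q\<in>F. \<integral>\<^sup>+x\<in>E Q. ennreal (\<alpha> Q powr p x) \<partial>lebesgue) \<le> 1"
    for s :: real and F :: "(real ^ 'n) set set" and \<alpha> :: "(real ^ 'n) set \<Rightarrow> real" and E :: "(real ^ 'n) set \<Rightarrow> (real ^ 'n) set"
  proof -
    have Es [measurable]: "E Q \<in> sets lebesgue" if "Q \<in> F" for Q using E that by blast
    have Fs [measurable]: "Q \<in> sets lebesgue" if "Q \<in> F" for Q using F(2) that by (simp add: cube_lebesgue(1))
    define f where "f = (\<lambda>x. \<Sum>Q\<in>F. \<alpha> Q * indicator (E Q) x)"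
    have fm [measurable]: "f \<in> borel_measurable lebesgue" unfolding f_def by (intro borel_measurable_sum) simp
    have f0: "0 \<le> f x" for x unfolding f_def using \<alpha> by (intro sum_nonneg) (auto simp: less_imp_le)
    have fE: "f x = \<alpha> Q" if "Q \<in> F" "x \<in> E Q" for x Q
    proof -
      have "f x = (\<Sum>Q'\<in>{Q}. \<alpha> Q' * indicator (E Q') x)"
        unfolding f_def
      proof (rule sum.mono_neutral_right)
        show "\<forall>Q'\<in>F - {Q}. \<alpha> Q' * indicat_real (E Q') x = 0"
        proof
          fix Q' assume Q': "Q' \<in> F - {Q}"
          then have "Q \<inter> Q' = {}" using F(3) that(1) by (auto simp: disjoint_def pairwise_def disjnt_def)
          then have "x \<notin> E Q'" using E that Q' by blast
          then show "\<alpha> Q' * indicat_real (E Q') x = 0" by simp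
        qed
      qed (use F(1) that in auto)
      then show ?thesis using that by simp
    qed
    have f_out: "f x = 0" if "\<forall>Q\<in>F. x \<notin> E Q" for x
      unfolding f_def using that by (intro sum.neutral) auto
    have "(\<integral>\<^sup>+x. ennreal (f x powr p x) \<partial>lebesgue) \<le> (\<integral>\<^sup>+x. (\<Sum>Q\<in>F. ennreal (\<alpha> Q powr p x) * indicator (E Q) x) \<partial>lebesgue)"
    proof (rule nn_integral_mono)
      fix x
      show "ennreal (f x powr p x) \<le> (\<Sum>Q\<in>F. ennreal (\<alpha> Q powr p x) * indicator (E Q) x)"
      proof (cases "\<exists>Q\<in>F. x \<in> E Q")
        case True
        then obtain Q where Q: "Q \<in> F" "x \<in> E Q" by blast
        have "ennreal (f x powr p x) = (\<Sum>Q'\<in>{Q}. ennreal (\<alpha> Q' powr p x) * indicator (E Q') x)" using fE[OF Q] Q by simp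
        also have "\<dots> \<le> (\<Sum>Q\<in>F. ennreal (\<alpha> Q powr p x) * indicator (E Q) x)"
          using F(1) Q by (intro sum_mono2) auto
        finally show ?thesis .
      next
        case False then show ?thesis using f_out[of x] by auto
      qed
    qed
    also have "\<dots> = (\<Sum>Q\<in>F. \<integral>\<^sup>+x\<in>E Q. ennreal (\<alpha> Q powr p x) \<partial>lebesgue)"
      by (rule nn_integral_sum) simp
    finally have "(\<integral>\<^sup>+x. ennreal (f x powr p x) \<partial>lebesgue) \<le> 1" using le1 by (rule order_trans)
    from maj[OF fm f0 this] obtain w where w [measurable]: "w \<in> borel_measurable lebesgue"
      and wfin: "AE x in lebesgue. w x < \<infinity>" and fw: "\<And>x. ennreal (f x) \<le> w x"
      and wB: "(\<integral>\<^sup>+x. ennreal (enn2real (w x) powr p x) \<partial>lebesgue) \<le> ennreal B"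
      and wA: "AE x in lebesgue. \<forall>Q. cube Q \<longrightarrow> x \<in> Q \<longrightarrow> (\<integral>\<^sup>+y\<in>Q. w y \<partial>lebesgue) / emeasure lebesgue Q \<le> ennreal A * w x"
      by blast
    define u where "u = (\<lambda>x. enn2real (w x))"
    have um [measurable]: "u \<in> borel_measurable lebesgue" unfolding u_def by measurable
    have u0: "0 \<le> u x" for x by (simp add: u_def)
    have wu: "AE x in lebesgue. w x = ennreal (u x)" using wfin by eventually_elim (simp add: u_def)
    have avg: "\<exists>c\<ge>0. (\<integral>\<^sup>+x\<in>V. ennreal (u x) \<partial>lebesgue) = ennreal c * emeasure lebesgue V \<and> (AE x in lebesgue. x \<in> V \<longrightarrow> c \<le> A * u x)"
      if V: "cube V" for V
    proof -
      have Vs [measurable]: "V \<in> sets lebesgue" using V by (rule cube_lebesgue)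
      obtain v where v: "emeasure lebesgue V = ennreal v" "v > 0"
        using cube_emeasure[OF V] by blast
      have eq: "(\<integral>\<^sup>+x\<in>V. w x \<partial>lebesgue) = (\<integral>\<^sup>+x\<in>V. ennreal (u x) \<partial>lebesgue)"
        using wu by (intro nn_integral_cong_AE) auto
      have le: "AE x in lebesgue. x \<in> V \<longrightarrow> (\<integral>\<^sup>+x\<in>V. ennreal (u x) \<partial>lebesgue) / ennreal v \<le> ennreal (A * u x)"
        using wA wu
      proof eventually_elim
        case (elim x)
        then show ?case using V v A u0[of x] unfolding eq[symmetric] by (auto simp: ennreal_mult)
      qed
      \<comment> \<open>One point of \<open>V\<close> at which the A1 inequality holds with a finite
        right-hand side shows that the average over \<open>V\<close> is finite.\<close>
      have "\<exists>x\<in>V. (\<integral>\<^sup>+x\<in>V. ennreal (u x) \<partial>lebesgue) / ennreal v \<le> ennreal (A * u x)"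
      proof (rule ccontr)
        assume "\<not> ?thesis"
        then have "AE x in lebesgue. x \<notin> V" using le by (auto elim!: eventually_mono)
        then have "emeasure lebesgue V = 0" by (subst (asm) AE_iff_null_sets[symmetric]) auto
        then show False using v by simp
      qed
      then have "(\<integral>\<^sup>+x\<in>V. ennreal (u x) \<partial>lebesgue) / ennreal v < \<infinity>" by (auto intro: le_less_trans)
      then obtain c where c: "c \<ge> 0" "(\<integral>\<^sup>+x\<in>V. ennreal (u x) \<partial>lebesgue) / ennreal v = ennreal c"
        by (cases "(\<integral>\<^sup>+x\<in>V. ennreal (u x) \<partial>lebesgue) / ennreal v") auto
      have "(\<integral>\<^sup>+x\<in>V. ennreal (u x) \<partial>lebesgue) = ((\<integral>\<^sup>+x\<in>V. ennreal (u x) \<partial>lebesgue) / ennreal v) * ennreal v"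
        using v(2) by (simp add: ennreal_divide_times ennreal_mult_divide_eq)
      then have "(\<integral>\<^sup>+x\<in>V. ennreal (u x) \<partial>lebesgue) = ennreal c * emeasure lebesgue V"
        unfolding c(2) v(1) .
      moreover have "AE x in lebesgue. x \<in> V \<longrightarrow> c \<le> A * u x"
        using le unfolding c(2) using A u0 by (simp add: ennreal_le_iff)
      ultimately show ?thesis using c(1) by blast
    qed
    have good: "\<exists>c\<ge>0. (\<integral>\<^sup>+x\<in>V. ennreal (u x) \<partial>lebesgue) \<le> ennreal c * emeasure lebesgue V \<and>
          ennreal 1 * emeasure lebesgue V \<le> emeasure lebesgue {x\<in>V. 1 / A * c \<le> u x}" if V: "V \<in> grid \<sigma>" for V and \<sigma> :: "'n \<Rightarrow> bool"
    proof -
      have Vs [measurable]: "V \<in> sets lebesgue" using V by (rule grid_sets)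
      obtain c where c: "c \<ge> 0" "(\<integral>\<^sup>+x\<in>V. ennreal (u x) \<partial>lebesgue) = ennreal c * emeasure lebesgue V" "AE x in lebesgue. x \<in> V \<longrightarrow> c \<le> A * u x"
        using avg[OF cube_grid[OF V]] by blast
      have s: "{x\<in>V. 1 / A * c \<le> u x} \<in> sets lebesgue"
      proof -
        have "{x\<in>V. 1 / A * c \<le> u x} = V \<inter> {x\<in>space lebesgue. 1 / A * c \<le> u x}" by auto
        then show ?thesis by simp
      qed
      have "emeasure lebesgue V \<le> emeasure lebesgue {x\<in>V. 1 / A * c \<le> u x}"
      proof (rule emeasure_mono_AE[OF _ s])
        show "AE x in lebesgue. x \<in> V \<longrightarrow> x \<in> {x \<in> V. 1 / A * c \<le> u x}"
          using c(3) by eventually_elim (use A in \<open>auto simp: field_simps\<close>)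
      qed
      then show ?thesis using c by (intro exI[of _ c]) auto
    qed
    define M where "M = density lebesgue (\<lambda>x. ennreal ((L * u x) powr p x))"
    have M: "emeasure M S = (\<integral>\<^sup>+x\<in>S. ennreal ((L * u x) powr p x) \<partial>lebesgue)" if "S \<in> sets lebesgue" for S
      unfolding M_def using that by (simp add: emeasure_density)
    have each: "(\<integral>\<^sup>+x\<in>Q. ennreal ((s powr (1 / r) * \<alpha> Q) powr p x) \<partial>lebesgue) \<le> emeasure M Q" if Q: "Q \<in> F" for Q
    proof -
      have cQ: "cube Q" using Q F by blast
      obtain v where v: "emeasure lebesgue Q = ennreal v" "v > 0" "measure lebesgue Q = v"
        using cube_emeasure[OF cQ] by blast
      have \<alpha>Q: "0 < \<alpha> Q" using \<alpha> Q by blast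
      have Ev: "emeasure lebesgue (E Q) = ennreal (s * v)"
      proof -
        have "emeasure lebesgue (E Q) \<le> emeasure lebesgue Q" using E Q Fs[OF Q] by (intro emeasure_mono) auto
        then have "emeasure lebesgue (E Q) \<noteq> top" using v by (auto simp: top_unique)
        then show ?thesis using E Q v(3) by (simp add: emeasure_eq_ennreal_measure)
      qed
      \<comment> \<open>\<open>Q\<close> is an arbitrary cube, whereas the reverse Hoelder
        inequality is about grid cubes; the enlargement costs the factor \<open>N\<close>.\<close>
      obtain \<sigma> P where P: "P \<in> grid \<sigma>" "Q \<subseteq> P" "emeasure lebesgue P \<le> 6 ^ CARD('n) * emeasure lebesgue Q"
        using cube_subset_grid_cube[OF cQ] by blast
      have Ps [measurable]: "P \<in> sets lebesgue" using P(1) by (rule grid_sets)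
      obtain T where T: "T \<ge> 0" "(\<integral>\<^sup>+x\<in>P. ennreal (u x) \<partial>lebesgue) = ennreal T * emeasure lebesgue P" "AE x in lebesgue. x \<in> P \<longrightarrow> T \<le> A * u x"
        using avg[OF cube_grid[OF P(1)]] by blast
      have \<alpha>u: "AE x in lebesgue. x \<in> E Q \<longrightarrow> \<alpha> Q \<le> u x"
        using wu
      proof eventually_elim
        case (elim x)
        then show ?case using fw[of x] fE[OF Q, of x] u0[of x] by auto
      qed
      have pos: "0 < T"
      proof (rule ccontr)
        assume "\<not> 0 < T"
        then have "T = 0" using T(1) by simp
        have "ennreal (\<alpha> Q) * ennreal (s * v) = (\<integral>\<^sup>+x. ennreal (\<alpha> Q) * indicator (E Q) x \<partial>lebesgue)"
          using Es[OF Q] by (subst nn_integral_cmult_indicator) (auto simp: Ev)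
        also have "\<dots> \<le> (\<integral>\<^sup>+x\<in>P. ennreal (u x) \<partial>lebesgue)"
          by (intro nn_integral_mono_AE eventually_mono[OF \<alpha>u]) (use E Q P(2) in \<open>auto simp: indicator_def intro!: ennreal_leI\<close>)
        finally have "ennreal (\<alpha> Q * (s * v)) \<le> 0" using T(2) \<open>T = 0\<close> \<alpha>Q s v by (simp add: ennreal_mult[symmetric])
        then show False using \<alpha>Q s v by (simp add: mult_le_0_iff)
      qed
      have "ennreal (\<alpha> Q powr r) * ennreal (s * v) = (\<integral>\<^sup>+x. ennreal (\<alpha> Q powr r) * indicator (E Q) x \<partial>lebesgue)"
        using Es[OF Q] by (subst nn_integral_cmult_indicator) (auto simp: Ev)
      also have "\<dots> \<le> (\<integral>\<^sup>+x\<in>P - {}. ennreal (u x powr (1 + \<epsilon>)) \<partial>lebesgue)"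
        by (intro nn_integral_mono_AE eventually_mono[OF \<alpha>u])
          (use E Q P(2) \<alpha>Q \<epsilon> in \<open>auto simp: indicator_def r_def intro!: ennreal_leI powr_mono2\<close>)
      also have "\<dots> \<le> ennreal (D * T powr (1 + \<epsilon>)) * emeasure lebesgue P"
      proof -
        have "A_infinity_on 1 (1 / A) \<sigma> P {} u"
          unfolding A_infinity_on_def using P(1) um u0 good by blast
        then show ?thesis using RH[rule_format, of \<sigma> P "{}" u T \<epsilon>] pos T(2) \<epsilon> by simp
      qed
      also have "\<dots> \<le> ennreal (D * T powr r) * (ennreal N * ennreal v)"
        unfolding r_def using P(3) v by (intro mult_left_mono) (auto simp: N_def ennreal_power[symmetric])
      finally have "ennreal (\<alpha> Q powr r * (s * v)) \<le> ennreal (D * T powr r * (N * v))"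
        using s v N D by (simp add: ennreal_mult)
      then have "\<alpha> Q powr r * (s * v) \<le> D * T powr r * (N * v)"
        using D N v by (simp add: ennreal_le_iff)
      then have "s * \<alpha> Q powr r \<le> D * N * T powr r" using v(2) by (simp add: field_simps)
      also have "\<dots> \<le> (1 + D * N) * T powr r" by (intro mult_right_mono) auto
      finally have "(s * \<alpha> Q powr r) powr (1 / r) \<le> ((1 + D * N) * T powr r) powr (1 / r)"
        using s r by (intro powr_mono2) auto
      then have sT: "s powr (1 / r) * \<alpha> Q \<le> (1 + D * N) powr (1 / r) * T"
        using s \<alpha>Q pos r D N by (simp add: powr_mult powr_powr)
      have sL: "s powr (1 / r) * \<alpha> Q \<le> L * u x" if "T \<le> A * u x" for x
      proof -
        have "(1 + D * N) powr (1 / r) * T \<le> (1 + D * N) powr (1 / r) * (A * u x)"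
          using that by (intro mult_left_mono) auto
        then show ?thesis using sT by (simp add: L_def mult.assoc)
      qed
      have key: "AE x in lebesgue. x \<in> Q \<longrightarrow> s powr (1 / r) * \<alpha> Q \<le> L * u x"
        by (rule eventually_mono[OF T(3)]) (use sL P(2) in blast)
      show ?thesis unfolding M[OF Fs[OF Q]]
        by (intro nn_integral_mono_AE eventually_mono[OF key])
          (use s \<alpha>Q p_pos in \<open>auto simp: indicator_def intro!: ennreal_leI powr_mono2\<close>)
    qed
    have "(\<Sum>Q\<in>F. \<integral>\<^sup>+x\<in>Q. ennreal ((s powr (1 / r) * \<alpha> Q) powr p x) \<partial>lebesgue) \<le> (\<Sum>Q\<in>F. emeasure M Q)"
      using each by (rule sum_mono)
    also have "\<dots> = emeasure M (\<Union>F)" using F Fs by (intro sum_emeasure_disjoint) (auto simp: M_def)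
    also have "\<dots> \<le> emeasure M (space M)" by (rule emeasure_space)
    also have "\<dots> = (\<integral>\<^sup>+x. ennreal ((L * u x) powr p x) \<partial>lebesgue)"
      using M[of UNIV] by (simp add: M_def)
    also have "\<dots> \<le> (\<integral>\<^sup>+x. ennreal (L powr b) * ennreal (u x powr p x) \<partial>lebesgue)"
      using powr_scale_up[OF L u0] by (intro nn_integral_mono) (simp add: ennreal_mult[symmetric] ennreal_leI)
    also have "\<dots> = ennreal (L powr b) * (\<integral>\<^sup>+x. ennreal (u x powr p x) \<partial>lebesgue)"
      by (rule nn_integral_cmult) simp
    also have "\<dots> \<le> ennreal (L powr b) * ennreal B" using wB by (intro mult_left_mono) (auto simp: u_def)
    also have "\<dots> = ennreal (L powr b * B)" using B by (simp add: ennreal_mult)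
    finally show ?thesis .
  qed
  show ?thesis unfolding S_infty_condition_def
  proof (rule exI[of _ r], rule exI[of _ "1/2"], rule exI[of _ "L powr b * B"], intro conjI allI impI)
    show "1 < r" by fact
    show "0 < L powr b * B" using L B by simp
  qed (use main in auto)
qed

end

subsection \<open>Quantiles\<close>

lemma measurable_subset_level [measurable]:
  fixes g :: "'a::euclidean_space \<Rightarrow> real"
  assumes [measurable]: "A \<in> sets lebesgue" "g \<in> borel_measurable lebesgue"
  shows "{x\<in>A. g x < t} \<in> sets lebesgue" "{x\<in>A. g x \<le> t} \<in> sets lebesgue"
    "{x\<in>A. t < g x} \<in> sets lebesgue" "{x\<in>A. t \<le> g x} \<in> sets lebesgue"
proof -
  have "{x\<in>A. g x < t} = A \<inter> {x\<in>space lebesgue. g x < t}" "{x\<in>A. g x \<le> t} = A \<inter> {x\<in>space lebesgue. g x \<le> t}"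
    "{x\<in>A. t < g x} = A \<inter> {x\<in>space lebesgue. t < g x}" "{x\<in>A. t \<le> g x} = A \<inter> {x\<in>space lebesgue. t \<le> g x}"
    by auto
  then show "{x\<in>A. g x < t} \<in> sets lebesgue" "{x\<in>A. g x \<le> t} \<in> sets lebesgue"
    "{x\<in>A. t < g x} \<in> sets lebesgue" "{x\<in>A. t \<le> g x} \<in> sets lebesgue" by simp_all
qed

text \<open>\<open>\<tau>\<close> is the infimum of the levels \<open>s\<close> for which
  \<open>{g > s}\<close> has measure at most \<open>c\<close>. Continuity from below treats the
  strict superlevel set, continuity from above the weak one. Both are recorded because
  \<open>g\<close> may be constant on a large set.\<close>

lemma quantile_exists:
  fixes g :: "'a::euclidean_space \<Rightarrow> real" and c :: ennreal
  assumes A [measurable]: "A \<in> sets lebesgue" and fin: "emeasure lebesgue A < \<infinity>"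
    and g [measurable]: "g \<in> borel_measurable lebesgue"
    and bd: "\<And>x. x \<in> A \<Longrightarrow> lo \<le> g x" "\<And>x. x \<in> A \<Longrightarrow> g x \<le> hi" and lohi: "lo \<le> hi"
    and c: "c \<le> emeasure lebesgue A"
  shows "\<exists>\<tau>. lo \<le> \<tau> \<and> \<tau> \<le> hi \<and> emeasure lebesgue {x\<in>A. \<tau> < g x} \<le> c \<and> c \<le> emeasure lebesgue {x\<in>A. \<tau> \<le> g x}"
proof -
  define m where "m = (\<lambda>s. emeasure lebesgue {x\<in>A. s < g x})"
  have m_anti: "m t \<le> m s" if "s \<le> t" for s t
    unfolding m_def using that by (intro emeasure_mono) auto
  define S where "S = {s. lo \<le> s \<and> s \<le> hi \<and> m s \<le> c}"
  have "{x\<in>A. hi < g x} = {}" using bd(2) by force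
  then have "m hi = 0" unfolding m_def by (simp only: emeasure_empty)
  then have hiS: "hi \<in> S" using lohi by (simp add: S_def)
  have bS: "bdd_below S" by (intro bdd_belowI[of _ lo]) (auto simp: S_def)
  define \<tau> where "\<tau> = Inf S"
  have \<tau>: "lo \<le> \<tau>" "\<tau> \<le> hi"
    unfolding \<tau>_def using hiS bS by (auto intro: cInf_lower cInf_greatest simp: S_def)
  have "emeasure lebesgue {x\<in>A. \<tau> < g x} \<le> c"
  proof -
    define X where "X = (\<lambda>n::nat. {x\<in>A. \<tau> + 1 / real (Suc n) < g x})"
    have X: "{x\<in>A. \<tau> < g x} = (\<Union>n. X n)"
    proof
      show "{x\<in>A. \<tau> < g x} \<subseteq> (\<Union>n. X n)"
      proof
        fix x assume x: "x \<in> {x\<in>A. \<tau> < g x}"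
        then obtain n where "inverse (real (Suc n)) < g x - \<tau>" using reals_Archimedean[of "g x - \<tau>"] by auto
        then have "x \<in> X n" using x by (simp add: X_def inverse_eq_divide algebra_simps)
        then show "x \<in> (\<Union>n. X n)" by blast
      qed
      show "(\<Union>n. X n) \<subseteq> {x\<in>A. \<tau> < g x}"
      proof
        fix x assume "x \<in> (\<Union>n. X n)"
        then obtain n where n: "x \<in> A" "\<tau> + 1 / real (Suc n) < g x" by (auto simp: X_def)
        have "0 < 1 / real (Suc n)" by simp
        then have "\<tau> < g x" using n(2) by linarith
        then show "x \<in> {x\<in>A. \<tau> < g x}" using n(1) by simp
      qed
    qed
    have sup: "(SUP n. emeasure lebesgue (X n)) = emeasure lebesgue (\<Union>n. X n)"
    proof (rule SUP_emeasure_incseq)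
      show "range X \<subseteq> sets lebesgue" by (auto simp: X_def)
      have "1 / real (Suc n) \<le> 1 / real (Suc k)" if "k \<le> n" for k n using that by (intro divide_left_mono) auto
      then have "\<tau> + 1 / real (Suc n) \<le> \<tau> + 1 / real (Suc k)" if "k \<le> n" for k n using that by simp
      then show "incseq X" unfolding incseq_def X_def by (blast intro: le_less_trans)
    qed
    have "emeasure lebesgue (X n) \<le> c" for n
    proof -
      have "0 < 1 / real (Suc n)" by simp
      then have "Inf S < \<tau> + 1 / real (Suc n)" unfolding \<tau>_def by linarith
      then obtain s where s: "s \<in> S" "s < \<tau> + 1 / real (Suc n)"
        using cInf_less_iff[of S] hiS bS by blast
      have "emeasure lebesgue (X n) \<le> m s" using m_anti[of s "\<tau> + 1 / real (Suc n)"] s(2) by (simp add: X_def m_def)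
      then show ?thesis using s(1) by (auto simp: S_def intro: order_trans)
    qed
    then show ?thesis unfolding X sup[symmetric] by (rule SUP_least)
  qed
  moreover have "c \<le> emeasure lebesgue {x\<in>A. \<tau> \<le> g x}"
  proof (cases "\<tau> = lo")
    case True
    then have "{x\<in>A. \<tau> \<le> g x} = A" using bd(1) by auto
    then show ?thesis using c by simp
  next
    case False
    \<comment> \<open>With steps \<open>d / real (Suc n)\<close> the approximating levels stay at or
      above \<open>lo\<close>, within the range over which \<open>S\<close> is defined.\<close>
    define d where "d = \<tau> - lo"
    have d: "d > 0" using False \<tau> by (simp add: d_def)
    define X where "X = (\<lambda>n::nat. {x\<in>A. \<tau> - d / real (Suc n) < g x})"
    have X: "{x\<in>A. \<tau> \<le> g x} = (\<Inter>n. X n)"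
    proof
      show "{x\<in>A. \<tau> \<le> g x} \<subseteq> (\<Inter>n. X n)"
      proof
        fix x assume x: "x \<in> {x\<in>A. \<tau> \<le> g x}"
        have "\<tau> - d / real (Suc n) < g x" for n
        proof -
          have "0 < d / real (Suc n)" using d by simp
          moreover have "\<tau> \<le> g x" using x by simp
          ultimately show ?thesis by linarith
        qed
        then show "x \<in> (\<Inter>n. X n)" using x unfolding X_def by blast
      qed
      show "(\<Inter>n. X n) \<subseteq> {x\<in>A. \<tau> \<le> g x}"
      proof
        fix x assume x: "x \<in> (\<Inter>n. X n)"
        then have lt: "\<tau> - d / real (Suc n) < g x" and xA: "x \<in> A" for n unfolding X_def by blast+
        have "(\<lambda>n. \<tau> - d * (1 / real (Suc n))) \<longlonglongrightarrow> \<tau> - d * 0"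
          by (intro tendsto_intros LIMSEQ_Suc[OF lim_1_over_n])
        then have "(\<lambda>n. \<tau> - d / real (Suc n)) \<longlonglongrightarrow> \<tau>" by simp
        then have "\<tau> \<le> g x" using lt by (intro LIMSEQ_le_const2[of "\<lambda>n. \<tau> - d / real (Suc n)"]) (auto intro: less_imp_le)
        then show "x \<in> {x\<in>A. \<tau> \<le> g x}" using xA by simp
      qed
    qed
    have inf: "(INF n. emeasure lebesgue (X n)) = emeasure lebesgue (\<Inter>n. X n)"
    proof (rule INF_emeasure_decseq)
      show "range X \<subseteq> sets lebesgue" by (auto simp: X_def)
      have "d / real (Suc n) \<le> d / real (Suc k)" if "k \<le> n" for k n using that d by (intro divide_left_mono) auto
      then have "\<tau> - d / real (Suc k) \<le> \<tau> - d / real (Suc n)" if "k \<le> n" for k n using that by simp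
      then show "decseq X" unfolding decseq_def X_def by (blast intro: le_less_trans)
      show "emeasure lebesgue (X n) \<noteq> \<infinity>" for n
        using emeasure_mono[of "X n" A lebesgue] fin by (auto simp: X_def top_unique)
    qed
    have "c \<le> emeasure lebesgue (X n)" for n
    proof -
      have "d / real (Suc n) \<le> d" "0 < d / real (Suc n)" using d by (auto simp: field_simps)
      then have "lo \<le> \<tau> - d / real (Suc n)" "\<tau> - d / real (Suc n) < \<tau>" by (auto simp: d_def)
      moreover have "\<tau> - d / real (Suc n) \<notin> S"
        using calculation(2) cInf_lower[OF _ bS] unfolding \<tau>_def by (meson not_le)
      ultimately have "\<not> m (\<tau> - d / real (Suc n)) \<le> c" using \<tau> by (auto simp: S_def)
      then show ?thesis by (simp add: m_def X_def)
    qed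
    then show ?thesis unfolding X inf[symmetric] by (rule INF_greatest)
  qed
  ultimately show ?thesis using \<tau> by (intro exI[of _ \<tau>] conjI)
qed

text \<open>Halfspaces orthogonal to a coordinate axis sweep out \<open>A\<close> continuously,
  since hyperplanes are null. Exactness matters because the S-infinity condition prescribes the
  measure of \<open>E Q\<close> by an equation.\<close>

lemma subset_of_given_measure:
  fixes A :: "(real ^ 'n) set" and c :: ennreal
  assumes A [measurable]: "A \<in> sets lebesgue" and Q: "cube Q" "A \<subseteq> Q" and c: "c \<le> emeasure lebesgue A"
  shows "\<exists>E\<subseteq>A. E \<in> sets lebesgue \<and> emeasure lebesgue E = c"
proof -
  obtain a l where l: "0 < l" "Q \<subseteq> cbox a (\<chi> i. a $ i + l)" using cube_bounds[OF Q(1)] by metis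
  define i :: 'n where "i = undefined"
  have b: "a $ i \<le> x $ i" "x $ i \<le> a $ i + l" if "x \<in> A" for x
  proof -
    have "x \<in> cbox a (\<chi> i. a $ i + l)" using that Q(2) l(2) by blast
    then show "a $ i \<le> x $ i" "x $ i \<le> a $ i + l" by (auto simp: mem_box_cart)
  qed
  have fin: "emeasure lebesgue A < \<infinity>"
    using emeasure_mono[OF Q(2), of lebesgue] cube_emeasure(2)[OF Q(1)] cube_lebesgue(1)[OF Q(1)] by auto
  have m [measurable]: "(\<lambda>x :: real ^ 'n. x $ i) \<in> borel_measurable lebesgue"
    by (rule measurable_completion) simp
  obtain \<tau> where \<tau>: "emeasure lebesgue {x\<in>A. \<tau> < x $ i} \<le> c" "c \<le> emeasure lebesgue {x\<in>A. \<tau> \<le> x $ i}"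
    using quantile_exists[OF A fin m b _ c] l(1) by auto
  have "negligible {x :: real ^ 'n. x $ i = \<tau>}"
    using negligible_standard_hyperplane[of "axis i 1 :: real ^ 'n" \<tau>] by (simp add: inner_axis)
  then have z: "emeasure lebesgue {x :: real ^ 'n. x $ i = \<tau>} = 0" "{x :: real ^ 'n. x $ i = \<tau>} \<in> sets lebesgue"
    by (auto simp: negligible_iff_null_sets null_sets_def)
  have "emeasure lebesgue {x\<in>A. \<tau> \<le> x $ i} \<le> emeasure lebesgue ({x\<in>A. \<tau> < x $ i} \<union> {x. x $ i = \<tau>})"
    using z(2) by (intro emeasure_mono sets.Un) auto
  also have "\<dots> \<le> emeasure lebesgue {x\<in>A. \<tau> < x $ i} + emeasure lebesgue {x. x $ i = \<tau>}"
    using z(2) by (intro emeasure_subadditive) auto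
  finally have "c \<le> emeasure lebesgue {x\<in>A. \<tau> < x $ i}" using \<tau>(2) z(1) by (simp add: order_trans)
  then have "emeasure lebesgue {x\<in>A. \<tau> < x $ i} = c" using \<tau>(1) by simp
  then show ?thesis by (intro exI[of _ "{x\<in>A. \<tau> < x $ i}"]) auto
qed

context exponent begin

lemma quantile_p:
  assumes V: "cube V" and l: "0 \<le> l" "l \<le> 1"
  shows "\<exists>\<tau>. a \<le> \<tau> \<and> \<tau> \<le> b \<and> emeasure lebesgue {x\<in>V. \<tau> < p x} \<le> ennreal l * emeasure lebesgue V \<and>
    ennreal l * emeasure lebesgue V \<le> emeasure lebesgue {x\<in>V. \<tau> \<le> p x}"
proof -
  have "ennreal l * emeasure lebesgue V \<le> 1 * emeasure lebesgue V"
    using l by (intro mult_right_mono) auto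
  then show ?thesis
    using quantile_exists[OF cube_lebesgue(1)[OF V] cube_emeasure(2)[OF V] p_meas p_ge p_le a_le_b] by auto
qed

lemma emeasure_le_quantile:
  assumes V: "cube V" and l: "0 \<le> l" "l \<le> 1"
    and le: "emeasure lebesgue {x\<in>V. \<tau> < p x} \<le> ennreal l * emeasure lebesgue V"
  shows "ennreal (1 - l) * emeasure lebesgue V \<le> emeasure lebesgue {x\<in>V. p x \<le> \<tau>}"
proof -
  have Vs [measurable]: "V \<in> sets lebesgue" using V by (rule cube_lebesgue)
  obtain v where v: "emeasure lebesgue V = ennreal v" "v > 0" using cube_emeasure[OF V] by blast
  have "V = {x\<in>V. \<tau> < p x} \<union> {x\<in>V. p x \<le> \<tau>}" by auto
  then have "emeasure lebesgue V \<le> emeasure lebesgue {x\<in>V. \<tau> < p x} + emeasure lebesgue {x\<in>V. p x \<le> \<tau>}"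
    using emeasure_subadditive[of "{x\<in>V. \<tau> < p x}" lebesgue "{x\<in>V. p x \<le> \<tau>}"] by simp
  also have "\<dots> \<le> ennreal (l * v) + emeasure lebesgue {x\<in>V. p x \<le> \<tau>}"
    using le l v by (intro add_right_mono) (simp add: ennreal_mult)
  finally have *: "ennreal v \<le> ennreal (l * v) + emeasure lebesgue {x\<in>V. p x \<le> \<tau>}" using v by simp
  have "ennreal ((1 - l) * v) \<le> emeasure lebesgue {x\<in>V. p x \<le> \<tau>}"
  proof (cases "emeasure lebesgue {x\<in>V. p x \<le> \<tau>}")
    case (real r)
    then have "v \<le> l * v + r" using * l v by (simp add: ennreal_plus[symmetric] del: ennreal_plus)
    then show ?thesis using real by (simp add: algebra_simps ennreal_leI)
  qed auto
  then show ?thesis using l v by (simp add: ennreal_mult)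
qed

lemma pmass_subset_const_ge:
  assumes "A \<in> sets lebesgue" "0 \<le> c" "\<And>x. x \<in> A \<Longrightarrow> c \<le> t powr p x" "A \<subseteq> B"
  shows "ennreal c * emeasure lebesgue A \<le> pmass B t"
proof -
  have "ennreal c * emeasure lebesgue A = (\<integral>\<^sup>+x. ennreal c * indicator A x \<partial>lebesgue)"
    using assms(1) by (simp add: nn_integral_cmult_indicator)
  also have "\<dots> \<le> pmass B t" unfolding pmass_def using assms(3,4)
    by (intro nn_integral_mono) (auto simp: indicator_def intro: ennreal_leI)
  finally show ?thesis .
qed

lemma pmass_le_const:
  assumes "A \<in> sets lebesgue" "\<And>x. x \<in> A \<Longrightarrow> t powr p x \<le> c"
  shows "pmass A t \<le> ennreal c * emeasure lebesgue A"
proof -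
  have "pmass A t \<le> (\<integral>\<^sup>+x. ennreal c * indicator A x \<partial>lebesgue)"
    unfolding pmass_def using assms(2) by (intro nn_integral_mono) (auto simp: indicator_def intro: ennreal_leI)
  also have "\<dots> = ennreal c * emeasure lebesgue A" using assms(1) by (simp add: nn_integral_cmult_indicator)
  finally show ?thesis .
qed

end

subsection \<open>Large levels\<close>

context exponent begin

text \<open>\<open>s\<close> and \<open>t\<close> stand for the norms of the indicator of
  \<open>Q\<close> in the two spaces, up to a factor. Keeping witnesses of the modular inequalities
  avoids infima and makes the symmetry between \<open>p\<close> and \<open>q\<close> plain.\<close>

definition A_pair :: "real \<Rightarrow> bool" where
  "A_pair C \<longleftrightarrow> 1 \<le> C \<and> (\<forall>Q. cube Q \<longrightarrow> (\<exists>s>0. \<exists>t>0. pmass Q (1 / s) \<le> 1 \<and> exponent.pmass q Q (1 / t) \<le> 1 \<and>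
     s * t \<le> C * measure lebesgue Q))"

lemma A_condition_imp_A_pair:
  assumes "A_condition p" shows "\<exists>C. A_pair C"
proof -
  interpret q: exponent q "b / (b - 1)" "a / (a - 1)" by (rule exponent_conj)
  obtain C where C: "0 \<le> C" "(SUP Q\<in>{Q. cube Q}. Lp_norm p (indicator Q) * Lp_norm q (indicator Q) / emeasure lebesgue Q) = ennreal C"
    using assms unfolding A_condition_def
    by (cases "SUP Q\<in>{Q. cube Q}. Lp_norm p (indicator Q) * Lp_norm q (indicator Q) / emeasure lebesgue Q") auto
  have "A_pair (4 * C + 1)" unfolding A_pair_def
  proof (intro conjI allI impI)
    show "1 \<le> 4 * C + 1" using C by simp
    fix Q :: "(real ^ 'n) set" assume Q: "cube Q"
    obtain \<nu> where \<nu>: "\<nu> > 0" "Lp_norm p (indicator Q) = ennreal \<nu>" using Lp_norm_indicator_cube[OF Q] by auto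
    obtain \<mu> where \<mu>: "\<mu> > 0" "Lp_norm q (indicator Q) = ennreal \<mu>" using q.Lp_norm_indicator_cube[OF Q] by auto
    obtain v where v: "emeasure lebesgue Q = ennreal v" "v > 0" "measure lebesgue Q = v" using cube_emeasure[OF Q] by blast
    have "Lp_norm p (indicator Q) * Lp_norm q (indicator Q) / emeasure lebesgue Q \<le> ennreal C"
      unfolding C(2)[symmetric] using Q by (intro SUP_upper) auto
    then have "ennreal (\<nu> * \<mu> / v) \<le> ennreal C" unfolding \<nu> \<mu> v using \<nu> \<mu> v
      by (simp add: ennreal_mult[symmetric] divide_ennreal)
    then have "\<nu> * \<mu> / v \<le> C" using C(1) by (simp add: ennreal_le_iff)
    then have "\<nu> * \<mu> \<le> C * v" using v by (simp add: field_simps)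
    then have "(2 * \<nu>) * (2 * \<mu>) \<le> (4 * C + 1) * measure lebesgue Q" using v by (simp add: algebra_simps)
    moreover have "pmass Q (1 / (2 * \<nu>)) \<le> 1"
      using Lp_norm_less[of "indicator Q" "2 * \<nu>"] \<nu> modular_indicator[of "2 * \<nu>" Q] by (simp add: ennreal_less_iff)
    moreover have "q.pmass Q (1 / (2 * \<mu>)) \<le> 1"
      using q.Lp_norm_less[of "indicator Q" "2 * \<mu>"] \<mu> q.modular_indicator[of "2 * \<mu>" Q] by (simp add: ennreal_less_iff)
    ultimately show "\<exists>s>0. \<exists>t>0. pmass Q (1 / s) \<le> 1 \<and> q.pmass Q (1 / t) \<le> 1 \<and> s * t \<le> (4 * C + 1) * measure lebesgue Q"
      using \<nu>(1) \<mu>(1) by (intro exI[of _ "2 * \<nu>"] conjI exI[of _ "2 * \<mu>"]) auto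
  qed
  then show ?thesis by blast
qed

lemma A_pair_conj:
  assumes "A_pair C" shows "exponent.A_pair q C"
proof -
  interpret q: exponent q "b / (b - 1)" "a / (a - 1)" by (rule exponent_conj)
  show ?thesis
    using assms unfolding A_pair_def q.A_pair_def conj_conj by (metis mult.commute)
qed

lemma Young_weak:
  assumes "0 < x" "0 < y" shows "x * y \<le> x powr p z + y powr q z"
proof (cases "y \<le> x powr (p z - 1)")
  case True
  then have "x * y \<le> x * x powr (p z - 1)" using assms by (intro mult_left_mono) auto
  also have "\<dots> = x powr p z" using assms by (simp add: powr_diff)
  finally show ?thesis by (simp add: add_increasing2)
next
  case False
  have "x = (x powr (p z - 1)) powr (q z - 1)"
    using assms p_gt1[of z] by (simp add: powr_powr conj_minus_one)
  also have "\<dots> \<le> y powr (q z - 1)"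
    using False p_gt1[of z] by (intro powr_mono2) (auto simp: conj_minus_one)
  finally have "x * y \<le> y powr (q z - 1) * y" using assms by (intro mult_right_mono) auto
  also have "\<dots> = y powr q z" using assms by (simp add: powr_diff)
  finally show ?thesis by (simp add: add_increasing)
qed

text \<open>Young's inequality on \<open>E\<close> bounds \<open>\<alpha> / t\<close> times the
  volume of \<open>E\<close> by the two modulars, together at most \<open>B + 1\<close>; hence
  \<open>l * \<alpha> * v \<le> 2 * B * t\<close>. The relation \<open>s * t \<le> C * v\<close>
  then trades \<open>t\<close> for \<open>1 / s\<close>, a level at which the modular over
  \<open>Q\<close> is at most \<open>1\<close>.\<close>

lemma A_pair_subset:
  assumes C: "A_pair C" and Q: "cube Q" and E [measurable]: "E \<in> sets lebesgue" and EQ: "E \<subseteq> Q"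
    and \<alpha>: "0 < \<alpha>" and B: "1 \<le> B" "pmass E \<alpha> \<le> ennreal B"
    and l: "0 \<le> l" "ennreal l * emeasure lebesgue Q \<le> emeasure lebesgue E"
  shows "pmass Q (l * \<alpha> / (2 * B * C)) \<le> 1"
proof -
  interpret q: exponent q "b / (b - 1)" "a / (a - 1)" by (rule exponent_conj)
  have C1: "1 \<le> C" using C by (simp add: A_pair_def)
  obtain v where v: "emeasure lebesgue Q = ennreal v" "v > 0" "measure lebesgue Q = v" using cube_emeasure[OF Q] by blast
  obtain s t where st: "0 < s" "0 < t" "pmass Q (1 / s) \<le> 1" "q.pmass Q (1 / t) \<le> 1" "s * t \<le> C * v"
    using C Q v(3) unfolding A_pair_def by blast
  have "ennreal (\<alpha> * (1 / t)) * (ennreal l * ennreal v) \<le> ennreal (\<alpha> * (1 / t)) * emeasure lebesgue E"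
    using l v by (intro mult_left_mono) auto
  also have "\<dots> = (\<integral>\<^sup>+x. ennreal (\<alpha> * (1 / t)) * indicator E x \<partial>lebesgue)"
    by (subst nn_integral_cmult_indicator) auto
  also have "\<dots> \<le> (\<integral>\<^sup>+x. (ennreal (\<alpha> powr p x) * indicator E x + ennreal ((1 / t) powr q x) * indicator E x) \<partial>lebesgue)"
    using Young_weak[OF \<alpha>, of "1 / t"] st(2)
    by (intro nn_integral_mono) (auto simp: indicator_def ennreal_plus[symmetric] intro!: ennreal_leI simp del: ennreal_plus)
  also have "\<dots> = pmass E \<alpha> + q.pmass E (1 / t)"
    unfolding pmass_def q.pmass_def by (rule nn_integral_add) auto
  also have "\<dots> \<le> ennreal B + 1"
    using B(2) st(4) q.pmass_mono[OF _ order_refl EQ, of "1 / t"] st(2) by (intro add_mono) (auto intro: order_trans)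
  also have "\<dots> \<le> ennreal (2 * B)" using B(1) by (simp add: ennreal_plus[symmetric] ennreal_leI del: ennreal_plus flip: ennreal_1)
  finally have "ennreal (\<alpha> * (1 / t)) * ennreal (l * v) \<le> ennreal (2 * B)"
    using l(1) v(2) ennreal_mult[of l v] by simp
  moreover have "ennreal (\<alpha> * (1 / t)) * ennreal (l * v) = ennreal (\<alpha> * (1 / t) * (l * v))"
    using \<alpha> st(2) l(1) v(2) by (intro ennreal_mult[symmetric]) auto
  ultimately have "ennreal (\<alpha> * (1 / t) * (l * v)) \<le> ennreal (2 * B)" by simp
  then have "\<alpha> * (1 / t) * (l * v) \<le> 2 * B" using B(1) by (simp add: ennreal_le_iff)
  then have 1: "l * \<alpha> * v \<le> 2 * B * t" using st(2) by (simp add: field_simps)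
  have "l * \<alpha> / (2 * B * C) \<le> 1 / s"
  proof -
    have "l * \<alpha> * v * s \<le> 2 * B * t * s" using 1 st(1) by (intro mult_right_mono) auto
    also have "\<dots> \<le> 2 * B * (C * v)" using mult_left_mono[OF st(5), of "2 * B"] B(1) by (simp add: mult_ac)
    finally have "(l * \<alpha> * s) * v \<le> (2 * B * C) * v" by (simp add: mult_ac)
    then have "l * \<alpha> * s \<le> 2 * B * C" using v(2) by simp
    then show ?thesis using st(1) B(1) C1 by (simp add: field_simps)
  qed
  then have "pmass Q (l * \<alpha> / (2 * B * C)) \<le> pmass Q (1 / s)"
    using l(1) \<alpha> B C1 by (intro pmass_mono) auto
  then show ?thesis using st(3) by simp
qed

text \<open>At the highest admissible level \<open>\<beta>\<close> the estimate is \<open>A_pair_subset\<close>; it descends to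
  \<open>\<alpha> \<le> \<beta>\<close> because \<open>\<alpha>\<^sup>p\<^sup>-\<^sup>m\<close> increases with \<open>\<alpha>\<close> where \<open>p > m\<close> and is at most \<open>1\<close> elsewhere.\<close>
lemma pmass_le_median:
  assumes C: "A_pair C" and Q: "cube Q" and B: "1 \<le> B" and \<alpha>: "1 \<le> \<alpha>" and m: "1 \<le> m"
    and med: "ennreal (1/2) * emeasure lebesgue Q \<le> emeasure lebesgue {x\<in>Q. p x \<le> m}"
    and le: "measure lebesgue Q * \<alpha> powr m \<le> B"
  shows "pmass Q \<alpha> \<le> ennreal ((1 + (4 * B * C) powr b) * \<alpha> powr m) * emeasure lebesgue Q"
proof -
  have C1: "1 \<le> C" using C by (simp add: A_pair_def)
  obtain v where v: "emeasure lebesgue Q = ennreal v" "v > 0" "measure lebesgue Q = v" using cube_emeasure[OF Q] by blast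
  have Qs [measurable]: "Q \<in> sets lebesgue" using Q by (rule cube_lebesgue)
  \<comment> \<open>The solution of \<open>v * \<beta> powr m = B\<close>, the highest level that
    the hypothesis \<open>le\<close> admits.\<close>
  define \<beta> where "\<beta> = (B / v) powr (1 / m)"
  have \<beta>m: "\<beta> powr m = B / v" using m v B by (simp add: \<beta>_def powr_powr)
  have "\<alpha> powr m \<le> B / v" using le v by (simp add: field_simps)
  then have "(\<alpha> powr m) powr (1 / m) \<le> \<beta>" unfolding \<beta>_def using m by (intro powr_mono2) auto
  then have \<alpha>\<beta>: "\<alpha> \<le> \<beta>" using m \<alpha> by (simp add: powr_powr)
  then have \<beta>1: "1 \<le> \<beta>" using \<alpha> by simp
  define E where "E = {x\<in>Q. p x \<le> m}"
  have Es [measurable]: "E \<in> sets lebesgue" unfolding E_def by measurable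
  have "pmass E \<beta> \<le> ennreal (\<beta> powr m) * emeasure lebesgue E"
    using \<beta>1 by (intro pmass_le_const) (auto simp: E_def intro: powr_mono)
  also have "\<dots> \<le> ennreal (\<beta> powr m) * ennreal v"
    unfolding v(1)[symmetric] by (intro mult_left_mono emeasure_mono) (auto simp: E_def)
  also have "\<dots> = ennreal B" unfolding \<beta>m using v B by (simp add: ennreal_mult[symmetric])
  finally have "pmass E \<beta> \<le> ennreal B" .
  then have 1: "pmass Q (1/2 * \<beta> / (2 * B * C)) \<le> 1"
    using \<beta>1 B med by (intro A_pair_subset[OF C Q Es]) (auto simp: E_def)
  have "pmass Q \<beta> = pmass Q ((4 * B * C) * (1/2 * \<beta> / (2 * B * C)))" using B C1 by simp
  also have "\<dots> \<le> ennreal ((4 * B * C) powr b) * pmass Q (1/2 * \<beta> / (2 * B * C))"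
  proof (rule pmass_scale_up)
    show "1 \<le> 4 * B * C" using B C1 mult_mono[of 1 B 1 C] by simp
  qed (use \<beta>1 B C1 in auto)
  also have "\<dots> \<le> ennreal ((4 * B * C) powr b) * 1" using 1 by (intro mult_left_mono) auto
  finally have \<beta>le: "pmass Q \<beta> \<le> ennreal ((4 * B * C) powr b)" by simp
  define w where "w = \<alpha> powr m * (v / B)"
  have w: "0 \<le> w" using v B by (simp add: w_def)
  have pt: "\<alpha> powr p x \<le> \<alpha> powr m + w * \<beta> powr p x" for x
  proof (cases "p x \<le> m")
    case True
    then have "\<alpha> powr p x \<le> \<alpha> powr m" using \<alpha> by (intro powr_mono) auto
    then show ?thesis using w by (simp add: add_increasing2)
  next
    case False
    have "\<alpha> powr p x = \<alpha> powr m * \<alpha> powr (p x - m)" using \<alpha> by (simp add: powr_add[symmetric])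
    also have "\<dots> \<le> \<alpha> powr m * \<beta> powr (p x - m)" using False \<alpha> \<alpha>\<beta> by (intro mult_left_mono powr_mono2) auto
    also have "\<beta> powr (p x - m) = (v / B) * \<beta> powr p x" using \<beta>1 v B by (simp add: powr_diff \<beta>m)
    finally show ?thesis by (simp add: add_increasing w_def mult.assoc)
  qed
  have "pmass Q \<alpha> \<le> (\<integral>\<^sup>+x. (ennreal (\<alpha> powr m) * indicator Q x + ennreal w * (ennreal (\<beta> powr p x) * indicator Q x)) \<partial>lebesgue)"
    unfolding pmass_def
  proof (rule nn_integral_mono)
    fix x
    have "ennreal (\<alpha> powr p x) \<le> ennreal (\<alpha> powr m) + ennreal w * ennreal (\<beta> powr p x)"
      using pt[of x] w by (simp add: ennreal_plus[symmetric] ennreal_mult[symmetric] ennreal_leI del: ennreal_plus)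
    then show "ennreal (\<alpha> powr p x) * indicator Q x \<le> ennreal (\<alpha> powr m) * indicator Q x + ennreal w * (ennreal (\<beta> powr p x) * indicator Q x)"
      by (auto simp: indicator_def)
  qed
  also have "\<dots> = ennreal (\<alpha> powr m) * ennreal v + ennreal w * pmass Q \<beta>"
    unfolding pmass_def v(1)[symmetric]
    by (subst nn_integral_add) (auto simp: nn_integral_cmult nn_integral_cmult_indicator)
  also have "\<dots> \<le> ennreal (\<alpha> powr m) * ennreal v + ennreal w * ennreal ((4 * B * C) powr b)"
    using \<beta>le by (intro add_left_mono mult_left_mono) auto
  also have "\<dots> = ennreal (\<alpha> powr m * v + w * (4 * B * C) powr b)"
    using v B w by (simp add: ennreal_plus[symmetric] ennreal_mult[symmetric] del: ennreal_plus)
  also have "\<dots> \<le> ennreal ((1 + (4 * B * C) powr b) * \<alpha> powr m * v)"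
    unfolding w_def
  proof (rule ennreal_leI)
    have "\<alpha> powr m * (v / B) * (4 * B * C) powr b \<le> \<alpha> powr m * v * (4 * B * C) powr b"
      using v B by (intro mult_right_mono mult_left_mono) (auto simp: field_simps mult_le_cancel_left1)
    then show "\<alpha> powr m * v + \<alpha> powr m * (v / B) * (4 * B * C) powr b \<le> (1 + (4 * B * C) powr b) * \<alpha> powr m * v"
      by (simp add: algebra_simps)
  qed
  also have "\<dots> = ennreal ((1 + (4 * B * C) powr b) * \<alpha> powr m) * emeasure lebesgue Q"
    unfolding v(1) using v by (intro ennreal_mult) auto
  finally show ?thesis .
qed

text \<open>Every subcube \<open>V\<close> is judged by its own median \<open>m\<close>. On half of
  \<open>V\<close> one has \<open>p \<ge> m\<close>, so the weight is at least
  \<open>\<kappa> powr m\<close> there. The same half turns the bound \<open>B\<close> on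
  \<open>Q\<close> into \<open>v * \<kappa> powr m \<le> 2 * B\<close>, which lets
  \<open>pmass_le_median\<close> bound the average over \<open>V\<close> by a multiple of
  \<open>\<kappa> powr m\<close>.\<close>

lemma A_infinity_on_power:
  assumes C: "A_pair C" and Q: "Q \<in> grid s" and \<kappa>: "1 \<le> \<kappa>" and B: "1 \<le> B" "pmass Q \<kappa> \<le> ennreal B"
  shows "A_infinity_on (1/2) (1 / (1 + (4 * (2 * B) * C) powr b)) s Q {} (\<lambda>x. \<kappa> powr p x)"
  unfolding A_infinity_on_def
proof (intro conjI ballI impI allI)
  show "Q \<in> grid s" by fact
  show "(\<lambda>x. \<kappa> powr p x) \<in> borel_measurable lebesgue" by measurable
  fix V assume V: "V \<in> grid s" "V \<subseteq> Q"
  define K where "K = 1 + (4 * (2 * B) * C) powr b"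
  have K: "K > 0" by (simp add: K_def add_pos_nonneg)
  have cV: "cube V" using V(1) by (rule cube_grid)
  have Vs [measurable]: "V \<in> sets lebesgue" using V(1) by (rule grid_sets)
  obtain v where v: "emeasure lebesgue V = ennreal v" "v > 0" "measure lebesgue V = v" using cube_emeasure[OF cV] by blast
  obtain m where m: "a \<le> m" "emeasure lebesgue {x\<in>V. m < p x} \<le> ennreal (1/2) * emeasure lebesgue V"
      "ennreal (1/2) * emeasure lebesgue V \<le> emeasure lebesgue {x\<in>V. m \<le> p x}"
    using quantile_p[OF cV, of "1/2"] by auto
  have m1: "1 \<le> m" using m(1) a1 by simp
  have lower: "ennreal (1 - 1/2) * emeasure lebesgue V \<le> emeasure lebesgue {x\<in>V. p x \<le> m}"
    using m(2) by (intro emeasure_le_quantile[OF cV]) auto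
  have "ennreal (\<kappa> powr m) * (ennreal (1/2) * ennreal v) \<le> ennreal (\<kappa> powr m) * emeasure lebesgue {x\<in>V. m \<le> p x}"
    using m(3) v by (intro mult_left_mono) auto
  also have "\<dots> \<le> pmass Q \<kappa>"
    using \<kappa> V(2) by (intro pmass_subset_const_ge) (auto intro: powr_mono)
  also have "\<dots> \<le> ennreal B" by fact
  finally have "ennreal (\<kappa> powr m) * ennreal (1/2 * v) \<le> ennreal B" using v ennreal_mult[of "1/2" v] by simp
  then have "ennreal (\<kappa> powr m * (1/2 * v)) \<le> ennreal B" using v by (subst ennreal_mult) auto
  then have "v * \<kappa> powr m \<le> 2 * B" using B by (simp add: ennreal_le_iff field_simps)
  then have "pmass V \<kappa> \<le> ennreal (K * \<kappa> powr m) * emeasure lebesgue V"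
    unfolding K_def using B \<kappa> m1 lower v(3) by (intro pmass_le_median[OF C cV]) auto
  moreover have "ennreal (1/2) * emeasure lebesgue V \<le> emeasure lebesgue {x\<in>V. 1 / K * (K * \<kappa> powr m) \<le> \<kappa> powr p x}"
  proof -
    have e: "1 / K * (K * \<kappa> powr m) = \<kappa> powr m" using K by simp
    have "{x\<in>V. m \<le> p x} \<subseteq> {x\<in>V. \<kappa> powr m \<le> \<kappa> powr p x}" using \<kappa> by (auto intro: powr_mono)
    then have "emeasure lebesgue {x\<in>V. m \<le> p x} \<le> emeasure lebesgue {x\<in>V. \<kappa> powr m \<le> \<kappa> powr p x}"
      by (rule emeasure_mono) measurable
    then show ?thesis unfolding e using m(3) by (rule order_trans[rotated])
  qed
  ultimately show "\<exists>c\<ge>0. (\<integral>\<^sup>+ x\<in>V. ennreal (\<kappa> powr p x)\<partial>lebesgue) \<le> ennreal c * emeasure lebesgue V \<and>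
      ennreal (1/2) * emeasure lebesgue V \<le> emeasure lebesgue {x \<in> V. 1 / (1 + (4 * (2 * B) * C) powr b) * c \<le> \<kappa> powr p x}"
    unfolding K_def[symmetric] pmass_def using K by (intro exI[of _ "K * \<kappa> powr m"] conjI) simp_all
qed auto


text \<open>With \<open>m\<close> the median of \<open>p\<close> on \<open>Q\<close>, \<open>t = l\<alpha>\<close> and \<open>\<kappa> = t\<^sup>m\<^sup>-\<^sup>1\<close>, the reverse Hoelder inequality for
  \<open>\<kappa>\<^sup>q\<close> shows that \<open>\<kappa>\<^bsup>1/(p-1)\<^esup>\<close> is much smaller than \<open>\<alpha>\<close> on half of \<open>E\<close>, whence the gain \<open>l\<^sup>\<eta>\<close>.\<close>
lemma A_condition_imp_large_levels:
  assumes A: "A_condition p"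
  shows "\<exists>C>0. \<exists>\<eta>>0. \<forall>(s :: 'n \<Rightarrow> bool) Q E \<alpha> l. Q \<in> grid s \<longrightarrow> E \<in> sets lebesgue \<longrightarrow> E \<subseteq> Q \<longrightarrow>
    emeasure lebesgue E = ennreal l * emeasure lebesgue Q \<longrightarrow> 0 < l \<longrightarrow> 0 < \<alpha> \<longrightarrow> 1 \<le> l * \<alpha> \<longrightarrow> pmass E \<alpha> \<le> 1 \<longrightarrow>
    pmass Q (l * \<alpha>) \<le> ennreal (C * l powr \<eta>) * pmass E \<alpha>"
proof -
  interpret q: exponent q "b / (b - 1)" "a / (a - 1)" by (rule exponent_conj)
  define b' where "b' = a / (a - 1)"
  obtain C0 where C0: "A_pair C0" using A_condition_imp_A_pair[OF A] by blast
  have C1: "1 \<le> C0" using C0 by (simp add: A_pair_def)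
  have C0q: "q.A_pair C0" using C0 by (rule A_pair_conj)
  \<comment> \<open>Twice the bound for \<open>pmass Q t\<close> that follows from
    \<open>A_pair_subset\<close>: half of \<open>Q\<close> has \<open>p \<ge> m\<close>, which turns
    that bound into \<open>v * t powr m \<le> B\<close>.\<close>
  define B where "B = 2 * (2 * C0) powr b"
  have "1 \<le> (2 * C0) powr b" using C1 b1 by (intro ge_one_powr_ge_zero) auto
  then have B: "2 \<le> B" "1 \<le> B" by (auto simp: B_def)
  define K where "K = 1 + (4 * B * C0) powr b"
  define K' where "K' = 1 + (4 * B * C0) powr b'"
  have K: "1 \<le> K" "1 \<le> K'" by (auto simp: K_def K'_def)
  define B' where "B' = K' * B"
  have B': "1 \<le> B'" using K B mult_mono[of 1 K' 1 B] by (simp add: B'_def)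
  define K'' where "K'' = 1 + (4 * (2 * B') * C0) powr b'"
  have \<delta>: "0 < 1 / K''" "1 / K'' \<le> 1" by (auto simp: K''_def add_pos_nonneg divide_le_eq_1)
  have half: "(0::real) < 1/2" "(1/2::real) \<le> 1" by auto
  obtain \<epsilon> D where \<epsilon>: "0 < \<epsilon>" and D: "0 < D" and RH:
    "\<forall>(s :: 'n \<Rightarrow> bool) Q U u T e. A_infinity_on (1/2) (1 / K'') s Q U u \<longrightarrow>
      0 < T \<longrightarrow> (\<integral>\<^sup>+x\<in>Q. ennreal (u x) \<partial>lebesgue) = ennreal T * emeasure lebesgue Q \<longrightarrow>
      0 < e \<longrightarrow> e \<le> \<epsilon> \<longrightarrow>
      (\<integral>\<^sup>+x\<in>Q - U. ennreal (u x powr (1 + e)) \<partial>lebesgue) \<le> ennreal (D * T powr (1 + e)) * emeasure lebesgue Q"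
    using reverse_Hoelder[OF half \<delta>, where 'n = 'n] by auto
  define D' where "D' = D * K' powr (1 + \<epsilon>)"
  have D': "0 < D'" using D K by (simp add: D'_def)
  define D2 where "D2 = 1 + 2 * D'"
  have D2: "1 \<le> D2" using D' by (simp add: D2_def)
  \<comment> \<open>Reverse Hoelder yields a factor
    \<open>l powr (\<epsilon> / (1 + \<epsilon>))\<close>, which will be raised to the power
    \<open>p x - 1 \<ge> a - 1\<close>.\<close>
  define \<eta> where "\<eta> = \<epsilon> / (1 + \<epsilon>) * (a - 1)"
  have \<eta>: "0 < \<eta>" using \<epsilon> a1 by (simp add: \<eta>_def)
  have main: "pmass Q (l * \<alpha>) \<le> ennreal (2 * K * D2 powr b * l powr \<eta>) * pmass E \<alpha>"
    if Q: "Q \<in> grid s" and E [measurable]: "E \<in> sets lebesgue" and EQ: "E \<subseteq> Q"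
      and El: "emeasure lebesgue E = ennreal l * emeasure lebesgue Q" and l: "0 < l" and \<alpha>: "0 < \<alpha>"
      and l\<alpha>: "1 \<le> l * \<alpha>" and le1: "pmass E \<alpha> \<le> 1"
    for s :: "'n \<Rightarrow> bool" and Q E \<alpha> l
  proof -
    have cQ: "cube Q" using Q by (rule cube_grid)
    have Qs [measurable]: "Q \<in> sets lebesgue" using Q by (rule grid_sets)
    obtain v where v: "emeasure lebesgue Q = ennreal v" "v > 0" "measure lebesgue Q = v" using cube_emeasure[OF cQ] by blast
    have l1: "l \<le> 1"
    proof -
      have "ennreal l * ennreal v \<le> ennreal v" using emeasure_mono[OF EQ, of lebesgue] El v(1) by simp
      then have "l * v \<le> v" using l v(2) by (simp add: ennreal_mult[symmetric])
      then show ?thesis using v(2) by simp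
    qed
    define t where "t = l * \<alpha>"
    have t: "1 \<le> t" using l\<alpha> by (simp add: t_def)
    have "pmass Q (l * \<alpha> / (2 * 1 * C0)) \<le> 1"
      using le1 El l \<alpha> by (intro A_pair_subset[OF C0 cQ E EQ \<alpha>]) auto
    then have p1: "pmass Q (t / (2 * C0)) \<le> 1" by (simp add: t_def)
    have "pmass Q t = pmass Q ((2 * C0) * (t / (2 * C0)))" using C1 by simp
    also have "\<dots> \<le> ennreal ((2 * C0) powr b) * pmass Q (t / (2 * C0))"
      using C1 t by (intro pmass_scale_up) auto
    also have "\<dots> \<le> ennreal ((2 * C0) powr b) * 1" using p1 by (intro mult_left_mono) auto
    finally have pt: "pmass Q t \<le> ennreal ((2 * C0) powr b)" by simp
    obtain m where m: "a \<le> m" "emeasure lebesgue {x\<in>Q. m < p x} \<le> ennreal (1/2) * emeasure lebesgue Q"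
        "ennreal (1/2) * emeasure lebesgue Q \<le> emeasure lebesgue {x\<in>Q. m \<le> p x}"
      using quantile_p[OF cQ, of "1/2"] by auto
    have m1: "1 < m" using m(1) a1 by simp
    have lower: "ennreal (1 - 1/2) * emeasure lebesgue Q \<le> emeasure lebesgue {x\<in>Q. p x \<le> m}"
      using m(2) by (intro emeasure_le_quantile[OF cQ]) auto
    have "ennreal (t powr m) * (ennreal (1/2) * ennreal v) \<le> ennreal (t powr m) * emeasure lebesgue {x\<in>Q. m \<le> p x}"
      using m(3) v by (intro mult_left_mono) auto
    also have "\<dots> \<le> pmass Q t"
      using t by (intro pmass_subset_const_ge) (auto intro: powr_mono)
    finally have "ennreal (t powr m) * (ennreal (1/2) * ennreal v) \<le> ennreal ((2 * C0) powr b)" using pt by (rule order_trans)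
    then have "ennreal (t powr m) * ennreal (1/2 * v) \<le> ennreal ((2 * C0) powr b)" using v ennreal_mult[of "1/2" v] by simp
    then have "ennreal (t powr m * (1/2 * v)) \<le> ennreal ((2 * C0) powr b)" using v by (subst ennreal_mult) auto
    then have vt: "v * t powr m \<le> B" by (simp add: B_def ennreal_le_iff mult_ac)
    then have Gp: "pmass Q t \<le> ennreal (K * t powr m) * emeasure lebesgue Q"
      unfolding K_def using B t m1 lower v(3) by (intro pmass_le_median[OF C0 cQ]) auto
    define \<kappa> where "\<kappa> = t powr (m - 1)"
    have \<kappa>: "1 \<le> \<kappa>" unfolding \<kappa>_def using t m1 by (intro ge_one_powr_ge_zero) auto
    \<comment> \<open>The conjugate of \<open>m\<close>: \<open>p x \<ge> m\<close> forces
      \<open>q x \<le> m'\<close>, and \<open>\<kappa> powr m' = t powr m\<close>, so admissibility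
      of \<open>t\<close> for \<open>p\<close> is admissibility of \<open>\<kappa>\<close> for
      \<open>q\<close>.\<close>
    define m' where "m' = m / (m - 1)"
    have m'1: "1 \<le> m'" using m1 by (simp add: m'_def)
    have \<kappa>m: "\<kappa> powr m' = t powr m" using m1 by (simp add: \<kappa>_def m'_def powr_powr)
    have medq: "ennreal (1/2) * emeasure lebesgue Q \<le> emeasure lebesgue {x\<in>Q. q x \<le> m'}"
    proof -
      have "q x \<le> m'" if "m \<le> p x" for x
      proof -
        have "q x = 1 + 1 / (p x - 1)" "m' = 1 + 1 / (m - 1)"
          using m1 p_gt1[of x] by (auto simp: m'_def conj_exponent_def field_simps)
        moreover have "1 / (p x - 1) \<le> 1 / (m - 1)" using that m1 by (intro divide_left_mono) auto
        ultimately show ?thesis by simp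
      qed
      then have "{x\<in>Q. m \<le> p x} \<subseteq> {x\<in>Q. q x \<le> m'}" by auto
      then have "emeasure lebesgue {x\<in>Q. m \<le> p x} \<le> emeasure lebesgue {x\<in>Q. q x \<le> m'}"
        by (rule emeasure_mono) (simp add: measurable_subset_level)
      then show ?thesis using m(3) by (rule order_trans[rotated])
    qed
    have Gq: "q.pmass Q \<kappa> \<le> ennreal (K' * t powr m) * emeasure lebesgue Q"
      using q.pmass_le_median[OF C0q cQ B(2) \<kappa> m'1 medq] vt unfolding \<kappa>m v(3) K'_def b'_def by simp
    have "K' * t powr m * v \<le> B'"
    proof -
      have "K' * (v * t powr m) \<le> K' * B" using vt K by (intro mult_left_mono) auto
      then show ?thesis by (simp add: B'_def mult_ac)
    qed
    then have "ennreal (K' * t powr m) * emeasure lebesgue Q \<le> ennreal B'"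
      unfolding v(1) using K v(2) by (simp add: ennreal_mult[symmetric] ennreal_leI)
    then have qB': "q.pmass Q \<kappa> \<le> ennreal B'" using Gq by (rule order_trans[rotated])
    have Ainf: "A_infinity_on (1/2) (1 / K'') s Q {} (\<lambda>x. \<kappa> powr q x)"
      unfolding K''_def b'_def using q.A_infinity_on_power[OF C0q Q \<kappa> B' qB'] .
    obtain w where w: "q.pmass Q \<kappa> = ennreal w" "0 \<le> w" using qB' by (cases "q.pmass Q \<kappa>") (auto simp: top_unique)
    have "ennreal 1 * ennreal v \<le> q.pmass Q \<kappa>"
      unfolding v(1)[symmetric]
      by (rule q.pmass_subset_const_ge[OF Qs]) (use \<kappa> q.p_pos in \<open>auto intro!: ge_one_powr_ge_zero\<close>)
    then have wv: "v \<le> w" using w by simp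
    define T where "T = w / v"
    have T0: "0 < T" using wv v(2) by (simp add: T_def)
    have T: "(\<integral>\<^sup>+x\<in>Q. ennreal (\<kappa> powr q x) \<partial>lebesgue) = ennreal T * emeasure lebesgue Q"
      using w v T0 unfolding q.pmass_def by (simp add: T_def ennreal_mult[symmetric])
    have "ennreal (T * v) \<le> ennreal (K' * t powr m * v)"
      using Gq w v K by (simp add: T_def ennreal_mult[symmetric])
    then have TK: "T \<le> K' * t powr m" using v(2) K T0 by (simp add: ennreal_le_iff)
    have "(\<integral>\<^sup>+x\<in>Q. ennreal ((\<kappa> powr q x) powr (1 + \<epsilon>)) \<partial>lebesgue) \<le> ennreal (D * T powr (1 + \<epsilon>)) * emeasure lebesgue Q"
      using RH[rule_format, OF Ainf T0 T \<epsilon> order_refl] by simp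
    also have "\<dots> \<le> ennreal (D' * (t powr m) powr (1 + \<epsilon>)) * emeasure lebesgue Q"
    proof (intro mult_right_mono ennreal_leI)
      have "D * T powr (1 + \<epsilon>) \<le> D * (K' * t powr m) powr (1 + \<epsilon>)"
        using TK T0 D \<epsilon> by (intro mult_left_mono powr_mono2) auto
      also have "\<dots> = D' * (t powr m) powr (1 + \<epsilon>)" using K by (simp add: D'_def powr_mult)
      finally show "D * T powr (1 + \<epsilon>) \<le> D' * (t powr m) powr (1 + \<epsilon>)" .
    qed simp
    finally have RH': "(\<integral>\<^sup>+x\<in>Q. ennreal ((\<kappa> powr q x) powr (1 + \<epsilon>)) \<partial>lebesgue) \<le> ennreal (D' * (t powr m) powr (1 + \<epsilon>)) * emeasure lebesgue Q" .
    \<comment> \<open>Chosen so that Chebyshev's inequality for the power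
      \<open>1 + \<epsilon>\<close> leaves \<open>S\<close> at most half the measure of
      \<open>E\<close>.\<close>
    define \<sigma> where "\<sigma> = (2 * D' / l) powr (1 / (1 + \<epsilon>))"
    have \<sigma>: "0 < \<sigma>" using D' l by (simp add: \<sigma>_def)
    have \<sigma>e: "\<sigma> powr (1 + \<epsilon>) = 2 * D' / l" using D' l \<epsilon> by (simp add: \<sigma>_def powr_powr)
    define S where "S = {x\<in>Q. \<sigma> * t powr m < \<kappa> powr q x}"
    have Ss [measurable]: "S \<in> sets lebesgue" unfolding S_def by measurable
    have "ennreal ((\<sigma> * t powr m) powr (1 + \<epsilon>)) * emeasure lebesgue S
        = (\<integral>\<^sup>+x. ennreal ((\<sigma> * t powr m) powr (1 + \<epsilon>)) * indicator S x \<partial>lebesgue)"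
      by (subst nn_integral_cmult_indicator) auto
    also have "\<dots> \<le> (\<integral>\<^sup>+x\<in>Q. ennreal ((\<kappa> powr q x) powr (1 + \<epsilon>)) \<partial>lebesgue)"
      using \<sigma> \<epsilon> by (intro nn_integral_mono) (auto simp: S_def indicator_def intro!: ennreal_leI powr_mono2)
    also note RH'
    finally have S1: "ennreal ((\<sigma> * t powr m) powr (1 + \<epsilon>)) * emeasure lebesgue S \<le> ennreal (D' * (t powr m) powr (1 + \<epsilon>)) * emeasure lebesgue Q" .
    have SQ: "S \<subseteq> Q" by (auto simp: S_def)
    obtain z where z: "emeasure lebesgue S = ennreal z" "0 \<le> z"
      using emeasure_mono[OF SQ, of lebesgue] v(1) by (cases "emeasure lebesgue S") (auto simp: top_unique)
    have "z \<le> l / 2 * v"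
    proof -
      define y where "y = (t powr m) powr (1 + \<epsilon>)"
      have y: "0 < y" using t by (simp add: y_def)
      have "(\<sigma> * t powr m) powr (1 + \<epsilon>) = 2 * D' / l * y" using \<sigma> by (simp add: powr_mult \<sigma>e y_def)
      then have "ennreal (2 * D' / l * y * z) \<le> ennreal (D' * y * v)"
        using S1 z v D' y l unfolding y_def[symmetric] by (simp add: ennreal_mult[symmetric])
      then have "2 * D' / l * y * z \<le> D' * y * v" using D' y v(2) by (simp add: ennreal_le_iff)
      then have "D' * y * (2 * z / l) \<le> D' * y * v" by (simp add: mult_ac)
      moreover have "0 < D' * y" using D' y by simp
      ultimately have "2 * z / l \<le> v" using mult_le_cancel_left_pos by blast
      then show ?thesis using l by (simp add: field_simps)
    qed
    have E0: "ennreal (l / 2 * v) \<le> emeasure lebesgue (E - S)"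
    proof -
      have "emeasure lebesgue E \<le> emeasure lebesgue ((E - S) \<union> S)" by (intro emeasure_mono) auto
      also have "\<dots> \<le> emeasure lebesgue (E - S) + emeasure lebesgue S" by (rule emeasure_subadditive) auto
      finally have *: "ennreal (l * v) \<le> emeasure lebesgue (E - S) + ennreal z" using El v l z by (simp add: ennreal_mult)
      show ?thesis
      proof (cases "emeasure lebesgue (E - S)")
        case (real r)
        then have "l * v \<le> r + z" using * z(2) by (simp add: ennreal_plus[symmetric] del: ennreal_plus)
        then have "l / 2 * v \<le> r" using \<open>z \<le> l / 2 * v\<close> by (simp add: field_simps)
        then show ?thesis using real by (simp add: ennreal_leI)
      qed auto
    qed
    define c where "c = \<alpha> * \<kappa> * (D2 powr (- b) * l powr (- \<eta>))"
    have c: "0 \<le> c" using \<alpha> \<kappa> by (simp add: c_def)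
    \<comment> \<open>Off \<open>S\<close>,
      \<open>\<kappa> powr q x \<le> \<sigma> * \<kappa> * t\<close>, which means
      \<open>\<kappa> powr (1 / (p x - 1)) \<le> \<sigma> * t\<close>, and
      \<open>\<sigma> * t\<close> is at most a multiple of
      \<open>l powr (\<epsilon> / (1 + \<epsilon>)) * \<alpha>\<close>. The power
      \<open>p x - 1\<close> of this bounds \<open>\<kappa>\<close> by a multiple of
      \<open>l powr \<eta> * \<alpha> powr (p x - 1)\<close>.\<close>
    have pw: "c \<le> \<alpha> powr p x" if x: "x \<in> E - S" for x
    proof -
      define P1 where "P1 = p x - 1"
      have P1: "0 < P1" "a - 1 \<le> P1" "P1 \<le> b" using p_gt1[of x] p_ge[of x] p_le[of x] by (auto simp: P1_def)
      have "\<kappa> powr q x \<le> \<sigma> * t powr m" using x EQ by (auto simp: S_def not_less)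
      also have "t powr m = \<kappa> * t" using t by (simp add: \<kappa>_def powr_diff)
      finally have "\<kappa> powr (q x - 1) * \<kappa> \<le> \<sigma> * t * \<kappa>" using \<kappa> by (simp add: powr_diff mult_ac)
      then have "\<kappa> powr (1 / P1) \<le> \<sigma> * t" using \<kappa> by (simp add: conj_minus_one P1_def)
      then have "(\<kappa> powr (1 / P1)) powr P1 \<le> (\<sigma> * t) powr P1" using P1 by (intro powr_mono2) auto
      then have k1: "\<kappa> \<le> (\<sigma> * t) powr P1" using \<kappa> P1 by (simp add: powr_powr)
      have "\<sigma> * t \<le> D2 * l powr (\<epsilon> / (1 + \<epsilon>)) * \<alpha>"
      proof -
        have "(2 * D') powr (1 / (1 + \<epsilon>)) \<le> D2 powr (1 / (1 + \<epsilon>))"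
          using D' \<epsilon> by (intro powr_mono2) (auto simp: D2_def)
        also have "\<dots> \<le> D2 powr 1" using D2 \<epsilon> by (intro powr_mono) auto
        finally have d: "(2 * D') powr (1 / (1 + \<epsilon>)) \<le> D2" using D2 by simp
        have "\<epsilon> / (1 + \<epsilon>) = 1 - 1 / (1 + \<epsilon>)" using \<epsilon> by (simp add: field_simps)
        then have "l powr (\<epsilon> / (1 + \<epsilon>)) = l / l powr (1 / (1 + \<epsilon>))" using l by (simp add: powr_diff)
        then have "\<sigma> * t = (2 * D') powr (1 / (1 + \<epsilon>)) * l powr (\<epsilon> / (1 + \<epsilon>)) * \<alpha>"
          using D' l by (simp add: \<sigma>_def t_def powr_divide)
        then show ?thesis using d \<alpha> by (simp add: mult_right_mono)
      qed
      then have "(\<sigma> * t) powr P1 \<le> (D2 * l powr (\<epsilon> / (1 + \<epsilon>)) * \<alpha>) powr P1"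
        using \<sigma> t P1 by (intro powr_mono2) auto
      also have "\<dots> = D2 powr P1 * (l powr (\<epsilon> / (1 + \<epsilon>))) powr P1 * \<alpha> powr P1"
        using D2 l \<alpha> by (simp add: powr_mult)
      also have "\<dots> \<le> D2 powr b * l powr \<eta> * \<alpha> powr P1"
      proof (intro mult_right_mono mult_mono)
        show "D2 powr P1 \<le> D2 powr b" using D2 P1 by (intro powr_mono) auto
        have "\<eta> \<le> \<epsilon> / (1 + \<epsilon>) * P1" unfolding \<eta>_def using P1 \<epsilon> by (intro mult_left_mono) auto
        then show "(l powr (\<epsilon> / (1 + \<epsilon>))) powr P1 \<le> l powr \<eta>"
          unfolding powr_powr using l l1 by (intro powr_mono') auto
      qed auto
      finally have "\<kappa> \<le> D2 powr b * l powr \<eta> * \<alpha> powr P1" using k1 by simp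
      then have "\<alpha> * \<kappa> * (D2 powr (- b) * l powr (- \<eta>)) \<le> \<alpha> * (D2 powr b * l powr \<eta> * \<alpha> powr P1) * (D2 powr (- b) * l powr (- \<eta>))"
        using \<alpha> by (intro mult_right_mono mult_left_mono) auto
      also have "\<dots> = \<alpha> * \<alpha> powr P1" using D2 l by (simp add: powr_minus field_simps)
      also have "\<dots> = \<alpha> powr p x" using \<alpha> by (simp add: P1_def powr_diff)
      finally show ?thesis by (simp add: c_def)
    qed
    have "ennreal c * ennreal (l / 2 * v) \<le> ennreal c * emeasure lebesgue (E - S)" using E0 by (rule mult_left_mono) simp
    also have "\<dots> \<le> pmass E \<alpha>" using pw c by (intro pmass_subset_const_ge) auto
    finally have fin: "ennreal (c * (l / 2 * v)) \<le> pmass E \<alpha>" using c l v(2) by (subst ennreal_mult) auto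
    \<comment> \<open>The constants close because
      \<open>t powr m = t * \<kappa> = l * \<alpha> * \<kappa>\<close>: its factor \<open>l\<close>
      is the proportion of \<open>E\<close> in \<open>Q\<close>.\<close>
    have "pmass Q (l * \<alpha>) \<le> ennreal (K * t powr m) * ennreal v" using Gp v(1) by (simp add: t_def)
    also have "\<dots> = ennreal (2 * K * D2 powr b * l powr \<eta>) * ennreal (c * (l / 2 * v))"
    proof -
      have "2 * K * D2 powr b * l powr \<eta> * (c * (l / 2 * v)) = K * (l * \<alpha> * \<kappa>) * v"
        using D2 l by (simp add: c_def powr_minus field_simps)
      also have "l * \<alpha> * \<kappa> = t powr m" using t by (simp add: t_def[symmetric] \<kappa>_def powr_diff)
      finally show ?thesis using K c l v(2) by (simp add: ennreal_mult[symmetric])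
    qed
    also have "\<dots> \<le> ennreal (2 * K * D2 powr b * l powr \<eta>) * pmass E \<alpha>" using fin by (rule mult_left_mono) simp
    finally show ?thesis .
  qed
  have "0 < 2 * K * D2 powr b" using K D2 by simp
  then show ?thesis
    by (rule exI[of _ "2 * K * D2 powr b", OF conjI], intro exI[of _ \<eta>] conjI allI impI \<eta> main)
qed

end

subsection \<open>Small levels\<close>

context exponent begin

definition S_infty_with :: "real \<Rightarrow> real \<Rightarrow> real \<Rightarrow> bool" where
  "S_infty_with r s0 C \<longleftrightarrow> 1 < r \<and> 0 < s0 \<and> s0 < 1 \<and> 0 < C \<and>
    (\<forall>s F \<alpha> E. 0 < s \<longrightarrow> s < s0 \<longrightarrow> finite F \<longrightarrow> (\<forall>Q\<in>F. cube Q) \<longrightarrow> disjoint F \<longrightarrow>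
      (\<forall>Q\<in>F. 0 < \<alpha> Q \<and> \<alpha> Q < 1) \<longrightarrow>
      (\<forall>Q\<in>F. E Q \<in> sets lebesgue \<and> E Q \<subseteq> Q \<and> measure lebesgue (E Q) = s * measure lebesgue Q) \<longrightarrow>
      (\<Sum>Q\<in>F. pmass (E Q) (\<alpha> Q)) \<le> 1 \<longrightarrow> (\<Sum>Q\<in>F. pmass Q (s powr (1 / r) * \<alpha> Q)) \<le> ennreal C)"

lemma S_infty_conditionD: "S_infty_condition p \<Longrightarrow> \<exists>r s0 C. S_infty_with r s0 C"
  unfolding S_infty_condition_def S_infty_with_def pmass_def .

text \<open>A cube has excess if its mass at level \<open>\<beta>\<close> is not controlled by that of its worst subset
  of proportion \<open>l\<close>, the one where \<open>p\<close> is largest.\<close>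
definition excess :: "real \<Rightarrow> real \<Rightarrow> real \<Rightarrow> real \<Rightarrow> (real ^ 'n) set \<Rightarrow> bool" where
  "excess r C l \<beta> V \<longleftrightarrow> (\<exists>\<tau>. a \<le> \<tau> \<and> \<tau> \<le> b \<and>
     emeasure lebesgue {x\<in>V. \<tau> < p x} \<le> ennreal l * emeasure lebesgue V \<and>
     ennreal l * emeasure lebesgue V \<le> emeasure lebesgue {x\<in>V. \<tau> \<le> p x} \<and>
     ennreal ((2 * C + 1) * (l * \<beta> powr \<tau>)) * emeasure lebesgue V < pmass V (l powr (1 / r) * \<beta>))"

text \<open>The test sets are taken inside \<open>{p \<ge> \<tau> V}\<close>. As
  \<open>\<beta> < 1\<close>, their mass is at most \<open>l * \<beta> powr \<tau> V\<close> times
  the volume of \<open>V\<close>, so the normalisation in the S-infinity condition becomes a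
  numerical hypothesis.\<close>

lemma S_infty_apply:
  assumes S: "S_infty_with r s0 C" and l: "0 < l" "l < s0"
    and F: "finite F" "disjoint F" "\<And>V. V \<in> F \<Longrightarrow> cube V" and \<beta>: "0 < \<beta>" "\<beta> < 1"
    and \<tau>: "\<And>V. V \<in> F \<Longrightarrow> ennreal l * emeasure lebesgue V \<le> emeasure lebesgue {x\<in>V. \<tau> V \<le> p x}"
    and le1: "(\<Sum>V\<in>F. l * \<beta> powr \<tau> V * measure lebesgue V) \<le> 1"
  shows "(\<Sum>V\<in>F. pmass V (l powr (1 / r) * \<beta>)) \<le> ennreal C"
proof -
  have "\<exists>E\<subseteq>{x\<in>V. \<tau> V \<le> p x}. E \<in> sets lebesgue \<and> emeasure lebesgue E = ennreal l * emeasure lebesgue V" if V: "V \<in> F" for V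
  proof (rule subset_of_given_measure[OF _ F(3)[OF V]])
    show "{x\<in>V. \<tau> V \<le> p x} \<in> sets lebesgue"
      using cube_lebesgue(1)[OF F(3)[OF V]] by (simp add: measurable_subset_level)
  qed (use \<tau>[OF V] in auto)
  then have "\<forall>V\<in>F. \<exists>E. E \<subseteq> {x\<in>V. \<tau> V \<le> p x} \<and> E \<in> sets lebesgue \<and> emeasure lebesgue E = ennreal l * emeasure lebesgue V"
    by blast
  from bchoice[OF this] obtain E where "\<forall>V\<in>F. E V \<subseteq> {x\<in>V. \<tau> V \<le> p x} \<and> E V \<in> sets lebesgue \<and>
      emeasure lebesgue (E V) = ennreal l * emeasure lebesgue V" by (rule exE)
  then have E: "\<And>V. V \<in> F \<Longrightarrow> E V \<subseteq> {x\<in>V. \<tau> V \<le> p x}" "\<And>V. V \<in> F \<Longrightarrow> E V \<in> sets lebesgue"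
      "\<And>V. V \<in> F \<Longrightarrow> emeasure lebesgue (E V) = ennreal l * emeasure lebesgue V"
    by simp_all
  have meas: "measure lebesgue (E V) = l * measure lebesgue V" if "V \<in> F" for V
    using E(3)[OF that] l by (simp add: measure_def enn2real_mult)
  have "(\<Sum>V\<in>F. pmass (E V) \<beta>) \<le> (\<Sum>V\<in>F. ennreal (l * \<beta> powr \<tau> V * measure lebesgue V))"
  proof (rule sum_mono)
    fix V assume V: "V \<in> F"
    have "pmass (E V) \<beta> \<le> ennreal (\<beta> powr \<tau> V) * emeasure lebesgue (E V)"
      using E(1,2)[OF V] \<beta> by (intro pmass_le_const) (auto intro!: powr_mono')
    also have "\<dots> = ennreal (l * \<beta> powr \<tau> V * measure lebesgue V)"
      unfolding E(3)[OF V] cube_emeasure(3)[OF F(3)[OF V]] using l \<beta>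
      by (simp add: ennreal_mult[symmetric] mult_ac)
    finally show "pmass (E V) \<beta> \<le> ennreal (l * \<beta> powr \<tau> V * measure lebesgue V)" .
  qed
  also have "\<dots> = ennreal (\<Sum>V\<in>F. l * \<beta> powr \<tau> V * measure lebesgue V)"
    using l by (intro sum_ennreal) auto
  also have "\<dots> \<le> 1" using le1 by (simp add: ennreal_le_1)
  finally have "(\<Sum>V\<in>F. pmass (E V) \<beta>) \<le> 1" .
  note S' = S[unfolded S_infty_with_def, THEN conjunct2, THEN conjunct2, THEN conjunct2, THEN conjunct2, rule_format]
  show ?thesis
  proof (rule S'[OF l F(1) _ F(2), where \<alpha> = "\<lambda>_. \<beta>" and E = E])
    show "(\<Sum>V\<in>F. pmass (E V) \<beta>) \<le> 1" by fact
    fix V assume V: "V \<in> F"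
    show "cube V" "0 < \<beta> \<and> \<beta> < 1" using V F(3) \<beta> by auto
    show "E V \<in> sets lebesgue \<and> E V \<subseteq> V \<and> measure lebesgue (E V) = l * measure lebesgue V"
      using E(1,2)[OF V] meas[OF V] by auto
  qed
qed

text \<open>Lowering the level keeps the mass of \<open>{p \<le> \<tau>}\<close> large relative to \<open>\<beta>\<^sup>\<tau>\<close>; this rules
  out single cubes violating the normalisation in the \<open>S\<^sub>\<infinity>\<close> condition.\<close>
lemma excess_single:
  assumes S: "S_infty_with r s0 C" and l: "0 < l" "l < s0" and V: "cube V" and \<beta>: "0 < \<beta>" "\<beta> < 1"
    and \<tau>: "a \<le> \<tau>" "emeasure lebesgue {x\<in>V. \<tau> < p x} \<le> ennreal l * emeasure lebesgue V"
      "ennreal l * emeasure lebesgue V \<le> emeasure lebesgue {x\<in>V. \<tau> \<le> p x}"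
      "ennreal ((2 * C + 1) * (l * \<beta> powr \<tau>)) * emeasure lebesgue V < pmass V (l powr (1 / r) * \<beta>)"
  shows "l * \<beta> powr \<tau> * measure lebesgue V \<le> 1 / 2"
proof (rule ccontr)
  have r: "1 < r" and s0: "s0 < 1" and C: "0 < C" using S by (auto simp: S_infty_with_def)
  have \<tau>1: "1 < \<tau>" using \<tau>(1) a1 by simp
  have Vs [measurable]: "V \<in> sets lebesgue" using V by (rule cube_lebesgue)
  obtain v where v: "emeasure lebesgue V = ennreal v" "v > 0" "measure lebesgue V = v" using cube_emeasure[OF V] by blast
  define X where "X = l * \<beta> powr \<tau> * v"
  assume "\<not> l * \<beta> powr \<tau> * measure lebesgue V \<le> 1 / 2"
  then have X: "1 / 2 < X" by (simp add: X_def v(3))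
  define c where "c = l powr (1 / r)"
  have c: "0 < c" "c \<le> 1" using l s0 r by (auto simp: c_def intro!: powr_le1)
  \<comment> \<open>The contraction with \<open>\<rho> powr \<tau> * X = 1/2\<close>; at level
    \<open>\<rho> * \<beta>\<close> the normalisation holds and the S-infinity inequality
    applies.\<close>
  define \<rho> where "\<rho> = (1 / (2 * X)) powr (1 / \<tau>)"
  have \<rho>: "0 < \<rho>" "\<rho> \<le> 1" using X \<tau>1 by (auto simp: \<rho>_def intro!: powr_le1)
  have \<rho>\<tau>: "\<rho> powr \<tau> = 1 / (2 * X)" using X \<tau>1 by (simp add: \<rho>_def powr_powr)
  have "\<rho> * \<beta> \<le> 1 * \<beta>" using \<rho> \<beta> by (intro mult_right_mono) auto
  then have "\<rho> * \<beta> < 1" using \<beta>(2) by linarith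
  then have \<rho>\<beta>: "0 < \<rho> * \<beta>" "\<rho> * \<beta> < 1" using \<rho>(1) \<beta>(1) by auto
  have "(\<Sum>W\<in>{V}. pmass W (l powr (1 / r) * (\<rho> * \<beta>))) \<le> ennreal C"
  proof (rule S_infty_apply[OF S l _ _ _ \<rho>\<beta>, where \<tau> = "\<lambda>_. \<tau>"])
    have "l * (\<rho> * \<beta>) powr \<tau> * v = \<rho> powr \<tau> * X" using \<rho> \<beta> by (simp add: powr_mult X_def mult_ac)
    also have "\<dots> = 1 / 2" using X by (simp add: \<rho>\<tau>)
    finally show "(\<Sum>W\<in>{V}. l * (\<rho> * \<beta>) powr \<tau> * measure lebesgue W) \<le> 1" using v(3) by simp
  qed (use V \<tau> in auto)
  then have 1: "pmass V (c * (\<rho> * \<beta>)) \<le> ennreal C" by (simp add: c_def)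
  define L where "L = {x\<in>V. p x \<le> \<tau>}"
  define H where "H = {x\<in>V. \<tau> < p x}"
  have Ls [measurable]: "L \<in> sets lebesgue" and Hs [measurable]: "H \<in> sets lebesgue"
    unfolding L_def H_def by measurable
  \<comment> \<open>The part with \<open>p > \<tau>\<close> carries at most \<open>X\<close>, so by
    excess the part with \<open>p \<le> \<tau>\<close> carries more than \<open>2 * C * X\<close>.
    There the contraction costs at most the factor \<open>\<rho> powr \<tau> = 1 / (2 * X)\<close>,
    and more than \<open>C\<close> remains, a contradiction.\<close>
  have split: "pmass V (c * \<beta>) = pmass L (c * \<beta>) + pmass H (c * \<beta>)"
    unfolding pmass_def by (subst nn_integral_add[symmetric]) (auto simp: L_def H_def indicator_def intro!: nn_integral_cong)
  have "pmass H (c * \<beta>) \<le> ennreal (\<beta> powr \<tau>) * emeasure lebesgue H"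
  proof (rule pmass_le_const[OF Hs])
    fix x assume "x \<in> H"
    have "(c * \<beta>) powr p x \<le> \<beta> powr p x" using c \<beta> p_pos[of x] by (intro powr_mono2) (auto simp: mult_le_cancel_right1)
    also have "\<dots> \<le> \<beta> powr \<tau>" using \<open>x \<in> H\<close> \<beta> by (intro powr_mono') (auto simp: H_def)
    finally show "(c * \<beta>) powr p x \<le> \<beta> powr \<tau>" .
  qed
  also have "\<dots> \<le> ennreal (\<beta> powr \<tau>) * (ennreal l * ennreal v)"
    using \<tau>(2) v by (intro mult_left_mono) (auto simp: H_def)
  also have "\<dots> = ennreal X" using l v by (simp add: X_def ennreal_mult[symmetric] mult_ac)
  finally have H: "pmass H (c * \<beta>) \<le> ennreal X" .
  have "ennreal ((2 * C + 1) * X) < pmass L (c * \<beta>) + pmass H (c * \<beta>)"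
  proof -
    have "ennreal ((2 * C + 1) * X) = ennreal ((2 * C + 1) * (l * \<beta> powr \<tau>)) * emeasure lebesgue V"
      unfolding v(1) X_def using C l v(2) by (subst ennreal_mult[symmetric]) (auto simp: mult_ac)
    then show ?thesis using \<tau>(4) split by (simp add: c_def)
  qed
  also have "\<dots> \<le> pmass L (c * \<beta>) + ennreal X" using H by (rule add_left_mono)
  finally have "ennreal (2 * C * X) < pmass L (c * \<beta>)"
    using C X by (cases "pmass L (c * \<beta>)") (auto simp: ennreal_plus[symmetric] ennreal_less_iff algebra_simps simp del: ennreal_plus)
  then have "ennreal (1 / (2 * X)) * ennreal (2 * C * X) < ennreal (1 / (2 * X)) * pmass L (c * \<beta>)"
    using X by (intro ennreal_mult_strict_left_mono) auto
  moreover have "ennreal (1 / (2 * X)) * ennreal (2 * C * X) = ennreal C"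
    using X C by (simp add: ennreal_mult[symmetric])
  moreover have "ennreal (1 / (2 * X)) * pmass L (c * \<beta>) \<le> pmass V (c * (\<rho> * \<beta>))"
  proof -
    have "ennreal (1 / (2 * X)) * pmass L (c * \<beta>) = (\<integral>\<^sup>+x. ennreal (1 / (2 * X)) * (ennreal ((c * \<beta>) powr p x) * indicator L x) \<partial>lebesgue)"
      unfolding pmass_def by (rule nn_integral_cmult[symmetric]) simp
    also have "\<dots> \<le> pmass V (c * (\<rho> * \<beta>))"
      unfolding pmass_def
    proof (rule nn_integral_mono)
      fix x
      show "ennreal (1 / (2 * X)) * (ennreal ((c * \<beta>) powr p x) * indicator L x) \<le> ennreal ((c * (\<rho> * \<beta>)) powr p x) * indicator V x"
      proof (cases "x \<in> L")
        case True
        have "1 / (2 * X) * (c * \<beta>) powr p x \<le> \<rho> powr p x * (c * \<beta>) powr p x"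
          unfolding \<rho>\<tau>[symmetric] using True \<rho> by (intro mult_right_mono powr_mono') (auto simp: L_def)
        also have "\<dots> = (c * (\<rho> * \<beta>)) powr p x" using \<rho> c \<beta> by (simp add: powr_mult mult_ac)
        finally show ?thesis using True X by (simp add: L_def ennreal_mult[symmetric] ennreal_leI)
      qed simp
    qed
    finally show ?thesis .
  qed
  ultimately show False using 1 by (metis not_less order_trans)
qed

text \<open>A bootstrap on the total of the quantities \<open>X V\<close>. A subfamily with total at
  most \<open>1/2\<close> and one further cube, with \<open>X V \<le> 1/2\<close>, still meet the
  normalisation. Excess and the S-infinity bound then give \<open>2 * C + 1\<close> times the new
  total at most \<open>C\<close>, so this total is again at most \<open>1/2\<close>. The constant in
  \<open>excess\<close> is made for this step.\<close>

lemma excess_family: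
  assumes S: "S_infty_with r s0 C" and l: "0 < l" "l < s0" and \<beta>: "0 < \<beta>" "\<beta> < 1"
    and F: "finite F" "disjoint F" "\<And>V. V \<in> F \<Longrightarrow> cube V" "\<And>V. V \<in> F \<Longrightarrow> excess r C l \<beta> V"
  shows "(\<Sum>V\<in>F. pmass V (l powr (1 / r) * \<beta>)) \<le> ennreal C"
proof -
  have C: "0 < C" using S by (auto simp: S_infty_with_def)
  have "\<forall>V\<in>F. \<exists>\<tau>. a \<le> \<tau> \<and> \<tau> \<le> b \<and>
     emeasure lebesgue {x\<in>V. \<tau> < p x} \<le> ennreal l * emeasure lebesgue V \<and>
     ennreal l * emeasure lebesgue V \<le> emeasure lebesgue {x\<in>V. \<tau> \<le> p x} \<and>
     ennreal ((2 * C + 1) * (l * \<beta> powr \<tau>)) * emeasure lebesgue V < pmass V (l powr (1 / r) * \<beta>)"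
    using F(4) unfolding excess_def by (rule ballI)
  from bchoice[OF this] obtain \<tau> where "\<forall>V\<in>F. a \<le> \<tau> V \<and> \<tau> V \<le> b \<and>
     emeasure lebesgue {x\<in>V. \<tau> V < p x} \<le> ennreal l * emeasure lebesgue V \<and>
     ennreal l * emeasure lebesgue V \<le> emeasure lebesgue {x\<in>V. \<tau> V \<le> p x} \<and>
     ennreal ((2 * C + 1) * (l * \<beta> powr \<tau> V)) * emeasure lebesgue V < pmass V (l powr (1 / r) * \<beta>)"
    by (rule exE)
  then have \<tau>: "\<And>V. V \<in> F \<Longrightarrow> a \<le> \<tau> V"
      "\<And>V. V \<in> F \<Longrightarrow> emeasure lebesgue {x\<in>V. \<tau> V < p x} \<le> ennreal l * emeasure lebesgue V"
      "\<And>V. V \<in> F \<Longrightarrow> ennreal l * emeasure lebesgue V \<le> emeasure lebesgue {x\<in>V. \<tau> V \<le> p x}"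
      "\<And>V. V \<in> F \<Longrightarrow> ennreal ((2 * C + 1) * (l * \<beta> powr \<tau> V)) * emeasure lebesgue V < pmass V (l powr (1 / r) * \<beta>)"
    by simp_all
  define X where "X = (\<lambda>V. l * \<beta> powr \<tau> V * measure lebesgue V)"
  have X0: "0 \<le> X V" for V using l by (simp add: X_def)
  have single: "X V \<le> 1/2" if "V \<in> F" for V
    unfolding X_def using that by (intro excess_single[OF S l F(3) \<beta> \<tau>]) auto
  have big: "ennreal ((2 * C + 1) * X V) \<le> pmass V (l powr (1 / r) * \<beta>)" if V: "V \<in> F" for V
  proof -
    have "ennreal ((2 * C + 1) * X V) = ennreal ((2 * C + 1) * (l * \<beta> powr \<tau> V)) * emeasure lebesgue V"
      unfolding cube_emeasure(3)[OF F(3)[OF V]] X_def using C l by (subst ennreal_mult[symmetric]) (auto simp: mult_ac)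
    then show ?thesis using \<tau>(4)[OF V] by simp
  qed
  have app: "(\<Sum>V\<in>G. pmass V (l powr (1 / r) * \<beta>)) \<le> ennreal C" if G: "G \<subseteq> F" "(\<Sum>V\<in>G. X V) \<le> 1" for G
  proof (rule S_infty_apply[OF S l _ _ _ \<beta>, where \<tau> = \<tau>])
    show "finite G" using G(1) F(1) finite_subset by blast
    show "disjoint G" using G(1) F(2) by (meson pairwise_subset)
    show "cube V" if "V \<in> G" for V using that G(1) F(3) by blast
    show "ennreal l * emeasure lebesgue V \<le> emeasure lebesgue {x\<in>V. \<tau> V \<le> p x}" if "V \<in> G" for V
      using that G(1) \<tau>(3) by blast
    show "(\<Sum>V\<in>G. l * \<beta> powr \<tau> V * measure lebesgue V) \<le> 1" using G(2) by (simp add: X_def)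
  qed
  have "(\<Sum>V\<in>G. X V) \<le> 1/2" if "finite G" "G \<subseteq> F" for G
    using that
  proof (induction G rule: finite_induct)
    case (insert V G)
    have "(\<Sum>W\<in>insert V G. X W) \<le> 1" using insert single[of V] by simp
    from app[OF insert.prems this] have le: "(\<Sum>W\<in>insert V G. pmass W (l powr (1 / r) * \<beta>)) \<le> ennreal C" .
    have "ennreal ((2 * C + 1) * (\<Sum>W\<in>insert V G. X W)) = (\<Sum>W\<in>insert V G. ennreal ((2 * C + 1) * X W))"
      unfolding sum_distrib_left using C X0 by (subst sum_ennreal) auto
    also have "\<dots> \<le> (\<Sum>W\<in>insert V G. pmass W (l powr (1 / r) * \<beta>))"
      using insert.prems by (intro sum_mono big) auto
    also note le
    finally have "(2 * C + 1) * (\<Sum>W\<in>insert V G. X W) \<le> C" using C by (simp add: ennreal_le_iff)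
    moreover have "0 \<le> (\<Sum>W\<in>insert V G. X W)" using X0 by (intro sum_nonneg)
    moreover have "(2 * C + 1) * (\<Sum>W\<in>insert V G. X W)
        = C * (2 * (\<Sum>W\<in>insert V G. X W)) + (\<Sum>W\<in>insert V G. X W)"
      by algebra
    ultimately have "C * (2 * (\<Sum>W\<in>insert V G. X W)) \<le> C * 1" by linarith
    then have "2 * (\<Sum>W\<in>insert V G. X W) \<le> 1" using C by (simp only: mult_le_cancel_left_pos)
    then show ?case by linarith
  qed simp
  from this[OF F(1)] have "(\<Sum>V\<in>F. X V) \<le> 1" by simp
  then show ?thesis by (rule app[OF order_refl])
qed

section \<open>The exceptional sets\<close>

definition excess_set :: "real \<Rightarrow> real \<Rightarrow> real \<Rightarrow> real \<Rightarrow> ('n \<Rightarrow> bool) \<Rightarrow> (real ^ 'n) set" where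
  "excess_set r C l \<beta> s = \<Union>{V\<in>grid s. excess r C l \<beta> V}"

lemma excess_set_sets [measurable]: "excess_set r C l \<beta> s \<in> sets lebesgue"
  unfolding excess_set_def
  by (intro sets.countable_Union countable_subset[OF _ countable_grid[of s]]) (auto simp: grid_sets)

text \<open>Only finite disjoint families of excess cubes have to be tested, since smaller cubes are
  absorbed by those containing them.\<close>

lemma pmass_excess_set:
  assumes S: "S_infty_with r s0 C" and l: "0 < l" "l < s0" and \<beta>: "0 < \<beta>" "\<beta> < 1"
  shows "pmass (excess_set r C l \<beta> s) (l powr (1 / r) * \<beta>) \<le> ennreal C"
proof -
  define M where "M = density lebesgue (\<lambda>x. ennreal ((l powr (1 / r) * \<beta>) powr p x))"
  have M: "emeasure M A = pmass A (l powr (1 / r) * \<beta>)" if "A \<in> sets lebesgue" for A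
    unfolding M_def pmass_def using that by (subst emeasure_density) auto
  have "emeasure M (\<Union>{V\<in>grid s. excess r C l \<beta> V}) \<le> ennreal C"
  proof (rule emeasure_grid_Union_le[of _ s])
    fix F assume F: "finite F" "F \<subseteq> {V\<in>grid s. excess r C l \<beta> V}" "disjoint F"
    have "(\<Sum>V\<in>F. emeasure M V) = (\<Sum>V\<in>F. pmass V (l powr (1 / r) * \<beta>))"
      using F(2) by (intro sum.cong refl M) (auto simp: grid_sets)
    also have "\<dots> \<le> ennreal C"
      using F by (intro excess_family[OF S l \<beta>]) (auto simp: cube_grid)
    finally show "(\<Sum>V\<in>F. emeasure M V) \<le> ennreal C" .
  qed (auto simp: M_def)
  then show ?thesis using M[OF excess_set_sets] by (simp add: excess_set_def)
qed

lemma not_excess: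
  assumes V: "cube V" and n: "\<not> excess r C l \<beta> V" and l: "0 \<le> l" "l \<le> 1"
  obtains \<tau> where "a \<le> \<tau>" "emeasure lebesgue {x\<in>V. \<tau> < p x} \<le> ennreal l * emeasure lebesgue V"
    "pmass V (l powr (1 / r) * \<beta>) \<le> ennreal ((2 * C + 1) * (l * \<beta> powr \<tau>)) * emeasure lebesgue V"
proof -
  obtain \<tau> where \<tau>: "a \<le> \<tau>" "\<tau> \<le> b" "emeasure lebesgue {x\<in>V. \<tau> < p x} \<le> ennreal l * emeasure lebesgue V"
      "ennreal l * emeasure lebesgue V \<le> emeasure lebesgue {x\<in>V. \<tau> \<le> p x}"
    using quantile_p[OF V l] by blast
  then have "\<not> ennreal ((2 * C + 1) * (l * \<beta> powr \<tau>)) * emeasure lebesgue V < pmass V (l powr (1 / r) * \<beta>)"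
    using n unfolding excess_def by blast
  then show ?thesis using \<tau> by (intro that[of \<tau>]) auto
qed

text \<open>A cube not inside the excess set is not itself an excess cube, so up to a dilation its
  average of \<open>\<gamma> powr p x\<close> is at most a multiple of
  \<open>\<gamma> powr \<tau>\<close>. As \<open>\<gamma> < 1\<close>, the weight is at least
  \<open>\<gamma> powr \<tau>\<close> wherever \<open>p \<le> \<tau>\<close>, a proportion of at
  least \<open>1 - l\<close>.\<close>

lemma A_infinity_on_off_excess:
  assumes S: "S_infty_with r s0 C" and Q: "Q \<in> grid s" and l: "0 < l" "l < s0" and \<gamma>: "0 < \<gamma>" "\<gamma> < 1"
  shows "A_infinity_on (1 - l) (1 / (1 + (l powr (- 1 / r)) powr b * (2 * C + 1))) s Q
    (excess_set r C l \<gamma> s) (\<lambda>x. \<gamma> powr p x)"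
  unfolding A_infinity_on_def
proof (intro conjI ballI impI allI)
  have r: "1 < r" and s0: "s0 < 1" and C: "0 < C" using S by (auto simp: S_infty_with_def)
  show "Q \<in> grid s" by fact
  show "(\<lambda>x. \<gamma> powr p x) \<in> borel_measurable lebesgue" by measurable
  define c where "c = l powr (- 1 / r)"
  have c: "1 \<le> c" using l s0 r by (simp add: c_def powr_minus_divide ge_one_powr_ge_zero powr_le1)
  define K where "K = 1 + c powr b * (2 * C + 1)"
  have K: "0 < K" "c powr b * (2 * C + 1) * l \<le> K"
  proof -
    have "0 \<le> c powr b * (2 * C + 1)" using C by simp
    moreover have "c powr b * (2 * C + 1) * l \<le> c powr b * (2 * C + 1) * 1"
      using C l s0 by (intro mult_left_mono) auto
    ultimately show "0 < K" "c powr b * (2 * C + 1) * l \<le> K" by (auto simp: K_def)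
  qed
  fix V assume V: "V \<in> grid s" "V \<subseteq> Q" "\<not> V \<subseteq> excess_set r C l \<gamma> s"
  have cV: "cube V" using V(1) by (rule cube_grid)
  have Vs [measurable]: "V \<in> sets lebesgue" using V(1) by (rule grid_sets)
  obtain v where v: "emeasure lebesgue V = ennreal v" "v > 0" "measure lebesgue V = v" using cube_emeasure[OF cV] by blast
  have "\<not> excess r C l \<gamma> V" using V(1,3) by (auto simp: excess_set_def)
  then obtain \<tau> where \<tau>: "emeasure lebesgue {x\<in>V. \<tau> < p x} \<le> ennreal l * emeasure lebesgue V"
    "pmass V (l powr (1 / r) * \<gamma>) \<le> ennreal ((2 * C + 1) * (l * \<gamma> powr \<tau>)) * emeasure lebesgue V"
    using not_excess[OF cV, of r C l \<gamma>] l s0 by auto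
  have "pmass V \<gamma> = pmass V (c * (l powr (1 / r) * \<gamma>))"
  proof -
    have "c * (l powr (1 / r) * \<gamma>) = \<gamma>" using l by (simp add: c_def powr_minus)
    then show ?thesis by (simp only:)
  qed
  also have "\<dots> \<le> ennreal (c powr b) * pmass V (l powr (1 / r) * \<gamma>)"
    using c \<gamma> by (intro pmass_scale_up) auto
  also have "\<dots> \<le> ennreal (c powr b) * (ennreal ((2 * C + 1) * (l * \<gamma> powr \<tau>)) * ennreal v)"
    using \<tau>(2) v(1) by (intro mult_left_mono) auto
  also have "\<dots> = ennreal (c powr b * ((2 * C + 1) * (l * \<gamma> powr \<tau>)) * v)"
    using C l v(2) by (simp add: ennreal_mult[symmetric])
  also have "\<dots> \<le> ennreal (K * \<gamma> powr \<tau> * v)"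
  proof (rule ennreal_leI)
    have "(c powr b * (2 * C + 1) * l) * (\<gamma> powr \<tau> * v) \<le> K * (\<gamma> powr \<tau> * v)"
      using K v(2) by (intro mult_right_mono) auto
    then show "c powr b * ((2 * C + 1) * (l * \<gamma> powr \<tau>)) * v \<le> K * \<gamma> powr \<tau> * v" by (simp add: mult_ac)
  qed
  also have "\<dots> = ennreal (K * \<gamma> powr \<tau>) * emeasure lebesgue V"
    unfolding v(1) using K v(2) by (intro ennreal_mult) auto
  finally have 1: "pmass V \<gamma> \<le> ennreal (K * \<gamma> powr \<tau>) * emeasure lebesgue V" .
  have e: "1 / K * (K * \<gamma> powr \<tau>) = \<gamma> powr \<tau>" using K by simp
  have "ennreal (1 - l) * emeasure lebesgue V \<le> emeasure lebesgue {x\<in>V. p x \<le> \<tau>}"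
    using \<tau>(1) l s0 by (intro emeasure_le_quantile[OF cV]) auto
  also have "\<dots> \<le> emeasure lebesgue {x\<in>V. \<gamma> powr \<tau> \<le> \<gamma> powr p x}"
  proof (rule emeasure_mono)
    show "{x\<in>V. p x \<le> \<tau>} \<subseteq> {x\<in>V. \<gamma> powr \<tau> \<le> \<gamma> powr p x}" using \<gamma> by (auto intro!: powr_mono')
  qed measurable
  finally have 2: "ennreal (1 - l) * emeasure lebesgue V \<le> emeasure lebesgue {x\<in>V. 1 / K * (K * \<gamma> powr \<tau>) \<le> \<gamma> powr p x}"
    unfolding e .
  show "\<exists>d\<ge>0. (\<integral>\<^sup>+ x\<in>V. ennreal (\<gamma> powr p x)\<partial>lebesgue) \<le> ennreal d * emeasure lebesgue V \<and>
      ennreal (1 - l) * emeasure lebesgue V \<le> emeasure lebesgue {x \<in> V. 1 / (1 + (l powr (- 1 / r)) powr b * (2 * C + 1)) * d \<le> \<gamma> powr p x}"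
    unfolding c_def[symmetric] K_def[symmetric]
    using 1[unfolded pmass_def] 2 K by (intro exI[of _ "K * \<gamma> powr \<tau>"] conjI) simp_all
qed auto

text \<open>The exceptional set has bounded mass at a level comparable to \<open>\<alpha>\<^bsup>1/(1+\<epsilon>)\<^esup>\<close>, which exceeds \<open>\<alpha>\<close>
  by a negative power of \<open>\<alpha>\<close>. This makes its contributions summable over dyadic \<open>\<alpha>\<close>.\<close>
lemma S_infty_imp_small_levels:
  assumes S: "S_infty_with r s0 C"
  shows "\<exists>\<epsilon>>0. 1 + \<epsilon> < r \<and> (\<exists>C'>0. \<forall>(s :: 'n \<Rightarrow> bool) l \<alpha>. 0 < l \<longrightarrow> l < s0 \<longrightarrow> 0 < \<alpha> \<longrightarrow> \<alpha> < 1 \<longrightarrow>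
    (\<exists>U\<in>sets lebesgue. pmass U (l powr (1 / r) * \<alpha> powr (1 / (1 + \<epsilon>))) \<le> ennreal C' \<and>
      (\<forall>Q E. Q \<in> grid s \<longrightarrow> E \<in> sets lebesgue \<longrightarrow> E \<subseteq> Q \<longrightarrow> ennreal (2 * l) * emeasure lebesgue Q \<le> emeasure lebesgue E \<longrightarrow>
        pmass (Q - U) (l powr ((1 + \<epsilon>) / r) * \<alpha>) \<le> ennreal C' * pmass E \<alpha>)))"
proof -
  have r: "1 < r" and s0: "0 < s0" "s0 < 1" and C: "0 < C" using S by (auto simp: S_infty_with_def)
  \<comment> \<open>An auxiliary proportion, fixed so that the reverse Hoelder exponent and its
    constants do not depend on the proportion \<open>l\<close> of the claim.\<close>
  define l1 where "l1 = s0 / 2"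
  have l1: "0 < l1" "l1 < s0" using s0 by (auto simp: l1_def)
  define c where "c = l1 powr (- 1 / r)"
  have c: "1 \<le> c" using l1 s0 r by (simp add: c_def powr_minus_divide ge_one_powr_ge_zero powr_le1)
  define K where "K = 2 * C + 1"
  have K: "1 \<le> K" using C by (simp add: K_def)
  have \<kappa>: "0 < 1 - l1" "1 - l1 \<le> 1" using l1 s0 by auto
  have "0 < 1 + c powr b * (2 * C + 1)" "1 \<le> 1 + c powr b * (2 * C + 1)" using C by (auto intro: add_pos_nonneg)
  then have \<delta>: "0 < 1 / (1 + c powr b * (2 * C + 1))" "1 / (1 + c powr b * (2 * C + 1)) \<le> 1" by auto
  obtain \<epsilon>0 D where \<epsilon>0: "0 < \<epsilon>0" and D: "0 < D" and RH:
    "\<forall>(s :: 'n \<Rightarrow> bool) Q U u T e. A_infinity_on (1 - l1) (1 / (1 + c powr b * (2 * C + 1))) s Q U u \<longrightarrow>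
      0 < T \<longrightarrow> (\<integral>\<^sup>+x\<in>Q. ennreal (u x) \<partial>lebesgue) = ennreal T * emeasure lebesgue Q \<longrightarrow>
      0 < e \<longrightarrow> e \<le> \<epsilon>0 \<longrightarrow>
      (\<integral>\<^sup>+x\<in>Q - U. ennreal (u x powr (1 + e)) \<partial>lebesgue) \<le> ennreal (D * T powr (1 + e)) * emeasure lebesgue Q"
    using reverse_Hoelder[OF \<kappa> \<delta>, where 'n = 'n] by auto
  \<comment> \<open>Kept below \<open>r - 1\<close>, so that \<open>l\<close> enters the final level
    with the exponent \<open>(1 + \<epsilon>) / r < 1\<close>.\<close>
  define \<epsilon> where "\<epsilon> = min \<epsilon>0 ((r - 1) / 2)"
  have "\<epsilon> \<le> (r - 1) / 2" unfolding \<epsilon>_def by (rule min.cobounded2)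
  then have \<epsilon>: "0 < \<epsilon>" "\<epsilon> \<le> \<epsilon>0" "1 + \<epsilon> < r" using \<epsilon>0 r by (auto simp: \<epsilon>_def)
  define C' where "C' = C + c powr b * C + D * K powr (1 + \<epsilon>)"
  have C': "0 < C'" "C + c powr b * C \<le> C'" "D * K powr (1 + \<epsilon>) \<le> C'"
    using C D by (auto simp: C'_def add_pos_nonneg)
  have main: "\<exists>U\<in>sets lebesgue. pmass U (l powr (1 / r) * \<alpha> powr (1 / (1 + \<epsilon>))) \<le> ennreal C' \<and>
      (\<forall>Q E. Q \<in> grid s \<longrightarrow> E \<in> sets lebesgue \<longrightarrow> E \<subseteq> Q \<longrightarrow> ennreal (2 * l) * emeasure lebesgue Q \<le> emeasure lebesgue E \<longrightarrow>
        pmass (Q - U) (l powr ((1 + \<epsilon>) / r) * \<alpha>) \<le> ennreal C' * pmass E \<alpha>)"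
    if l: "0 < l" "l < s0" and \<alpha>: "0 < \<alpha>" "\<alpha> < 1" for s :: "'n \<Rightarrow> bool" and l \<alpha>
  proof -
    \<comment> \<open>Reverse Hoelder raises \<open>\<gamma> = l powr (1 / r) * \<beta>\<close> to
      the power \<open>1 + \<epsilon>\<close>; starting from this root of \<open>\<alpha>\<close>,
      it arrives at \<open>l powr ((1 + \<epsilon>) / r) * \<alpha>\<close>.\<close>
    define \<beta> where "\<beta> = \<alpha> powr (1 / (1 + \<epsilon>))"
    have \<beta>: "0 < \<beta>" "\<beta> < 1"
      using \<alpha> \<epsilon> powr_less_mono2[of "1 / (1 + \<epsilon>)" \<alpha> 1] by (auto simp: \<beta>_def)
    have \<beta>\<epsilon>: "\<beta> powr (1 + \<epsilon>) = \<alpha>" using \<alpha> \<epsilon> by (simp add: \<beta>_def powr_powr)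
    define \<gamma> where "\<gamma> = l powr (1 / r) * \<beta>"
    have lr: "0 < l powr (1 / r)" "l powr (1 / r) \<le> 1" using l s0 r by (auto intro!: powr_le1)
    have "l powr (1 / r) * \<beta> \<le> 1 * \<beta>" using lr \<beta> by (intro mult_right_mono) auto
    then have "l powr (1 / r) * \<beta> < 1" using \<beta>(2) by linarith
    then have \<gamma>: "0 < \<gamma>" "\<gamma> < 1" using lr \<beta>(1) by (auto simp: \<gamma>_def)
    have \<gamma>\<epsilon>: "\<gamma> powr (1 + \<epsilon>) = l powr ((1 + \<epsilon>) / r) * \<alpha>"
      using l \<beta> by (simp add: \<gamma>_def powr_mult powr_powr \<beta>\<epsilon>)
    \<comment> \<open>\<open>U0\<close> removes the cubes for which the comparison with
      \<open>\<beta> powr \<tau>\<close> fails; \<open>U1\<close>, at proportion \<open>l1\<close>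
      and level \<open>\<gamma>\<close>, removes those on which reverse Hoelder lacks its
      hypothesis.\<close>
    define U0 where "U0 = excess_set r C l \<beta> s"
    define U1 where "U1 = excess_set r C l1 \<gamma> s"
    have Us [measurable]: "U0 \<in> sets lebesgue" "U1 \<in> sets lebesgue" by (auto simp: U0_def U1_def)
    have "pmass U0 \<gamma> \<le> ennreal C"
      unfolding U0_def \<gamma>_def by (rule pmass_excess_set[OF S l \<beta>])
    moreover have "pmass U1 \<gamma> \<le> ennreal (c powr b * C)"
    proof -
      have "c * (l1 powr (1 / r) * \<gamma>) = \<gamma>" using l1 by (simp add: c_def powr_minus)
      then have "pmass U1 \<gamma> = pmass U1 (c * (l1 powr (1 / r) * \<gamma>))" by (simp only:)
      also have "\<dots> \<le> ennreal (c powr b) * pmass U1 (l1 powr (1 / r) * \<gamma>)"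
        using c \<gamma> by (intro pmass_scale_up) auto
      also have "\<dots> \<le> ennreal (c powr b) * ennreal C"
        unfolding U1_def using pmass_excess_set[OF S l1 \<gamma>] by (intro mult_left_mono) auto
      also have "\<dots> = ennreal (c powr b * C)" using C by (intro ennreal_mult[symmetric]) auto
      finally show ?thesis .
    qed
    moreover have "pmass (U0 \<union> U1) \<gamma> \<le> pmass U0 \<gamma> + pmass U1 \<gamma>"
      unfolding pmass_def by (subst nn_integral_add[symmetric]) (auto simp: indicator_def intro!: nn_integral_mono)
    ultimately have "pmass (U0 \<union> U1) \<gamma> \<le> ennreal C + ennreal (c powr b * C)" by (meson add_mono order_trans)
    also have "\<dots> = ennreal (C + c powr b * C)" using C by (intro ennreal_plus[symmetric]) auto
    also have "\<dots> \<le> ennreal C'" using C' by (intro ennreal_leI)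
    finally have pU: "pmass (U0 \<union> U1) \<gamma> \<le> ennreal C'" .
    have "pmass (Q - (U0 \<union> U1)) (l powr ((1 + \<epsilon>) / r) * \<alpha>) \<le> ennreal C' * pmass E \<alpha>"
      if Q: "Q \<in> grid s" and E [measurable]: "E \<in> sets lebesgue" and EQ: "E \<subseteq> Q"
        and El: "ennreal (2 * l) * emeasure lebesgue Q \<le> emeasure lebesgue E" for Q E
    proof (cases "Q \<subseteq> U0")
      case True
      then have e: "Q - (U0 \<union> U1) = {}" by blast
      show ?thesis unfolding e by (simp add: pmass_def)
    next
      case False
      have cQ: "cube Q" using Q by (rule cube_grid)
      have Qs [measurable]: "Q \<in> sets lebesgue" using Q by (rule grid_sets)
      obtain v where v: "emeasure lebesgue Q = ennreal v" "v > 0" "measure lebesgue Q = v" using cube_emeasure[OF cQ] by blast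
      have "\<not> excess r C l \<beta> Q" using False Q by (auto simp: U0_def excess_set_def)
      then obtain \<tau> where \<tau>: "emeasure lebesgue {x\<in>Q. \<tau> < p x} \<le> ennreal l * emeasure lebesgue Q"
        "pmass Q \<gamma> \<le> ennreal (K * (l * \<beta> powr \<tau>)) * emeasure lebesgue Q"
        using not_excess[OF cQ, of r C l \<beta>] l s0 unfolding K_def \<gamma>_def by auto
      obtain w where w: "pmass Q \<gamma> = ennreal w" "0 \<le> w"
        using \<tau>(2) v(1) by (cases "pmass Q \<gamma>") (auto simp: top_unique ennreal_mult_eq_top_iff)
      have "ennreal (\<gamma> powr b) * emeasure lebesgue Q \<le> pmass Q \<gamma>"
        using \<gamma> p_le by (intro pmass_subset_const_ge) (auto intro!: powr_mono')
      then have "ennreal (\<gamma> powr b * v) \<le> ennreal w" using v w by (simp add: ennreal_mult)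
      then have "\<gamma> powr b * v \<le> w" using w by simp
      moreover have "0 < \<gamma> powr b * v" using \<gamma> v by simp
      ultimately have w0: "0 < w" by linarith
      define T where "T = w / v"
      have T0: "0 < T" using w0 v by (simp add: T_def)
      have T: "(\<integral>\<^sup>+x\<in>Q. ennreal (\<gamma> powr p x) \<partial>lebesgue) = ennreal T * emeasure lebesgue Q"
        using w v T0 unfolding pmass_def by (simp add: T_def ennreal_mult[symmetric])
      have "ennreal w \<le> ennreal (K * (l * \<beta> powr \<tau>) * v)"
        using \<tau>(2) w v K l by (simp add: ennreal_mult)
      then have "w \<le> K * (l * \<beta> powr \<tau>) * v" using K l v by (simp add: ennreal_le_iff)
      then have TK: "T \<le> K * (l * \<beta> powr \<tau>)" using v by (simp add: T_def field_simps)
      have Ainf: "A_infinity_on (1 - l1) (1 / (1 + c powr b * (2 * C + 1))) s Q U1 (\<lambda>x. \<gamma> powr p x)"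
        unfolding c_def U1_def by (rule A_infinity_on_off_excess[OF S Q l1 \<gamma>])
      have "pmass (Q - (U0 \<union> U1)) (l powr ((1 + \<epsilon>) / r) * \<alpha>) \<le> (\<integral>\<^sup>+x\<in>Q - U1. ennreal ((\<gamma> powr p x) powr (1 + \<epsilon>)) \<partial>lebesgue)"
        unfolding pmass_def \<gamma>\<epsilon>[symmetric] powr_powr
        by (intro nn_integral_mono) (auto simp: indicator_def mult.commute)
      also have "\<dots> \<le> ennreal (D * T powr (1 + \<epsilon>)) * emeasure lebesgue Q"
        using RH[rule_format, OF Ainf T0 T \<epsilon>(1,2)] .
      also have "\<dots> \<le> ennreal (C' * (\<alpha> powr \<tau> * l)) * ennreal v"
        unfolding v(1)
      proof (intro mult_right_mono ennreal_leI)
        have "D * T powr (1 + \<epsilon>) \<le> D * (K * (l * \<beta> powr \<tau>)) powr (1 + \<epsilon>)"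
          using D T0 TK \<epsilon> by (intro mult_left_mono powr_mono2) auto
        also have "\<dots> = D * K powr (1 + \<epsilon>) * (l powr (1 + \<epsilon>) * \<alpha> powr \<tau>)"
        proof -
          have "(\<beta> powr \<tau>) powr (1 + \<epsilon>) = \<alpha> powr \<tau>"
            unfolding \<beta>\<epsilon>[symmetric] powr_powr by (simp add: mult.commute)
          then show ?thesis using K l by (simp add: powr_mult mult_ac)
        qed
        also have "\<dots> \<le> C' * (l * \<alpha> powr \<tau>)"
        proof (intro mult_mono)
          show "l powr (1 + \<epsilon>) \<le> l" using l s0 \<epsilon> powr_mono'[of 1 "1 + \<epsilon>" l] by simp
        qed (use C' l in auto)
        finally show "D * T powr (1 + \<epsilon>) \<le> C' * (\<alpha> powr \<tau> * l)" by (simp add: mult_ac)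
      qed simp
      also have "\<dots> = ennreal C' * (ennreal (\<alpha> powr \<tau>) * ennreal (l * v))"
        using C' l v by (simp add: ennreal_mult[symmetric] mult_ac)
      also have "\<dots> \<le> ennreal C' * pmass E \<alpha>"
      proof (rule mult_left_mono)
        \<comment> \<open>\<open>E\<close> has proportion at least \<open>2 * l\<close> in
          \<open>Q\<close>, and \<open>p > \<tau>\<close> holds on at most a proportion
          \<open>l\<close>, so \<open>E0\<close> keeps a proportion \<open>l\<close>; on it
          \<open>\<alpha> powr p x \<ge> \<alpha> powr \<tau>\<close>.\<close>
        define E0 where "E0 = {x\<in>E. p x \<le> \<tau>}"
        have E0s [measurable]: "E0 \<in> sets lebesgue" unfolding E0_def by measurable
        have "emeasure lebesgue E \<le> emeasure lebesgue (E0 \<union> {x\<in>Q. \<tau> < p x})"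
          using EQ by (intro emeasure_mono) (auto simp: E0_def)
        also have "\<dots> \<le> emeasure lebesgue E0 + emeasure lebesgue {x\<in>Q. \<tau> < p x}"
          by (rule emeasure_subadditive) auto
        also have "\<dots> \<le> emeasure lebesgue E0 + ennreal (l * v)"
          using \<tau>(1) v l by (intro add_left_mono) (simp add: ennreal_mult)
        finally have "ennreal (2 * l) * ennreal v \<le> emeasure lebesgue E0 + ennreal (l * v)"
          using El v by (auto intro: order_trans)
        then have *: "ennreal (2 * l * v) \<le> emeasure lebesgue E0 + ennreal (l * v)"
          using l v by (subst ennreal_mult) auto
        have "ennreal (l * v) \<le> emeasure lebesgue E0"
        proof (cases "emeasure lebesgue E0")
          case (real e)
          then have "2 * l * v \<le> e + l * v" using * l v by (simp add: ennreal_plus[symmetric] del: ennreal_plus)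
          then show ?thesis using real by (simp add: ennreal_leI)
        qed auto
        then have "ennreal (\<alpha> powr \<tau>) * ennreal (l * v) \<le> ennreal (\<alpha> powr \<tau>) * emeasure lebesgue E0"
          by (rule mult_left_mono) simp
        also have "\<dots> \<le> pmass E \<alpha>"
          using \<alpha> by (intro pmass_subset_const_ge) (auto simp: E0_def intro!: powr_mono')
        finally show "ennreal (\<alpha> powr \<tau>) * ennreal (l * v) \<le> pmass E \<alpha>" .
      qed simp
      finally show ?thesis .
    qed
    moreover have "U0 \<union> U1 \<in> sets lebesgue" by simp
    ultimately show ?thesis using pU unfolding \<gamma>_def \<beta>_def by blast
  qed
  show ?thesis
    by (rule exI[of _ \<epsilon>], intro conjI \<epsilon>, rule exI[of _ C'], intro conjI C' allI impI main)
qed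

end

subsection \<open>Summation over dyadic levels\<close>

lemma int_geometric_sum:
  fixes y e :: real
  assumes y: "0 < y" and e: "0 < e"
  shows "(\<integral>\<^sup>+i. ennreal (if 2 powr real_of_int i < y then (2 powr real_of_int i) powr e else 0) \<partial>count_space UNIV)
    \<le> ennreal (y powr e / (1 - 2 powr (- e)))"
proof -
  define j where "j = \<lceil>log 2 y\<rceil> - 1"
  have iff: "2 powr real_of_int i < y \<longleftrightarrow> i \<le> j" for i
  proof -
    have "2 powr real_of_int i < y \<longleftrightarrow> real_of_int i < log 2 y" using y by (simp add: less_log_iff)
    also have "\<dots> \<longleftrightarrow> i \<le> j" unfolding j_def by linarith
    finally show ?thesis .
  qed
  have q: "0 < (2::real) powr (- e)" "(2::real) powr (- e) < 1" using e by (auto simp: powr_minus_divide)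
  have bij: "bij_betw (\<lambda>n::nat. j - int n) UNIV {..j}"
    by (rule bij_betw_byWitness[where f' = "\<lambda>i. nat (j - i)"]) auto
  have "(\<integral>\<^sup>+i. ennreal (if 2 powr real_of_int i < y then (2 powr real_of_int i) powr e else 0) \<partial>count_space UNIV)
      = (\<integral>\<^sup>+i. ennreal ((2 powr real_of_int i) powr e) * indicator {..j} i \<partial>count_space UNIV)"
    by (intro nn_integral_cong) (auto simp: iff)
  also have "\<dots> = (\<integral>\<^sup>+i. ennreal ((2 powr real_of_int i) powr e) \<partial>count_space {..j})"
    by (subst nn_integral_count_space_indicator) auto
  also have "\<dots> = (\<integral>\<^sup>+n. ennreal ((2 powr real_of_int (j - int n)) powr e) \<partial>count_space UNIV)"
    by (rule nn_integral_bij_count_space[OF bij, symmetric])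
  also have "\<dots> = (\<Sum>n. ennreal ((2 powr real_of_int j) powr e * (2 powr (- e)) ^ n))"
    unfolding nn_integral_count_space_nat
  proof (intro arg_cong[where f = suminf] ext arg_cong[where f = ennreal])
    fix n
    have "(2 powr (- e)) ^ n = 2 powr (- e * real n)" by (simp add: powr_realpow[symmetric] powr_powr)
    then show "(2 powr real_of_int (j - int n)) powr e = (2 powr real_of_int j) powr e * (2 powr (- e)) ^ n"
      by (simp add: powr_powr powr_add[symmetric] algebra_simps)
  qed
  also have "\<dots> = ennreal ((2 powr real_of_int j) powr e * (1 / (1 - 2 powr (- e))))"
    using q by (intro suminf_ennreal_eq sums_mult geometric_sums) auto
  also have "\<dots> \<le> ennreal (y powr e / (1 - 2 powr (- e)))"
  proof (rule ennreal_leI)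
    have "2 powr real_of_int j < y" by (simp add: iff)
    then have "(2 powr real_of_int j) powr e \<le> y powr e" using e by (intro powr_mono2) auto
    then have "(2 powr real_of_int j) powr e * (1 / (1 - 2 powr (- e))) \<le> y powr e * (1 / (1 - 2 powr (- e)))"
      using q by (intro mult_right_mono) auto
    then show "(2 powr real_of_int j) powr e * (1 / (1 - 2 powr (- e))) \<le> y powr e / (1 - 2 powr (- e))" by simp
  qed
  finally show ?thesis .
qed

text \<open>If no superlevel set were large, summing the layers would give an average of at most \<open>t\<close>.\<close>
lemma large_superlevel_set:
  fixes f :: "real ^ 'n \<Rightarrow> real"
  assumes f [measurable]: "f \<in> borel_measurable lebesgue" and Q: "cube Q" and t: "0 < t"
    and avg: "ennreal t * emeasure lebesgue Q < (\<integral>\<^sup>+x\<in>Q. ennreal (f x) \<partial>lebesgue)"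
    and \<delta>: "0 < \<delta>" and c: "0 < c" "c \<le> (1 - 2 powr (- \<delta>)) / 2"
  shows "\<exists>m::nat. ennreal (c * 2 powr (- ((1 + \<delta>) * real m))) * emeasure lebesgue Q
    \<le> emeasure lebesgue {x\<in>Q. 2 powr (real m - 1) * t < f x}"
proof (rule ccontr)
  assume "\<not> ?thesis"
  then have n: "emeasure lebesgue {x\<in>Q. 2 powr (real m - 1) * t < f x}
      \<le> ennreal (c * 2 powr (- ((1 + \<delta>) * real m))) * emeasure lebesgue Q" for m :: nat
    by (meson less_imp_le not_le)
  have Qs [measurable]: "Q \<in> sets lebesgue" using Q by (rule cube_lebesgue)
  obtain v where v: "emeasure lebesgue Q = ennreal v" "v > 0" using cube_emeasure[OF Q] by blast
  define X where "X = (\<lambda>m::nat. {x\<in>Q. 2 powr (real m - 1) * t < f x})"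
  have Xs [measurable]: "X m \<in> sets lebesgue" for m unfolding X_def using Qs f by (rule measurable_subset_level(3))
  have q: "0 < (2::real) powr (- \<delta>)" "(2::real) powr (- \<delta>) < 1" using \<delta> by (auto simp: powr_minus_divide)
  have pt: "ennreal (f x) * indicator Q x \<le> ennreal (t / 2) * indicator Q x + (\<Sum>m. ennreal (2 powr real m * t) * indicator (X m) x)" for x
  proof (cases "x \<in> Q \<and> t / 2 < f x")
    case True
    then have fx: "0 < f x" using t by linarith
    \<comment> \<open>\<open>nat\<close> cuts off at \<open>0\<close>. Since
      \<open>f x > t / 2\<close>, the logarithm exceeds \<open>-1\<close>, so
      \<open>real m - 1\<close> stays below it in that case too.\<close>
    define m where "m = nat (\<lceil>log 2 (f x / t)\<rceil>)"
    have "log 2 (1 / 2) < log 2 (f x / t)" using True t fx by (subst log_less_cancel_iff) (auto simp: field_simps)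
    then have l: "- 1 < log 2 (f x / t)" by (simp add: log_divide)
    then have m: "log 2 (f x / t) \<le> real m" "real m - 1 < log 2 (f x / t)"
      unfolding m_def by linarith+
    have "2 powr (real m - 1) < 2 powr (log 2 (f x / t))" "2 powr (log 2 (f x / t)) \<le> 2 powr real m"
      using m by (auto intro: powr_less_mono)
    then have "2 powr (real m - 1) * t < f x" "f x \<le> 2 powr real m * t" using t fx by (auto simp: field_simps)
    then have "ennreal (f x) * indicator Q x \<le> ennreal (2 powr real m * t) * indicator (X m) x"
      using True by (simp add: X_def ennreal_leI)
    also have "\<dots> \<le> (\<Sum>m. ennreal (2 powr real m * t) * indicator (X m) x)"
    proof -
      define g where "g = (\<lambda>m. ennreal (2 powr real m * t) * indicator (X m) x)"
      have "sum g {m} \<le> suminf g" by (rule sum_le_suminf) auto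
      then have "g m \<le> suminf g" by simp
      then show ?thesis unfolding g_def .
    qed
    finally show ?thesis by (simp add: add_increasing)
  next
    case False
    then have "ennreal (f x) * indicator Q x \<le> ennreal (t / 2) * indicator Q x"
      by (auto simp: indicator_def intro!: ennreal_leI)
    then show ?thesis by (simp add: add_increasing2)
  qed
  have "(\<integral>\<^sup>+x\<in>Q. ennreal (f x) \<partial>lebesgue)
      \<le> (\<integral>\<^sup>+x. (ennreal (t / 2) * indicator Q x + (\<Sum>m. ennreal (2 powr real m * t) * indicator (X m) x)) \<partial>lebesgue)"
    using pt by (rule nn_integral_mono)
  also have "\<dots> = ennreal (t / 2) * emeasure lebesgue Q + (\<Sum>m. ennreal (2 powr real m * t) * emeasure lebesgue (X m))"
    by (subst nn_integral_add) (auto simp: nn_integral_suminf nn_integral_cmult_indicator)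
  also have "\<dots> \<le> ennreal (t / 2) * ennreal v + (\<Sum>m. ennreal ((t * c * v) * (2 powr (- \<delta>)) ^ m))"
  proof (intro add_mono suminf_le)
    fix m
    have "ennreal (2 powr real m * t) * emeasure lebesgue (X m)
        \<le> ennreal (2 powr real m * t) * (ennreal (c * 2 powr (- ((1 + \<delta>) * real m))) * ennreal v)"
      using n[of m] v by (intro mult_left_mono) (auto simp: X_def)
    also have "\<dots> = ennreal ((2 powr real m * t) * (c * 2 powr (- ((1 + \<delta>) * real m)) * v))"
      using t c v by (simp add: ennreal_mult[symmetric])
    also have "(2 powr real m * t) * (c * 2 powr (- ((1 + \<delta>) * real m)) * v) = (t * c * v) * (2 powr (- \<delta>)) ^ m"
    proof -
      have "2 powr real m * 2 powr (- ((1 + \<delta>) * real m)) = (2 powr (- \<delta>)) ^ m"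
        by (simp add: powr_realpow[symmetric] powr_powr powr_add[symmetric] algebra_simps)
      moreover have "(2 powr real m * t) * (c * 2 powr (- ((1 + \<delta>) * real m)) * v)
          = (t * c * v) * (2 powr real m * 2 powr (- ((1 + \<delta>) * real m)))" by (simp only: mult_ac)
      ultimately show ?thesis by (simp only:)
    qed
    finally show "ennreal (2 powr real m * t) * emeasure lebesgue (X m) \<le> ennreal ((t * c * v) * (2 powr (- \<delta>)) ^ m)" .
  qed (auto simp: v)
  also have "(\<Sum>m. ennreal ((t * c * v) * (2 powr (- \<delta>)) ^ m)) = ennreal ((t * c * v) * (1 / (1 - 2 powr (- \<delta>))))"
    using q t c v by (intro suminf_ennreal_eq sums_mult geometric_sums) auto
  also have "ennreal (t / 2) * ennreal v + \<dots> \<le> ennreal (t / 2 * v) + ennreal (t / 2 * v)"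
  proof (intro add_mono ennreal_leI)
    have "c / (1 - 2 powr (- \<delta>)) \<le> 1 / 2" using c q by (simp add: field_simps)
    then have "(t * v) * (c / (1 - 2 powr (- \<delta>))) \<le> (t * v) * (1 / 2)" using t v by (intro mult_left_mono) auto
    then show "(t * c * v) * (1 / (1 - 2 powr (- \<delta>))) \<le> t / 2 * v" by (simp add: mult_ac)
  qed (use t v in \<open>simp add: ennreal_mult[symmetric]\<close>)
  also have "\<dots> = ennreal t * emeasure lebesgue Q"
    using t v by (simp add: ennreal_mult[symmetric] ennreal_plus[symmetric] del: ennreal_plus)
  finally show False using avg by simp
qed

context exponent begin

text \<open>Let \<open>l\<close> be the proportion of \<open>E\<close> and \<open>t\<close> the
  lower level. For \<open>\<alpha> < 1\<close> the estimate at small levels applies and needs the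
  exceptional set; for \<open>\<alpha> \<ge> 1\<close> and \<open>l * \<alpha> \<ge> 1\<close> the
  one at large levels applies; in between, \<open>t\<close> is so small that
  \<open>p \<ge> a > 1\<close> suffices. Since \<open>l\<close> is smaller than
  \<open>2 powr (- real m)\<close> by the factor \<open>2 powr (- (\<delta> * real m))\<close>, each
  regime has to pay for the mismatch.\<close>

lemma level_estimate:
  assumes A: "A_condition p" and S: "S_infty_condition p"
  obtains c \<delta> \<theta> K e :: real where "0 < c" "0 < \<delta>" "c \<le> (1 - 2 powr (- \<delta>)) / 2" "0 < \<theta>" "0 < K" "0 < e"
    "\<And>(s :: 'n \<Rightarrow> bool) (m :: nat) \<alpha>. 0 < \<alpha> \<Longrightarrow> \<exists>U\<in>sets lebesgue.
      pmass U (2 powr (1 - real m) * \<alpha>) \<le> ennreal (K * 2 powr (- (\<theta> * real m))) * ennreal (if \<alpha> < 1 then \<alpha> powr e else 0) \<and>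
      (\<forall>Q E. Q \<in> grid s \<longrightarrow> E \<in> sets lebesgue \<longrightarrow> E \<subseteq> Q \<longrightarrow>
        emeasure lebesgue E = ennreal (c * 2 powr (- ((1 + \<delta>) * real m))) * emeasure lebesgue Q \<longrightarrow> pmass E \<alpha> \<le> 1 \<longrightarrow>
        pmass (Q - U) (2 powr (1 - real m) * \<alpha>) \<le> ennreal (K * 2 powr (- (\<theta> * real m))) * pmass E \<alpha>)"
proof -
  obtain CL \<eta> where CL: "0 < CL" and \<eta>: "0 < \<eta>" and L:
    "\<forall>(s :: 'n \<Rightarrow> bool) Q E \<alpha> l. Q \<in> grid s \<longrightarrow> E \<in> sets lebesgue \<longrightarrow> E \<subseteq> Q \<longrightarrow>
    emeasure lebesgue E = ennreal l * emeasure lebesgue Q \<longrightarrow> 0 < l \<longrightarrow> 0 < \<alpha> \<longrightarrow> 1 \<le> l * \<alpha> \<longrightarrow> pmass E \<alpha> \<le> 1 \<longrightarrow>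
    pmass Q (l * \<alpha>) \<le> ennreal (CL * l powr \<eta>) * pmass E \<alpha>"
    using A_condition_imp_large_levels[OF A] by auto
  obtain r s0 C where SW: "S_infty_with r s0 C" using S_infty_conditionD[OF S] by blast
  have r: "1 < r" and s0: "0 < s0" "s0 < 1" using SW by (auto simp: S_infty_with_def)
  obtain \<epsilon> CS where \<epsilon>: "0 < \<epsilon>" "1 + \<epsilon> < r" and CS: "0 < CS" and small:
    "\<forall>(s :: 'n \<Rightarrow> bool) l \<alpha>. 0 < l \<longrightarrow> l < s0 \<longrightarrow> 0 < \<alpha> \<longrightarrow> \<alpha> < 1 \<longrightarrow>
    (\<exists>U\<in>sets lebesgue. pmass U (l powr (1 / r) * \<alpha> powr (1 / (1 + \<epsilon>))) \<le> ennreal CS \<and>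
      (\<forall>Q E. Q \<in> grid s \<longrightarrow> E \<in> sets lebesgue \<longrightarrow> E \<subseteq> Q \<longrightarrow> ennreal (2 * l) * emeasure lebesgue Q \<le> emeasure lebesgue E \<longrightarrow>
        pmass (Q - U) (l powr ((1 + \<epsilon>) / r) * \<alpha>) \<le> ennreal CS * pmass E \<alpha>))"
    using S_infty_imp_small_levels[OF SW] by auto
  define r1 where "r1 = r / (1 + \<epsilon>)"
  have r1: "1 < r1" "r1 \<le> r" using \<epsilon> r by (auto simp: r1_def field_simps)
  \<comment> \<open>At most half of what each regime can afford: \<open>\<delta> * b\<close> against
    \<open>\<eta>\<close>, \<open>\<delta> * (1 + b)\<close> against \<open>a - 1\<close>, and
    \<open>\<delta>\<close> against \<open>r1 - 1\<close>. The exponent \<open>\<theta>\<close>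
    below is the least of the gains that survive.\<close>
  define \<delta> where "\<delta> = min (\<eta> / (2 * b)) (min ((a - 1) / (2 * (1 + b))) ((r1 - 1) / 2))"
  have \<delta>0: "0 < \<delta>" using \<eta> a1 b1 r1 by (auto simp: \<delta>_def)
  have "\<delta> \<le> \<eta> / (2 * b)" "\<delta> \<le> (a - 1) / (2 * (1 + b))" "\<delta> \<le> (r1 - 1) / 2"
    unfolding \<delta>_def by (meson min.cobounded1 min.cobounded2 order_trans)+
  then have \<delta>: "\<delta> * b \<le> \<eta> / 2" "\<delta> * (1 + b) \<le> (a - 1) / 2" "\<delta> \<le> (r1 - 1) / 2"
    using b1 by (auto simp: field_simps)
  define \<theta>3 where "\<theta>3 = 1 - (1 + \<delta>) / r1"
  have \<theta>3: "0 < \<theta>3" using \<delta>(3) r1 by (simp add: \<theta>3_def field_simps)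
  define \<theta> where "\<theta> = min (\<eta> - \<delta> * b) (min (a - 1 - \<delta> * (1 + b)) \<theta>3)"
  have \<theta>0: "0 < \<theta>" using \<delta> \<eta> a1 \<theta>3 by (auto simp: \<theta>_def)
  have \<theta>: "\<theta> \<le> \<eta> - \<delta> * b" "\<theta> \<le> a - 1 - \<delta> * (1 + b)" "\<theta> \<le> \<theta>3"
    unfolding \<theta>_def by (meson min.cobounded1 min.cobounded2 order_trans)+
  have q: "0 < (2::real) powr (- \<delta>)" "(2::real) powr (- \<delta>) < 1" using \<delta>0 by (auto simp: powr_minus_divide)
  define c where "c = min s0 ((1 - 2 powr (- \<delta>)) / 2)"
  have c: "0 < c" "c \<le> s0" "c \<le> (1 - 2 powr (- \<delta>)) / 2" "c < 1" using s0 q by (auto simp: c_def min_def)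
  define K where "K = (4 / c) powr b * CS + (2 / c) powr b * CL + (2 / c) powr b * 2 powr a / c"
  have K1: "(4 / c) powr b * CS \<le> K" "(2 / c) powr b * CL \<le> K" "(2 / c) powr b * 2 powr a / c \<le> K"
    using c CS CL by (auto simp: K_def)
  have K: "0 < K" using K1(1) c CS by (smt (verit, best) mult_pos_pos powr_gt_zero divide_pos_pos)
  define e where "e = \<epsilon> / (1 + \<epsilon>)"
  have e: "0 < e" using \<epsilon> by (simp add: e_def)
  have main: "\<exists>U\<in>sets lebesgue.
      pmass U (2 powr (1 - real m) * \<alpha>) \<le> ennreal (K * 2 powr (- (\<theta> * real m))) * ennreal (if \<alpha> < 1 then \<alpha> powr e else 0) \<and>
      (\<forall>Q E. Q \<in> grid s \<longrightarrow> E \<in> sets lebesgue \<longrightarrow> E \<subseteq> Q \<longrightarrow>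
        emeasure lebesgue E = ennreal (c * 2 powr (- ((1 + \<delta>) * real m))) * emeasure lebesgue Q \<longrightarrow> pmass E \<alpha> \<le> 1 \<longrightarrow>
        pmass (Q - U) (2 powr (1 - real m) * \<alpha>) \<le> ennreal (K * 2 powr (- (\<theta> * real m))) * pmass E \<alpha>)"
    if \<alpha>: "0 < \<alpha>" for s :: "'n \<Rightarrow> bool" and m :: nat and \<alpha> :: real
  proof -
    define l where "l = c * 2 powr (- ((1 + \<delta>) * real m))"
    define t where "t = 2 powr (1 - real m) * \<alpha>"
    have t: "0 < t" using \<alpha> by (simp add: t_def)
    have "2 powr (- ((1 + \<delta>) * real m)) \<le> (2::real) powr 0" using \<delta>0 by (intro powr_mono) auto
    then have l: "0 < l" "l \<le> c" using c mult_left_mono[of "2 powr (- ((1 + \<delta>) * real m))" 1 c] by (auto simp: l_def)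
    define y where "y = 2 powr (- (\<theta> * real m))"
    have y: "0 < y" "y \<le> 1" using \<theta>0 powr_mono[of "- (\<theta> * real m)" 0 2] by (auto simp: y_def)
    show ?thesis
    proof (cases "\<alpha> < 1")
      case True
      \<comment> \<open>The estimate at small levels asks for a proportion of at least twice its
        parameter.\<close>
      define h where "h = l / 2"
      have h: "0 < h" "h < s0" using l c s0 by (auto simp: h_def)
      obtain U where U [measurable]: "U \<in> sets lebesgue" and U1: "pmass U (h powr (1 / r) * \<alpha> powr (1 / (1 + \<epsilon>))) \<le> ennreal CS"
        and U2: "\<forall>Q E. Q \<in> grid s \<longrightarrow> E \<in> sets lebesgue \<longrightarrow> E \<subseteq> Q \<longrightarrow> ennreal (2 * h) * emeasure lebesgue Q \<le> emeasure lebesgue E \<longrightarrow>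
        pmass (Q - U) (h powr ((1 + \<epsilon>) / r) * \<alpha>) \<le> ennreal CS * pmass E \<alpha>"
        using small[rule_format, OF h \<alpha> True, of s] by blast
      \<comment> \<open>Because \<open>(1 + \<delta>) / r1 \<le> 1 - \<theta>\<close>, the root
        \<open>h powr (1 / r1)\<close> decays more slowly than \<open>2 powr (- real m)\<close>, and
        the difference leaves the factor \<open>y\<close>.\<close>
      have hr: "2 powr (1 - real m) \<le> 4 / c * y * h powr (1 / r1)"
      proof -
        have "(c / 2) powr 1 \<le> (c / 2) powr (1 / r1)" using c r1 by (intro powr_mono') auto
        moreover have "2 powr (- real m + \<theta> * real m) \<le> 2 powr (- ((1 + \<delta>) * real m) * (1 / r1))"
        proof (rule powr_mono)
          have "(1 + \<delta>) / r1 \<le> 1 - \<theta>" using \<theta>(3) by (simp add: \<theta>3_def)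
          then have "(1 + \<delta>) / r1 * real m \<le> (1 - \<theta>) * real m" by (intro mult_right_mono) auto
          then show "- real m + \<theta> * real m \<le> - ((1 + \<delta>) * real m) * (1 / r1)" by (simp add: algebra_simps add_divide_distrib)
        qed simp
        ultimately have "(c / 2) powr 1 * 2 powr (- real m + \<theta> * real m) \<le> (c / 2) powr (1 / r1) * 2 powr (- ((1 + \<delta>) * real m) * (1 / r1))"
          using c by (intro mult_mono) auto
        also have "\<dots> = h powr (1 / r1)" using c by (simp add: h_def l_def powr_mult powr_divide powr_powr)
        finally have "c / 2 * 2 powr (- real m + \<theta> * real m) \<le> h powr (1 / r1)" using c by simp
        then have "4 / c * y * (c / 2 * 2 powr (- real m + \<theta> * real m)) \<le> 4 / c * y * h powr (1 / r1)"
          using c y by (intro mult_left_mono) auto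
        moreover have "4 / c * y * (c / 2 * 2 powr (- real m + \<theta> * real m)) = 2 * (y * 2 powr (- real m + \<theta> * real m))"
          using c by simp
        moreover have "y * 2 powr (- real m + \<theta> * real m) = 2 powr (- real m)"
          by (simp add: y_def powr_add[symmetric])
        moreover have "2 powr (1 - real m) = 2 * 2 powr (- real m)" by (simp add: powr_diff powr_minus_divide)
        ultimately show ?thesis by simp
      qed
      have "h powr (1 / r1) \<le> h powr (1 / r)" using h s0 r1 by (intro powr_mono') (auto intro!: divide_left_mono)
      then have "4 / c * y * h powr (1 / r1) \<le> 4 / c * y * h powr (1 / r)" using c y by (intro mult_left_mono) auto
      then have hr': "2 powr (1 - real m) \<le> 4 / c * y * h powr (1 / r)" using hr by simp
      have c4: "1 \<le> 4 / c" using c by simp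
      \<comment> \<open>The exceptional set is controlled at a level proportional to
        \<open>\<beta>\<close>, which exceeds \<open>\<alpha>\<close> by
        \<open>\<alpha> powr (- e)\<close>; descending from there produces the summable factor
        \<open>\<alpha> powr e\<close>.\<close>
      define \<beta> where "\<beta> = \<alpha> powr (1 / (1 + \<epsilon>))"
      have \<beta>: "0 < \<beta>" "\<alpha> = \<alpha> powr e * \<beta>"
      proof -
        have "e + 1 / (1 + \<epsilon>) = 1" using \<epsilon> by (simp add: e_def add_divide_distrib[symmetric])
        then show "\<alpha> = \<alpha> powr e * \<beta>" using \<alpha> by (simp add: \<beta>_def powr_add[symmetric])
      qed (use \<alpha> in \<open>simp add: \<beta>_def\<close>)
      have \<alpha>e: "0 < \<alpha> powr e" "\<alpha> powr e \<le> 1" using \<alpha> True e by (auto intro!: powr_le1)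
      have ye: "0 \<le> y * \<alpha> powr e" "y * \<alpha> powr e \<le> 1" using y \<alpha>e mult_le_one[of y "\<alpha> powr e"] by auto
      have "pmass U t \<le> pmass U (4 / c * ((y * \<alpha> powr e) * (h powr (1 / r) * \<beta>)))"
      proof (rule pmass_mono)
        have "t \<le> (4 / c * y * h powr (1 / r)) * \<alpha>" unfolding t_def using hr' \<alpha> by (intro mult_right_mono) auto
        also have "\<dots> = (4 / c * y * h powr (1 / r)) * (\<alpha> powr e * \<beta>)" using \<beta>(2) by simp
        finally show "t \<le> 4 / c * ((y * \<alpha> powr e) * (h powr (1 / r) * \<beta>))" by (simp only: mult_ac)
      qed (use t in auto)
      also have "\<dots> \<le> ennreal ((4 / c) powr b) * pmass U ((y * \<alpha> powr e) * (h powr (1 / r) * \<beta>))"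
        using c4 ye \<beta> by (intro pmass_scale_up) auto
      also have "\<dots> \<le> ennreal ((4 / c) powr b) * (ennreal (y * \<alpha> powr e) * pmass U (h powr (1 / r) * \<beta>))"
        using ye \<beta> by (intro mult_left_mono pmass_scale_down) auto
      also have "\<dots> \<le> ennreal ((4 / c) powr b) * (ennreal (y * \<alpha> powr e) * ennreal CS)"
        using U1 by (intro mult_left_mono) (auto simp: \<beta>_def)
      also have "\<dots> = ennreal ((4 / c) powr b * CS * y * \<alpha> powr e)"
        using CS y by (simp add: ennreal_mult[symmetric] mult_ac)
      also have "\<dots> \<le> ennreal (K * y * \<alpha> powr e)"
        using K1(1) y by (intro ennreal_leI mult_right_mono) auto
      also have "\<dots> = ennreal (K * y) * ennreal (\<alpha> powr e)" using K y by (intro ennreal_mult) auto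
      finally have P1: "pmass U t \<le> ennreal (K * y) * ennreal (if \<alpha> < 1 then \<alpha> powr e else 0)" using True by simp
      have P2: "pmass (Q - U) t \<le> ennreal (K * y) * pmass E \<alpha>"
        if Q: "Q \<in> grid s" and E: "E \<in> sets lebesgue" "E \<subseteq> Q" "emeasure lebesgue E = ennreal l * emeasure lebesgue Q" for Q E
      proof -
        have Qs [measurable]: "Q \<in> sets lebesgue" using Q by (rule grid_sets)
        have "pmass (Q - U) t \<le> pmass (Q - U) (4 / c * (y * (h powr (1 / r1) * \<alpha>)))"
        proof (rule pmass_mono)
          have "t \<le> (4 / c * y * h powr (1 / r1)) * \<alpha>" unfolding t_def using hr \<alpha> by (intro mult_right_mono) auto
          then show "t \<le> 4 / c * (y * (h powr (1 / r1) * \<alpha>))" by (simp only: mult_ac)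
        qed (use t in auto)
        also have "\<dots> \<le> ennreal ((4 / c) powr b) * pmass (Q - U) (y * (h powr (1 / r1) * \<alpha>))"
          using c4 y \<alpha> by (intro pmass_scale_up) auto
        also have "\<dots> \<le> ennreal ((4 / c) powr b) * (ennreal y * pmass (Q - U) (h powr (1 / r1) * \<alpha>))"
          using y \<alpha> by (intro mult_left_mono pmass_scale_down) auto
        also have "\<dots> \<le> ennreal ((4 / c) powr b) * (ennreal y * (ennreal CS * pmass E \<alpha>))"
        proof -
          have "1 / r1 = (1 + \<epsilon>) / r" by (simp add: r1_def)
          then show ?thesis using U2[rule_format, OF Q E(1,2)] E(3) by (intro mult_left_mono) (auto simp: h_def)
        qed
        also have "\<dots> = ennreal ((4 / c) powr b * CS * y) * pmass E \<alpha>"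
          using CS y by (simp add: ennreal_mult mult_ac)
        also have "\<dots> \<le> ennreal (K * y) * pmass E \<alpha>"
          using K1(1) y by (intro ennreal_leI mult_right_mono) auto
        finally show ?thesis .
      qed
      show ?thesis
        unfolding l_def[symmetric] t_def[symmetric] y_def[symmetric] using P1 P2 U by blast
    next
      case False
      have P: "pmass Q t \<le> ennreal (K * y) * pmass E \<alpha>"
        if Q: "Q \<in> grid s" and E [measurable]: "E \<in> sets lebesgue" and EQ: "E \<subseteq> Q"
          and El: "emeasure lebesgue E = ennreal l * emeasure lebesgue Q" and le1: "pmass E \<alpha> \<le> 1" for Q E
      proof -
        have Qs [measurable]: "Q \<in> sets lebesgue" using Q by (rule grid_sets)
        \<comment> \<open>The mismatch factor in \<open>t = T * (l * \<alpha>)\<close>. It grows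
          only like \<open>2 powr (\<delta> * real m)\<close>, and its power \<open>b\<close> is the
          loss that \<open>\<delta>\<close> was chosen to absorb.\<close>
        define T where "T = 2 / c * 2 powr (\<delta> * real m)"
        have "1 \<le> (2::real) powr (\<delta> * real m)" using \<delta>0 by (intro ge_one_powr_ge_zero) auto
        moreover have c2: "1 \<le> 2 / c" using c by simp
        ultimately have T1: "1 \<le> T" using mult_mono[of 1 "2 / c" 1 "2 powr (\<delta> * real m)"] c(1) by (simp add: T_def)
        have tT: "t = T * (l * \<alpha>)"
        proof -
          have "2 powr (\<delta> * real m) * 2 powr (- ((1 + \<delta>) * real m)) = 2 powr (- real m)"
            by (simp add: powr_add[symmetric] algebra_simps)
          moreover have "T * l = 2 * (2 powr (\<delta> * real m) * 2 powr (- ((1 + \<delta>) * real m)))"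
            using c by (simp add: T_def l_def)
          moreover have "2 powr (1 - real m) = 2 * 2 powr (- real m)" by (simp add: powr_diff powr_minus_divide)
          ultimately have "2 powr (1 - real m) = T * l" by simp
          then show ?thesis by (simp add: t_def)
        qed
        have Tb: "T powr b = (2 / c) powr b * 2 powr (\<delta> * b * real m)"
        proof -
          have "T powr b = (2 / c) powr b * (2 powr (\<delta> * real m)) powr b" unfolding T_def by (rule powr_mult)
          then show ?thesis by (simp add: powr_powr mult_ac)
        qed
        show ?thesis
        proof (cases "1 \<le> l * \<alpha>")
          case True
          have "pmass Q t \<le> ennreal (T powr b) * pmass Q (l * \<alpha>)"
            unfolding tT using T1 l \<alpha> by (intro pmass_scale_up) auto
          also have "\<dots> \<le> ennreal (T powr b) * (ennreal (CL * l powr \<eta>) * pmass E \<alpha>)"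
            using L[rule_format, OF Q E EQ El l(1) \<alpha> True le1] by (rule mult_left_mono) simp
          also have "\<dots> = ennreal (T powr b * (CL * l powr \<eta>)) * pmass E \<alpha>"
            using CL by (simp add: ennreal_mult mult.assoc)
          also have "\<dots> \<le> ennreal (K * y) * pmass E \<alpha>"
          proof (intro mult_right_mono ennreal_leI)
            have "l powr \<eta> = c powr \<eta> * 2 powr (- ((1 + \<delta>) * real m) * \<eta>)"
              using c by (simp add: l_def powr_mult powr_powr)
            also have "\<dots> \<le> 1 * 2 powr (- (\<eta> * real m))"
            proof (intro mult_mono powr_mono)
              show "c powr \<eta> \<le> 1" using c \<eta> by (intro powr_le1) auto
              have "0 \<le> \<delta> * real m * \<eta>" using \<delta>0 \<eta> by simp
              then show "- ((1 + \<delta>) * real m) * \<eta> \<le> - (\<eta> * real m)" by (simp add: algebra_simps)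
            qed auto
            finally have l\<eta>: "l powr \<eta> \<le> 2 powr (- (\<eta> * real m))" by simp
            have "T powr b * (CL * l powr \<eta>) \<le> T powr b * (CL * 2 powr (- (\<eta> * real m)))"
              using l\<eta> CL by (intro mult_left_mono) auto
            also have "\<dots> = (2 / c) powr b * CL * (2 powr (\<delta> * b * real m) * 2 powr (- (\<eta> * real m)))"
              by (simp add: Tb mult_ac)
            also have "2 powr (\<delta> * b * real m) * 2 powr (- (\<eta> * real m)) = (2::real) powr (\<delta> * b * real m - \<eta> * real m)"
              by (simp add: powr_add[symmetric])
            also have "(2 / c) powr b * CL * \<dots> \<le> K * y"
            proof (rule mult_mono[OF K1(2)])
              have "\<theta> * real m \<le> (\<eta> - \<delta> * b) * real m" using \<theta>(1) by (intro mult_right_mono) auto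
              then show "2 powr (\<delta> * b * real m - \<eta> * real m) \<le> y"
                unfolding y_def by (intro powr_mono) (auto simp: algebra_simps)
            qed (use K in auto)
            finally show "T powr b * (CL * l powr \<eta>) \<le> K * y" .
          qed simp
          finally show ?thesis .
        next
          case Fl: False
          have tle: "t \<le> T" using Fl T1 l \<alpha> unfolding tT by (simp add: mult_le_cancel_left2)
          \<comment> \<open>Here \<open>t \<le> T\<close>, hence
            \<open>t powr p x \<le> t powr a * T powr b\<close>. Passing from \<open>Q\<close> to
            \<open>E\<close> costs \<open>1 / l\<close>, a multiple of
            \<open>2 powr ((1 + \<delta>) * real m)\<close>, while
            \<open>t powr a / \<alpha> powr a\<close> gains a multiple of
            \<open>2 powr (- (a * real m))\<close>; since \<open>a > 1\<close>, the gain
            wins.\<close>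
          have "pmass Q t \<le> ennreal (t powr a * T powr b) * emeasure lebesgue Q"
          proof (rule pmass_le_const[OF Qs])
            fix x
            have "t powr p x = t powr a * t powr (p x - a)" using t by (simp add: powr_add[symmetric])
            also have "t powr (p x - a) \<le> T powr (p x - a)" using t tle p_ge by (intro powr_mono2) auto
            also have "T powr (p x - a) \<le> T powr b" using T1 p_le[of x] a1 by (intro powr_mono) auto
            finally show "t powr p x \<le> t powr a * T powr b" by (simp add: mult_left_mono)
          qed
          also have "\<dots> = ennreal (t powr a * T powr b / l) * emeasure lebesgue E"
          proof -
            have "ennreal (t powr a * T powr b) = ennreal (t powr a * T powr b / l) * ennreal l"
              using l by (subst ennreal_mult[symmetric]) auto
            then show ?thesis unfolding El by (simp add: mult.assoc)
          qed
          also have "\<dots> = ennreal (t powr a * T powr b / l / \<alpha> powr a) * (ennreal (\<alpha> powr a) * emeasure lebesgue E)"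
          proof -
            have "ennreal (t powr a * T powr b / l) = ennreal (t powr a * T powr b / l / \<alpha> powr a) * ennreal (\<alpha> powr a)"
              using \<alpha> l by (subst ennreal_mult[symmetric]) auto
            then show ?thesis by (simp add: mult.assoc)
          qed
          also have "\<dots> \<le> ennreal (t powr a * T powr b / l / \<alpha> powr a) * pmass E \<alpha>"
            using False p_ge by (intro mult_left_mono pmass_subset_const_ge) (auto intro: powr_mono)
          also have "\<dots> \<le> ennreal (K * y) * pmass E \<alpha>"
          proof (intro mult_right_mono ennreal_leI)
            have "t powr a / \<alpha> powr a = 2 powr ((1 - real m) * a)" using \<alpha> by (simp add: t_def powr_mult powr_powr)
            also have "\<dots> = 2 powr a * 2 powr (- (a * real m))" by (simp add: powr_add[symmetric] algebra_simps)
            finally have 1: "t powr a / \<alpha> powr a = 2 powr a * 2 powr (- (a * real m))" .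
            have 2: "1 / l = (1 / c) * 2 powr ((1 + \<delta>) * real m)" by (simp add: l_def powr_minus_divide del: minus_mult_left)
            have "t powr a * T powr b / l / \<alpha> powr a = (t powr a / \<alpha> powr a) * T powr b * (1 / l)" by simp
            also have "\<dots> = ((2 / c) powr b * 2 powr a / c) * (2 powr (- (a * real m)) * 2 powr (\<delta> * b * real m) * 2 powr ((1 + \<delta>) * real m))"
              unfolding 1 2 Tb by simp
            also have "2 powr (- (a * real m)) * 2 powr (\<delta> * b * real m) * 2 powr ((1 + \<delta>) * real m)
              = (2::real) powr (- (a * real m) + \<delta> * b * real m + (1 + \<delta>) * real m)" by (simp only: powr_add)
            also have "((2 / c) powr b * 2 powr a / c) * \<dots> \<le> K * y"
            proof (rule mult_mono[OF K1(3)])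
              have "\<theta> * real m \<le> (a - 1 - \<delta> * (1 + b)) * real m" using \<theta>(2) by (intro mult_right_mono) auto
              then show "2 powr (- (a * real m) + \<delta> * b * real m + (1 + \<delta>) * real m) \<le> y"
                unfolding y_def by (intro powr_mono) (auto simp: algebra_simps)
            qed (use K in auto)
            finally show "t powr a * T powr b / l / \<alpha> powr a \<le> K * y" .
          qed simp
          finally show ?thesis .
        qed
      qed
      show ?thesis unfolding l_def[symmetric] t_def[symmetric] y_def[symmetric]
        by (rule bexI[of _ "{}"], use P in \<open>auto simp: pmass_def\<close>)
    qed
  qed
  show ?thesis by (rule that[OF c(1) \<delta>0 c(3) \<theta>0 K e main])
qed


text \<open>The superlevel set at height \<open>t\<close> of the maximal operator restricted to
  cubes of the grid \<open>s\<close>.\<close>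

definition level_set :: "('n \<Rightarrow> bool) \<Rightarrow> (real ^ 'n \<Rightarrow> real) \<Rightarrow> real \<Rightarrow> (real ^ 'n) set" where
  "level_set s f t = \<Union>{Q\<in>grid s. ennreal t * emeasure lebesgue Q < (\<integral>\<^sup>+x\<in>Q. ennreal (f x) \<partial>lebesgue)}"

lemma level_set_sets [measurable]: "level_set s f t \<in> sets lebesgue"
  unfolding level_set_def
  by (intro sets.countable_Union countable_subset[OF _ countable_grid[of s]]) (auto simp: grid_sets)

text \<open>Each cube of the level set with index \<open>k\<close> has some \<open>m\<close> for
  which the superlevel set with index \<open>i = k + int m - 1\<close> is large in it. The choice of
  \<open>m\<close> is not tracked; the sum of the bounds over all \<open>m\<close> dominates every
  cube. Replacing \<open>k\<close> by \<open>i\<close> separates the double sum into the geometric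
  series of \<open>w m\<close> and the sum of \<open>g i\<close>, which the layer cake formula and
  the factor \<open>z i powr e\<close> keep finite.\<close>

lemma level_set_summation:
  assumes A: "A_condition p" and S: "S_infty_condition p"
  shows "\<exists>C>0. \<forall>(s :: 'n \<Rightarrow> bool) f. f \<in> borel_measurable lebesgue \<longrightarrow> (\<forall>x. 0 \<le> f x) \<longrightarrow>
    (\<integral>\<^sup>+x. ennreal (f x powr p x) \<partial>lebesgue) \<le> 1 \<longrightarrow>
    (\<integral>\<^sup>+k. pmass (level_set s f (2 powr real_of_int k)) (2 powr real_of_int k) \<partial>count_space UNIV) \<le> ennreal C"
proof -
  obtain c \<delta> \<theta> K e :: real where c1: "0 < c" and \<delta>: "0 < \<delta>"
    and c2: "c \<le> (1 - 2 powr (- \<delta>)) / 2" and \<theta>: "0 < \<theta>" and K: "0 < K" and e: "0 < e"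
    and est: "\<And>(s :: 'n \<Rightarrow> bool) (m :: nat) \<alpha>. 0 < \<alpha> \<Longrightarrow> \<exists>U\<in>sets lebesgue.
      pmass U (2 powr (1 - real m) * \<alpha>) \<le> ennreal (K * 2 powr (- (\<theta> * real m))) * ennreal (if \<alpha> < 1 then \<alpha> powr e else 0) \<and>
      (\<forall>Q E. Q \<in> grid s \<longrightarrow> E \<in> sets lebesgue \<longrightarrow> E \<subseteq> Q \<longrightarrow>
        emeasure lebesgue E = ennreal (c * 2 powr (- ((1 + \<delta>) * real m))) * emeasure lebesgue Q \<longrightarrow> pmass E \<alpha> \<le> 1 \<longrightarrow>
        pmass (Q - U) (2 powr (1 - real m) * \<alpha>) \<le> ennreal (K * 2 powr (- (\<theta> * real m))) * pmass E \<alpha>)"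
    by (rule level_estimate[OF A S]) (rule that)
  note c = c1 c2
  have q\<theta>: "0 < (2::real) powr (- \<theta>)" "(2::real) powr (- \<theta>) < 1" using \<theta> by (auto simp: powr_minus_divide)
  have qe: "0 < (2::real) powr (- e)" "(2::real) powr (- e) < 1" using e by (auto simp: powr_minus_divide)
  define C0 where "C0 = 1 / (1 - 2 powr (- e)) + 2"
  have C0: "0 < C0" using qe by (simp add: C0_def add_pos_pos)
  define C where "C = K / (1 - 2 powr (- \<theta>)) * C0"
  have C: "0 < C" using K q\<theta> C0 by (simp add: C_def)
  have main: "(\<integral>\<^sup>+k. pmass (level_set s f (2 powr real_of_int k)) (2 powr real_of_int k) \<partial>count_space UNIV) \<le> ennreal C"
    if f [measurable]: "f \<in> borel_measurable lebesgue" and f0: "\<And>x. 0 \<le> f x"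
      and f1: "(\<integral>\<^sup>+x. ennreal (f x powr p x) \<partial>lebesgue) \<le> 1" for s :: "'n \<Rightarrow> bool" and f
  proof -
    define z where "z = (\<lambda>i::int. 2 powr real_of_int i)"
    have z0: "0 < z i" for i by (simp add: z_def)
    have zm: "2 powr (1 - real m) * z (k + int m - 1) = z k" for m k
      by (simp add: z_def powr_add[symmetric])
    have zm': "2 powr (real m - 1) * z k = z (k + int m - 1)" for m k
      by (simp add: z_def powr_add[symmetric] algebra_simps)
    define w where "w = (\<lambda>m::nat. K * 2 powr (- (\<theta> * real m)))"
    have w0: "0 < w m" for m using K by (simp add: w_def)
    define good where "good = (\<lambda>(m::nat) i U. U \<in> sets lebesgue \<and>
      pmass U (2 powr (1 - real m) * z i) \<le> ennreal (w m) * ennreal (if z i < 1 then z i powr e else 0) \<and>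
      (\<forall>Q E. Q \<in> grid s \<longrightarrow> E \<in> sets lebesgue \<longrightarrow> E \<subseteq> Q \<longrightarrow>
        emeasure lebesgue E = ennreal (c * 2 powr (- ((1 + \<delta>) * real m))) * emeasure lebesgue Q \<longrightarrow> pmass E (z i) \<le> 1 \<longrightarrow>
        pmass (Q - U) (2 powr (1 - real m) * z i) \<le> ennreal (w m) * pmass E (z i)))"
    define U where "U = (\<lambda>m i. SOME U. good m i U)"
    have good: "good m i (U m i)" for m i
    proof -
      have "\<exists>U. good m i U" using est[OF z0[of i], where s = s and m = m] unfolding good_def w_def by blast
      then show ?thesis unfolding U_def by (rule someI_ex)
    qed
    have U: "\<And>m i. U m i \<in> sets lebesgue"
      "\<And>m i. pmass (U m i) (2 powr (1 - real m) * z i) \<le> ennreal (w m) * ennreal (if z i < 1 then z i powr e else 0)"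
      "\<And>m i Q E. Q \<in> grid s \<Longrightarrow> E \<in> sets lebesgue \<Longrightarrow> E \<subseteq> Q \<Longrightarrow>
        emeasure lebesgue E = ennreal (c * 2 powr (- ((1 + \<delta>) * real m))) * emeasure lebesgue Q \<Longrightarrow> pmass E (z i) \<le> 1 \<Longrightarrow>
        pmass (Q - U m i) (2 powr (1 - real m) * z i) \<le> ennreal (w m) * pmass E (z i)"
      using good unfolding good_def by blast+
    note U(1) [measurable]
    define G where "G = (\<lambda>i. {x. z i < f x})"
    have Gs [measurable]: "G i \<in> sets lebesgue" for i
      using measurable_subset_level(3)[of UNIV f "z i"] by (simp add: G_def)
    \<comment> \<open>The single normalisation of \<open>f\<close> supplies the hypothesis
      \<open>pmass E \<alpha> \<le> 1\<close> of the level estimate at all levels at once.\<close>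
    have pG: "pmass E (z i) \<le> 1" if "E \<subseteq> G i" for E i
    proof -
      have "pmass E (z i) \<le> (\<integral>\<^sup>+x. ennreal (f x powr p x) \<partial>lebesgue)"
        unfolding pmass_def
        using that z0[of i] p_pos by (intro nn_integral_mono) (auto simp: indicator_def G_def intro!: ennreal_leI powr_mono2 dest: subsetD)
      then show ?thesis using f1 by (rule order_trans)
    qed
    \<comment> \<open>A density that does not depend on the cube: if \<open>m\<close> suits
      \<open>Q\<close>, the mass of \<open>Q\<close> at level \<open>z k\<close> is at most the
      integral of \<open>h m k\<close> over \<open>Q\<close>.\<close>
    define h where "h = (\<lambda>m k x. ennreal (z k powr p x) * indicator (U m (k + int m - 1)) x
      + ennreal (w m) * (ennreal (z (k + int m - 1) powr p x) * indicator (G (k + int m - 1)) x))"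
    have hm [measurable]: "h m k \<in> borel_measurable lebesgue" for m k unfolding h_def by measurable
    define g where "g = (\<lambda>i. ennreal (if z i < 1 then z i powr e else 0) + pmass (G i) (z i))"
    have hint: "(\<integral>\<^sup>+x. h m k x \<partial>lebesgue) \<le> ennreal (w m) * g (k + int m - 1)" for m k
    proof -
      have "(\<integral>\<^sup>+x. h m k x \<partial>lebesgue) = pmass (U m (k + int m - 1)) (z k) + ennreal (w m) * pmass (G (k + int m - 1)) (z (k + int m - 1))"
        unfolding h_def pmass_def by (subst nn_integral_add) (auto simp: nn_integral_cmult)
      also have "\<dots> \<le> ennreal (w m) * ennreal (if z (k + int m - 1) < 1 then z (k + int m - 1) powr e else 0)
          + ennreal (w m) * pmass (G (k + int m - 1)) (z (k + int m - 1))"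
        using U(2)[of m "k + int m - 1"] unfolding zm by (rule add_right_mono)
      finally show ?thesis by (simp add: g_def distrib_left)
    qed
    have lev: "pmass (level_set s f (z k)) (z k) \<le> (\<Sum>m. ennreal (w m) * g (k + int m - 1))" for k
    proof -
      define M where "M = density lebesgue (\<lambda>x. ennreal (z k powr p x))"
      have M: "emeasure M X = pmass X (z k)" if "X \<in> sets lebesgue" for X
        unfolding M_def pmass_def using that by (subst emeasure_density) auto
      define N where "N = density lebesgue (\<lambda>x. \<Sum>m. h m k x)"
      have N: "emeasure N X = (\<integral>\<^sup>+x\<in>X. (\<Sum>m. h m k x) \<partial>lebesgue)" if "X \<in> sets lebesgue" for X
        unfolding N_def using that by (subst emeasure_density) auto
      have NU: "emeasure N (space N) \<le> (\<Sum>m. ennreal (w m) * g (k + int m - 1))"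
      proof -
        have "emeasure N (space N) = (\<integral>\<^sup>+x. (\<Sum>m. h m k x) \<partial>lebesgue)" using N[of UNIV] by (simp add: N_def)
        also have "\<dots> = (\<Sum>m. \<integral>\<^sup>+x. h m k x \<partial>lebesgue)" by (rule nn_integral_suminf) simp
        also have "\<dots> \<le> (\<Sum>m. ennreal (w m) * g (k + int m - 1))" using hint by (intro suminf_le) auto
        finally show ?thesis .
      qed
      define \<G> where "\<G> = {Q\<in>grid s. ennreal (z k) * emeasure lebesgue Q < (\<integral>\<^sup>+x\<in>Q. ennreal (f x) \<partial>lebesgue)}"
      have each: "emeasure M Q \<le> emeasure N Q" if Q: "Q \<in> \<G>" for Q
      proof -
        have Qg: "Q \<in> grid s" using Q by (simp add: \<G>_def)
        have cQ: "cube Q" using Qg by (rule cube_grid)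
        have Qs [measurable]: "Q \<in> sets lebesgue" using Qg by (rule grid_sets)
        obtain m :: nat where "ennreal (c * 2 powr (- ((1 + \<delta>) * real m))) * emeasure lebesgue Q
            \<le> emeasure lebesgue {x\<in>Q. 2 powr (real m - 1) * z k < f x}"
          using large_superlevel_set[OF f cQ z0 _ \<delta> c] Q by (auto simp: \<G>_def)
        moreover define i where "i = k + int m - 1"
        moreover have "{x\<in>Q. 2 powr (real m - 1) * z k < f x} = Q \<inter> G i" unfolding zm' by (auto simp: G_def i_def)
        ultimately have m: "ennreal (c * 2 powr (- ((1 + \<delta>) * real m))) * emeasure lebesgue Q \<le> emeasure lebesgue (Q \<inter> G i)" by simp
        \<comment> \<open>The level estimate is stated for an exact proportion, so the superlevel
          set is trimmed.\<close>
        obtain E where E: "E \<subseteq> Q \<inter> G i" "E \<in> sets lebesgue"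
            "emeasure lebesgue E = ennreal (c * 2 powr (- ((1 + \<delta>) * real m))) * emeasure lebesgue Q"
          using subset_of_given_measure[OF _ cQ _ m] by auto
        have "pmass (Q - U m i) (z k) \<le> ennreal (w m) * pmass E (z i)"
          using U(3)[OF Qg E(2) _ E(3), of i] E(1) pG[of E i] zm[of m k] unfolding i_def by auto
        also have "\<dots> \<le> ennreal (w m) * pmass (Q \<inter> G i) (z i)"
          using E(1) z0[of i] by (intro mult_left_mono pmass_mono) auto
        finally have 1: "pmass (Q - U m i) (z k) \<le> ennreal (w m) * pmass (Q \<inter> G i) (z i)" .
        have "emeasure M Q = pmass (Q \<inter> U m i) (z k) + pmass (Q - U m i) (z k)"
          unfolding M[OF Qs] pmass_def
          by (subst nn_integral_add[symmetric]) (use U(1) in \<open>auto simp: indicator_def intro!: nn_integral_cong\<close>)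
        also have "\<dots> \<le> pmass (Q \<inter> U m i) (z k) + ennreal (w m) * pmass (Q \<inter> G i) (z i)" using 1 by (rule add_left_mono)
        also have "\<dots> = (\<integral>\<^sup>+x\<in>Q. h m k x \<partial>lebesgue)"
          unfolding pmass_def h_def i_def[symmetric]
          by (subst nn_integral_cmult[symmetric], measurable, subst nn_integral_add[symmetric], measurable)
            (auto simp: indicator_def intro!: nn_integral_cong)
        also have "\<dots> \<le> (\<integral>\<^sup>+x\<in>Q. (\<Sum>m. h m k x) \<partial>lebesgue)"
        proof (intro nn_integral_mono mult_right_mono)
          fix x
          have "sum (\<lambda>m. h m k x) {m} \<le> (\<Sum>m. h m k x)" by (rule sum_le_suminf) auto
          then show "h m k x \<le> (\<Sum>m. h m k x)" by (simp only: sum.insert finite.emptyI empty_iff sum.empty add_0_right not_False_eq_True)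
        qed simp
        also have "\<dots> = emeasure N Q" by (simp add: N)
        finally show ?thesis .
      qed
      have "emeasure M (\<Union>\<G>) \<le> emeasure N (space N)"
      proof (rule emeasure_grid_Union_le[of _ s])
        fix F assume F: "finite F" "F \<subseteq> \<G>" "disjoint F"
        have "(\<Sum>V\<in>F. emeasure M V) \<le> (\<Sum>V\<in>F. emeasure N V)" using F(2) each by (intro sum_mono) auto
        also have "\<dots> = emeasure N (\<Union>F)" using F by (intro sum_emeasure_disjoint) (auto simp: N_def \<G>_def grid_sets)
        also have "\<dots> \<le> emeasure N (space N)" by (rule emeasure_space)
        finally show "(\<Sum>V\<in>F. emeasure M V) \<le> emeasure N (space N)" .
      qed (auto simp: \<G>_def M_def)
      moreover have "\<Union>\<G> = level_set s f (z k)" by (simp add: level_set_def \<G>_def)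
      ultimately show ?thesis using M[OF level_set_sets] NU by (metis order_trans)
    qed
    have gsum: "(\<integral>\<^sup>+i. g i \<partial>count_space UNIV) \<le> ennreal C0"
    proof -
      have "(\<integral>\<^sup>+i. pmass (G i) (z i) \<partial>count_space UNIV) \<le> ennreal 2"
      proof -
        have "(\<integral>\<^sup>+i. pmass (G i) (z i) \<partial>count_space UNIV)
            = (\<integral>\<^sup>+x. \<integral>\<^sup>+i. ennreal (z i powr p x) * indicator (G i) x \<partial>count_space UNIV \<partial>lebesgue)"
          unfolding pmass_def by (rule nn_integral_count_space_nn_integral[symmetric]) auto
        also have "\<dots> \<le> (\<integral>\<^sup>+x. ennreal 2 * ennreal (f x powr p x) \<partial>lebesgue)"
        proof (rule nn_integral_mono)
          fix x
          show "(\<integral>\<^sup>+i. ennreal (z i powr p x) * indicator (G i) x \<partial>count_space UNIV) \<le> ennreal 2 * ennreal (f x powr p x)"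
          proof (cases "f x = 0")
            case True
            then have "indicator (G i) x = (0::ennreal)" for i using z0[of i] by (auto simp: G_def indicator_def)
            then show ?thesis by simp
          next
            case False
            then have fx: "0 < f x" using f0[of x] by linarith
            have "(\<integral>\<^sup>+i. ennreal (z i powr p x) * indicator (G i) x \<partial>count_space UNIV)
                = (\<integral>\<^sup>+i. ennreal (if 2 powr real_of_int i < f x then (2 powr real_of_int i) powr p x else 0) \<partial>count_space UNIV)"
              by (intro nn_integral_cong) (auto simp: G_def z_def indicator_def)
            also have "\<dots> \<le> ennreal (f x powr p x / (1 - 2 powr (- p x)))" using fx p_pos(1) by (rule int_geometric_sum)
            also have "\<dots> \<le> ennreal (2 * f x powr p x)"
            proof (rule ennreal_leI)
              have "2 powr (- p x) \<le> 2 powr (- 1)" using p_gt1[of x] by (intro powr_mono) auto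
              then have "1 / (1 - 2 powr (- p x)) \<le> 2" by (simp add: powr_minus_divide field_simps)
              then have "f x powr p x * (1 / (1 - 2 powr (- p x))) \<le> f x powr p x * 2" by (intro mult_left_mono) auto
              then show "f x powr p x / (1 - 2 powr (- p x)) \<le> 2 * f x powr p x" by simp
            qed
            finally show ?thesis by (simp add: ennreal_mult)
          qed
        qed
        also have "\<dots> = ennreal 2 * (\<integral>\<^sup>+x. ennreal (f x powr p x) \<partial>lebesgue)" by (rule nn_integral_cmult) simp
        also have "\<dots> \<le> ennreal 2 * 1" using f1 by (rule mult_left_mono) simp
        finally show ?thesis by simp
      qed
      moreover have "(\<integral>\<^sup>+i. ennreal (if z i < 1 then z i powr e else 0) \<partial>count_space UNIV) \<le> ennreal (1 / (1 - 2 powr (- e)))"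
        using int_geometric_sum[OF zero_less_one e] unfolding z_def powr_one_eq_one .
      moreover have "(\<integral>\<^sup>+i. g i \<partial>count_space UNIV)
          = (\<integral>\<^sup>+i. ennreal (if z i < 1 then z i powr e else 0) \<partial>count_space UNIV) + (\<integral>\<^sup>+i. pmass (G i) (z i) \<partial>count_space UNIV)"
        unfolding g_def by (rule nn_integral_add) auto
      ultimately have "(\<integral>\<^sup>+i. g i \<partial>count_space UNIV) \<le> ennreal (1 / (1 - 2 powr (- e))) + ennreal 2"
        by (simp only: add_mono)
      also have "\<dots> = ennreal C0" unfolding C0_def using qe by (intro ennreal_plus[symmetric]) auto
      finally show ?thesis .
    qed
    have "(\<integral>\<^sup>+k. pmass (level_set s f (z k)) (z k) \<partial>count_space UNIV)
        \<le> (\<integral>\<^sup>+k. (\<Sum>m. ennreal (w m) * g (k + int m - 1)) \<partial>count_space UNIV)"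
      using lev by (intro nn_integral_mono)
    also have "\<dots> = (\<Sum>m. \<integral>\<^sup>+k. ennreal (w m) * g (k + int m - 1) \<partial>count_space UNIV)"
      by (rule nn_integral_suminf) simp
    also have "\<dots> = (\<Sum>m. ennreal (w m) * (\<integral>\<^sup>+i. g i \<partial>count_space UNIV))"
    proof (intro arg_cong[where f = suminf] ext)
      fix m
      have bij: "bij_betw (\<lambda>k. k + int m - 1) UNIV (UNIV :: int set)"
        by (rule bij_betw_byWitness[where f' = "\<lambda>i. i - int m + 1"]) auto
      have "(\<integral>\<^sup>+k. ennreal (w m) * g (k + int m - 1) \<partial>count_space UNIV) = ennreal (w m) * (\<integral>\<^sup>+k. g (k + int m - 1) \<partial>count_space UNIV)"
        by (rule nn_integral_cmult) simp
      also have "(\<integral>\<^sup>+k. g (k + int m - 1) \<partial>count_space UNIV) = (\<integral>\<^sup>+i. g i \<partial>count_space UNIV)"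
        by (rule nn_integral_bij_count_space[OF bij])
      finally show "(\<integral>\<^sup>+k. ennreal (w m) * g (k + int m - 1) \<partial>count_space UNIV) = ennreal (w m) * (\<integral>\<^sup>+i. g i \<partial>count_space UNIV)" .
    qed
    also have "\<dots> = (\<Sum>m. ennreal (w m)) * (\<integral>\<^sup>+i. g i \<partial>count_space UNIV)" by simp
    also have "(\<Sum>m. ennreal (w m)) = ennreal (K * (1 / (1 - 2 powr (- \<theta>))))"
    proof -
      have "w = (\<lambda>m. K * (2 powr (- \<theta>)) ^ m)"
        by (simp add: w_def powr_realpow[symmetric] powr_powr fun_eq_iff)
      then show ?thesis using q\<theta> K by (simp only:, intro suminf_ennreal_eq sums_mult geometric_sums) auto
    qed
    also have "ennreal (K * (1 / (1 - 2 powr (- \<theta>)))) * (\<integral>\<^sup>+i. g i \<partial>count_space UNIV) \<le> ennreal (K * (1 / (1 - 2 powr (- \<theta>)))) * ennreal C0"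
      using gsum by (rule mult_left_mono) simp
    also have "\<dots> = ennreal C" unfolding C_def using K q\<theta> C0 by (simp add: ennreal_mult[symmetric])
    finally show ?thesis by (simp add: z_def)
  qed
  show ?thesis by (rule exI[of _ C], intro conjI C allI impI main) auto
qed

end

subsection \<open>The maximal operator\<close>

text \<open>Averages over slightly larger open cubes are almost as large, so superlevel sets of the
  maximal function are open although the cubes need not be.\<close>
lemma maximal_measurable [measurable]:
  fixes f :: "real ^ 'n \<Rightarrow> real"
  shows "maximal f \<in> borel_measurable lebesgue"
proof (rule borel_measurableI_greater)
  fix y :: ennreal
  have "open {x. y < maximal f x}"
  proof (subst open_subopen, intro ballI)
    fix x assume "x \<in> {x. y < maximal f x}"
    then obtain Q where Q: "cube Q" "x \<in> Q" "y < (\<integral>\<^sup>+z\<in>Q. ennreal \<bar>f z\<bar> \<partial>lebesgue) / emeasure lebesgue Q"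
      unfolding maximal_def by (auto simp: less_SUP_iff)
    define I where "I = (\<integral>\<^sup>+z\<in>Q. ennreal \<bar>f z\<bar> \<partial>lebesgue)"
    obtain a l where l: "0 < l" and sub: "box a (\<chi> i. a $ i + l) \<subseteq> Q" "Q \<subseteq> cbox a (\<chi> i. a $ i + l)"
      using cube_bounds[OF Q(1)] .
    have Ql: "emeasure lebesgue Q = ennreal (l ^ CARD('n))"
      using emeasure_mono[OF sub(1), of lebesgue] emeasure_mono[OF sub(2), of lebesgue] cube_lebesgue(1)[OF Q(1)]
      by (simp add: emeasure_box_side[OF l])
    have "y < \<infinity>" using Q(3) by (auto simp: less_top[symmetric])
    then obtain r where r: "y = ennreal r" "0 \<le> r" by (cases y) auto
    have "ennreal r * ennreal (l ^ CARD('n)) < I"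
    proof (rule ccontr)
      assume "\<not> ennreal r * ennreal (l ^ CARD('n)) < I"
      then have "I \<le> ennreal r * ennreal (l ^ CARD('n))" by simp
      then have "I / ennreal (l ^ CARD('n)) \<le> ennreal r"
        using l by (subst divide_le_posI_ennreal) (auto simp: mult.commute)
      then show False using Q(3) r(1) by (simp add: I_def Ql)
    qed
    then have "ennreal (r * l ^ CARD('n)) < I" using r l by (simp add: ennreal_mult)
    moreover have "(\<lambda>j. ennreal (r * (l + 2 * (1 / real (Suc j))) ^ CARD('n))) \<longlonglongrightarrow> ennreal (r * (l + 2 * 0) ^ CARD('n))"
      by (intro tendsto_ennrealI tendsto_intros LIMSEQ_Suc[OF lim_1_over_n])
    ultimately have "eventually (\<lambda>j. ennreal (r * (l + 2 * (1 / real (Suc j))) ^ CARD('n)) < I) sequentially"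
      by (intro order_tendstoD(2)) auto
    then obtain j where j: "ennreal (r * (l + 2 * (1 / real (Suc j))) ^ CARD('n)) < I"
      unfolding eventually_sequentially by blast
    define e where "e = 1 / real (Suc j)"
    have e: "0 < e" by (simp add: e_def)
    define L where "L = l + 2 * e"
    have L: "0 < L" using l e by (simp add: L_def)
    define a' where "a' = (\<chi> i. a $ i - e)"
    define R where "R = box a' (\<chi> i. a' $ i + L)"
    have R: "cube R" unfolding cube_def R_def
      using L by (intro exI[of _ a'] exI[of _ L] exI[of _ "\<lambda>i. {a' $ i <..< a' $ i + L}"]) (auto simp: mem_box_cart)
    have QR: "Q \<subseteq> R"
    proof
      fix z assume "z \<in> Q"
      then have "a $ i \<le> z $ i \<and> z $ i \<le> a $ i + l" for i using sub(2) by (auto simp: mem_box_cart)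
      then have "a $ i - e < z $ i \<and> z $ i < a $ i - e + (l + 2 * e)" for i using e by (smt (verit))
      then show "z \<in> R" by (simp add: R_def mem_box_cart a'_def L_def)
    qed
    have RL: "emeasure lebesgue R = ennreal (L ^ CARD('n))" unfolding R_def by (rule emeasure_box_side[OF L])
    have "y < I / emeasure lebesgue R"
    proof (rule ccontr)
      assume "\<not> y < I / emeasure lebesgue R"
      then have "I / ennreal (L ^ CARD('n)) \<le> ennreal r" using r(1) RL by simp
      then have "I / ennreal (L ^ CARD('n)) * ennreal (L ^ CARD('n)) \<le> ennreal r * ennreal (L ^ CARD('n))"
        by (rule mult_right_mono) simp
      then have "I \<le> ennreal r * ennreal (L ^ CARD('n))"
        using L by (simp add: ennreal_divide_times ennreal_mult_divide_eq)
      also have "\<dots> = ennreal (r * L ^ CARD('n))" using r L by (simp add: ennreal_mult)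
      finally show False using j by (simp add: L_def e_def)
    qed
    also have "\<dots> \<le> (\<integral>\<^sup>+z\<in>R. ennreal \<bar>f z\<bar> \<partial>lebesgue) / emeasure lebesgue R"
      unfolding I_def using QR by (intro divide_right_mono_ennreal nn_integral_mono) (auto simp: indicator_def)
    finally have "y < maximal f z" if "z \<in> R" for z
      using average_le_maximal[OF R that, of f] by (rule less_le_trans)
    then show "\<exists>T. open T \<and> x \<in> T \<and> T \<subseteq> {x. y < maximal f x}"
      using QR Q(2) by (intro exI[of _ R]) (auto simp: R_def open_box)
  qed
  then show "{x \<in> space lebesgue. y < maximal f x} \<in> sets lebesgue" by (simp add: borel_open)
qed

lemma maximal_scale:
  fixes f :: "real ^ 'n \<Rightarrow> real"
  assumes [measurable]: "f \<in> borel_measurable lebesgue" and c: "0 \<le> c"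
  shows "maximal (\<lambda>x. c * f x) x = ennreal c * maximal f x"
proof -
  have "(\<integral>\<^sup>+y\<in>Q. ennreal \<bar>c * f y\<bar> \<partial>lebesgue) / emeasure lebesgue Q
      = ennreal c * ((\<integral>\<^sup>+y\<in>Q. ennreal \<bar>f y\<bar> \<partial>lebesgue) / emeasure lebesgue Q)" if "cube Q" for Q
  proof -
    have [measurable]: "Q \<in> sets lebesgue" using that by (rule cube_lebesgue)
    have "(\<integral>\<^sup>+y\<in>Q. ennreal \<bar>c * f y\<bar> \<partial>lebesgue) = (\<integral>\<^sup>+y. ennreal c * (ennreal \<bar>f y\<bar> * indicator Q y) \<partial>lebesgue)"
      using c by (intro nn_integral_cong) (simp add: abs_mult ennreal_mult mult.assoc)
    also have "\<dots> = ennreal c * (\<integral>\<^sup>+y\<in>Q. ennreal \<bar>f y\<bar> \<partial>lebesgue)" by (rule nn_integral_cmult) simp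
    finally show ?thesis by (simp add: ennreal_times_divide)
  qed
  then show ?thesis unfolding maximal_def
    by (subst SUP_mult_left_ennreal) (auto intro!: SUP_cong)
qed

context exponent begin

text \<open>Passing from \<open>Q\<close> to a grid cube around it dilutes the average by at most
  \<open>6 ^ CARD('n)\<close>, a factor built into \<open>f\<close>; the shifts \<open>s\<close>
  together catch every cube.\<close>

lemma superlevel_maximal_subset:
  fixes f g :: "real ^ 'n \<Rightarrow> real"
  assumes [measurable]: "g \<in> borel_measurable lebesgue" and f: "f = (\<lambda>x. 6 ^ CARD('n) * \<bar>g x\<bar>)" and t: "0 < t"
  shows "{x. ennreal t < maximal g x} \<subseteq> (\<Union>s. level_set s f t)"
proof
  fix x assume "x \<in> {x. ennreal t < maximal g x}"
  then obtain Q where Q: "cube Q" "x \<in> Q" "ennreal t < (\<integral>\<^sup>+z\<in>Q. ennreal \<bar>g z\<bar> \<partial>lebesgue) / emeasure lebesgue Q"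
    unfolding maximal_def by (auto simp: less_SUP_iff)
  obtain v where v: "emeasure lebesgue Q = ennreal v" "v > 0" using cube_emeasure[OF Q(1)] by blast
  have Qs [measurable]: "Q \<in> sets lebesgue" using Q(1) by (rule cube_lebesgue)
  obtain s P where P: "P \<in> grid s" "Q \<subseteq> P" "emeasure lebesgue P \<le> 6 ^ CARD('n) * emeasure lebesgue Q"
    using cube_subset_grid_cube[OF Q(1)] by blast
  define N :: real where "N = 6 ^ CARD('n)"
  have N: "0 < N" "6 ^ CARD('n) = ennreal N" by (auto simp: N_def ennreal_power[symmetric])
  define J where "J = (\<integral>\<^sup>+z\<in>Q. ennreal \<bar>g z\<bar> \<partial>lebesgue)"
  have tv: "ennreal t * ennreal v < J"
  proof (rule ccontr)
    assume "\<not> ennreal t * ennreal v < J"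
    then have "J / ennreal v \<le> ennreal t"
      using v by (subst divide_le_posI_ennreal) (auto simp: mult.commute)
    then show False using Q(3) v(1) by (simp add: J_def)
  qed
  have "ennreal t * emeasure lebesgue P \<le> ennreal t * (ennreal N * ennreal v)"
    using P(3) v(1) N(2) by (intro mult_left_mono) auto
  also have "\<dots> = ennreal N * (ennreal t * ennreal v)" by (simp only: mult_ac)
  also have "\<dots> < ennreal N * J" using tv N(1) by (intro ennreal_mult_strict_left_mono) auto
  also have "\<dots> = (\<integral>\<^sup>+z. ennreal N * (ennreal \<bar>g z\<bar> * indicator Q z) \<partial>lebesgue)"
    unfolding J_def by (rule nn_integral_cmult[symmetric]) simp
  also have "\<dots> \<le> (\<integral>\<^sup>+z\<in>P. ennreal (f z) \<partial>lebesgue)"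
    using P(2) N(1) by (intro nn_integral_mono) (auto simp: f N_def[symmetric] indicator_def ennreal_mult)
  finally have "P \<in> {Q\<in>grid s. ennreal t * emeasure lebesgue Q < (\<integral>\<^sup>+x\<in>Q. ennreal (f x) \<partial>lebesgue)}"
    using P(1) by simp
  then show "x \<in> (\<Union>s. level_set s f t)" using Q(2) P(2) unfolding level_set_def by blast
qed

lemma pmass_finite_Union:
  assumes "finite I" "\<And>i. i \<in> I \<Longrightarrow> A i \<in> sets lebesgue"
  shows "pmass (\<Union>i\<in>I. A i) t \<le> (\<Sum>i\<in>I. pmass (A i) t)"
proof -
  define M where "M = density lebesgue (\<lambda>x. ennreal (t powr p x))"
  have M: "emeasure M X = pmass X t" if "X \<in> sets lebesgue" for X
    unfolding M_def pmass_def using that by (subst emeasure_density) auto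
  have "emeasure M (\<Union>i\<in>I. A i) \<le> (\<Sum>i\<in>I. emeasure M (A i))"
    using assms by (intro emeasure_subadditive_finite) (auto simp: M_def)
  moreover have "(\<Union>i\<in>I. A i) \<in> sets lebesgue" using assms by (intro sets.finite_UN) auto
  ultimately show ?thesis using assms(2) M by simp
qed

text \<open>Dyadic layer cake: \<open>\<Phi>\<close> sums \<open>z k powr p x\<close> over the
  heights below \<open>maximal g x\<close>, so its integral is a sum of masses of superlevel sets,
  and \<open>2 powr b * \<Phi>\<close> dominates the \<open>p\<close>-th power of the maximal
  function. Where that function is infinite, all terms with \<open>k \<ge> 0\<close> are at least
  \<open>1\<close> and \<open>\<Phi>\<close> is infinite, which yields finiteness almost
  everywhere.\<close>

lemma A_and_S_imp_modular_bound:
  assumes A: "A_condition p" and S: "S_infty_condition p"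
  shows "\<exists>C\<ge>1. \<forall>g. g \<in> borel_measurable lebesgue \<longrightarrow>
    (\<integral>\<^sup>+x. ennreal ((6 ^ CARD('n) * \<bar>g x\<bar>) powr p x) \<partial>lebesgue) \<le> 1 \<longrightarrow>
    (AE x in lebesgue. maximal g x < \<infinity>) \<and>
    (\<integral>\<^sup>+x. ennreal (enn2real (maximal g x) powr p x) \<partial>lebesgue) \<le> ennreal C"
proof -
  obtain C where C: "0 < C" and sum: "\<forall>(s :: 'n \<Rightarrow> bool) f. f \<in> borel_measurable lebesgue \<longrightarrow> (\<forall>x. 0 \<le> f x) \<longrightarrow>
    (\<integral>\<^sup>+x. ennreal (f x powr p x) \<partial>lebesgue) \<le> 1 \<longrightarrow>
    (\<integral>\<^sup>+k. pmass (level_set s f (2 powr real_of_int k)) (2 powr real_of_int k) \<partial>count_space UNIV) \<le> ennreal C"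
    using level_set_summation[OF A S] by blast
  define D where "D = real (card (UNIV :: ('n \<Rightarrow> bool) set)) * C"
  have D: "0 \<le> D" using C by (simp add: D_def)
  have main: "(AE x in lebesgue. maximal g x < \<infinity>) \<and>
      (\<integral>\<^sup>+x. ennreal (enn2real (maximal g x) powr p x) \<partial>lebesgue) \<le> ennreal (2 powr b * D)"
    if g [measurable]: "g \<in> borel_measurable lebesgue"
      and g1: "(\<integral>\<^sup>+x. ennreal ((6 ^ CARD('n) * \<bar>g x\<bar>) powr p x) \<partial>lebesgue) \<le> 1" for g
  proof -
    define f where "f = (\<lambda>x. 6 ^ CARD('n) * \<bar>g x\<bar>)"
    have f [measurable]: "f \<in> borel_measurable lebesgue" unfolding f_def by measurable
    define z where "z = (\<lambda>k::int. 2 powr real_of_int k)"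
    have z0: "0 < z k" for k by (simp add: z_def)
    define O' where "O' = (\<lambda>k. {x. ennreal (z k) < maximal g x})"
    have Os [measurable]: "O' k \<in> sets lebesgue" for k
    proof -
      have "O' k = {x\<in>space lebesgue. ennreal (z k) < maximal g x}" by (simp add: O'_def)
      also have "\<dots> \<in> sets lebesgue" by measurable
      finally show ?thesis .
    qed
    define \<Phi> where "\<Phi> = (\<lambda>x. \<integral>\<^sup>+k. ennreal (z k powr p x) * indicator (O' k) x \<partial>count_space UNIV)"
    have \<Phi>m [measurable]: "\<Phi> \<in> borel_measurable lebesgue"
    proof -
      have "\<Phi> = (\<lambda>x. \<Sum>n. ennreal (z (int_decode n) powr p x) * indicator (O' (int_decode n)) x)"
        unfolding \<Phi>_def nn_integral_count_space_nat[symmetric]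
        by (intro ext nn_integral_bij_count_space[symmetric] bij_int_decode)
      then show ?thesis by simp
    qed
    have O_le: "pmass (O' k) (z k) \<le> (\<Sum>s\<in>UNIV. pmass (level_set s f (z k)) (z k))" for k
    proof -
      have "pmass (O' k) (z k) \<le> pmass (\<Union>s. level_set s f (z k)) (z k)"
        using superlevel_maximal_subset[OF g f_def z0[of k]] z0[of k] by (intro pmass_mono) (auto simp: O'_def)
      also have "\<dots> \<le> (\<Sum>s\<in>UNIV. pmass (level_set s f (z k)) (z k))" by (rule pmass_finite_Union) auto
      finally show ?thesis .
    qed
    have "(\<integral>\<^sup>+x. \<Phi> x \<partial>lebesgue) = (\<integral>\<^sup>+k. pmass (O' k) (z k) \<partial>count_space UNIV)"
      unfolding \<Phi>_def pmass_def by (rule nn_integral_count_space_nn_integral) auto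
    also have "\<dots> \<le> (\<integral>\<^sup>+k. (\<Sum>s\<in>UNIV. pmass (level_set s f (z k)) (z k)) \<partial>count_space UNIV)"
      using O_le by (intro nn_integral_mono)
    also have "\<dots> = (\<Sum>s\<in>UNIV. \<integral>\<^sup>+k. pmass (level_set s f (z k)) (z k) \<partial>count_space UNIV)"
      by (rule nn_integral_sum) simp
    also have "\<dots> \<le> (\<Sum>s\<in>(UNIV :: ('n \<Rightarrow> bool) set). ennreal C)"
    proof (rule sum_mono)
      fix s :: "'n \<Rightarrow> bool"
      have "(\<integral>\<^sup>+x. ennreal (f x powr p x) \<partial>lebesgue) \<le> 1" using g1 by (simp add: f_def)
      then show "(\<integral>\<^sup>+k. pmass (level_set s f (z k)) (z k) \<partial>count_space UNIV) \<le> ennreal C"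
        unfolding z_def using sum[rule_format, of f s] by (simp add: f_def)
    qed
    also have "\<dots> = ennreal D" unfolding D_def using C by (simp add: ennreal_mult ennreal_of_nat_eq_real_of_nat)
    finally have \<Phi>D: "(\<integral>\<^sup>+x. \<Phi> x \<partial>lebesgue) \<le> ennreal D" .
    then have "AE x in lebesgue. \<Phi> x \<noteq> \<infinity>" by (intro nn_integral_PInf_AE) (auto simp: top_unique)
    then have fin: "AE x in lebesgue. \<Phi> x < \<infinity>" by (simp add: less_top)
    have Mfin: "maximal g x < \<infinity>" if "\<Phi> x < \<infinity>" for x
    proof (rule ccontr)
      assume "\<not> maximal g x < \<infinity>"
      then have m: "maximal g x = \<infinity>" by (simp add: less_top[symmetric])
      have "(\<integral>\<^sup>+k. indicator {0::int..} k \<partial>count_space UNIV) \<le> \<Phi> x"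
        unfolding \<Phi>_def
      proof (rule nn_integral_mono)
        fix k :: int
        show "indicator {0..} k \<le> ennreal (z k powr p x) * indicator (O' k) x"
        proof (cases "0 \<le> k")
          case True
          then have "1 \<le> z k" unfolding z_def by (intro ge_one_powr_ge_zero) auto
          then have "1 \<le> z k powr p x" using p_pos[of x] by (intro ge_one_powr_ge_zero) auto
          then have "1 \<le> ennreal (z k powr p x)" using ennreal_leI[of 1] by simp
          then show ?thesis using True m by (simp add: O'_def)
        qed simp
      qed
      moreover have "(\<integral>\<^sup>+k. indicator {0::int..} k \<partial>count_space UNIV) = \<infinity>"
        by (simp add: infinite_Ici)
      ultimately show False using that by simp
    qed
    have Mle: "ennreal (enn2real (maximal g x) powr p x) \<le> ennreal (2 powr b) * \<Phi> x" if "\<Phi> x < \<infinity>" for x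
    proof (cases "enn2real (maximal g x) = 0")
      case False
      define m where "m = enn2real (maximal g x)"
      have m: "maximal g x = ennreal m" "0 < m" using Mfin[OF that] False by (auto simp: m_def less_le)
      \<comment> \<open>Ceiling minus one gives \<open>z k < m \<le> 2 * z k\<close>, strict on the
        left as membership in \<open>O' k\<close> requires, even if \<open>m\<close> is a power of
        two.\<close>
      define k where "k = \<lceil>log 2 m\<rceil> - 1"
      have "real_of_int k < log 2 m" "log 2 m \<le> real_of_int k + 1" unfolding k_def by linarith+
      then have "2 powr real_of_int k < 2 powr log 2 m" "2 powr log 2 m \<le> 2 powr (real_of_int k + 1)" by auto
      then have k: "z k < m" "m \<le> 2 * z k" using m(2) by (auto simp: z_def powr_add)
      have "m powr p x \<le> (2 * z k) powr p x" using k m p_pos[of x] by (intro powr_mono2) auto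
      also have "\<dots> \<le> 2 powr b * z k powr p x" using z0[of k] by (intro powr_scale_up) auto
      finally have "ennreal (m powr p x) \<le> ennreal (2 powr b) * ennreal (z k powr p x)"
        by (simp add: ennreal_mult[symmetric] ennreal_leI)
      also have "ennreal (z k powr p x) = ennreal (z k powr p x) * indicator (O' k) x"
        using k(1) m z0[of k] by (simp add: O'_def ennreal_less_iff)
      also have "\<dots> \<le> \<Phi> x" unfolding \<Phi>_def by (rule nn_integral_ge_point) simp
      finally show ?thesis by (simp add: m_def mult_left_mono)
    qed simp
    show ?thesis
    proof
      show "AE x in lebesgue. maximal g x < \<infinity>" using fin by eventually_elim (rule Mfin)
      have "(\<integral>\<^sup>+x. ennreal (enn2real (maximal g x) powr p x) \<partial>lebesgue) \<le> (\<integral>\<^sup>+x. ennreal (2 powr b) * \<Phi> x \<partial>lebesgue)"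
        using fin by (intro nn_integral_mono_AE) (auto elim!: eventually_mono intro: Mle)
      also have "\<dots> = ennreal (2 powr b) * (\<integral>\<^sup>+x. \<Phi> x \<partial>lebesgue)" by (rule nn_integral_cmult) simp
      also have "\<dots> \<le> ennreal (2 powr b) * ennreal D" using \<Phi>D by (rule mult_left_mono) simp
      also have "\<dots> = ennreal (2 powr b * D)" using D by (intro ennreal_mult[symmetric]) auto
      finally show "(\<integral>\<^sup>+x. ennreal (enn2real (maximal g x) powr p x) \<partial>lebesgue) \<le> ennreal (2 powr b * D)" .
    qed
  qed
  show ?thesis
  proof (intro exI[of _ "1 + 2 powr b * D"] conjI allI impI)
    show "1 \<le> 1 + 2 powr b * D" using D by simp
    fix g :: "real ^ 'n \<Rightarrow> real"
    assume g: "g \<in> borel_measurable lebesgue" "(\<integral>\<^sup>+x. ennreal ((6 ^ CARD('n) * \<bar>g x\<bar>) powr p x) \<partial>lebesgue) \<le> 1"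
    show "AE x in lebesgue. maximal g x < \<infinity>" using main[OF g] by blast
    have "ennreal (2 powr b * D) \<le> ennreal (1 + 2 powr b * D)" by (intro ennreal_leI) simp
    then show "(\<integral>\<^sup>+x. ennreal (enn2real (maximal g x) powr p x) \<partial>lebesgue) \<le> ennreal (1 + 2 powr b * D)"
      using main[OF g] by (blast intro: order_trans)
  qed
qed

text \<open>For \<open>u\<close> above the norm of \<open>f\<close>, dividing \<open>f\<close> by
  \<open>N * u\<close> meets the normalisation of the modular bound, and contracting by
  \<open>1 / C\<close> brings the resulting modular from \<open>C\<close> down to \<open>1\<close>.
  Letting \<open>u\<close> decrease to the norm makes the estimate proportional to it, including the
  case of norm zero.\<close>

lemma A_and_S_imp_maximal_bounded:
  assumes A: "A_condition p" and S: "S_infty_condition p"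
  shows "maximal_bounded p"
proof -
  obtain C where C: "1 \<le> C" and bd: "\<forall>g. g \<in> borel_measurable lebesgue \<longrightarrow>
    (\<integral>\<^sup>+x. ennreal ((6 ^ CARD('n) * \<bar>g x\<bar>) powr p x) \<partial>lebesgue) \<le> 1 \<longrightarrow>
    (AE x in lebesgue. maximal g x < \<infinity>) \<and>
    (\<integral>\<^sup>+x. ennreal (enn2real (maximal g x) powr p x) \<partial>lebesgue) \<le> ennreal C"
    using A_and_S_imp_modular_bound[OF A S] by blast
  define N :: real where "N = 6 ^ CARD('n)"
  have N: "0 < N" by (simp add: N_def)
  have main: "(AE x in lebesgue. maximal f x < \<infinity>) \<and> Lp_norm p (\<lambda>x. enn2real (maximal f x)) \<le> ennreal (N * C * u)"
    if f [measurable]: "f \<in> borel_measurable lebesgue" and u: "0 < u" "Lp_norm p f < ennreal u" for f u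
  proof -
    define g where "g = (\<lambda>x. f x / (N * u))"
    have g [measurable]: "g \<in> borel_measurable lebesgue" unfolding g_def by measurable
    have "N * \<bar>g x\<bar> = \<bar>f x\<bar> / u" for x using N u by (simp add: g_def abs_mult)
    then have "(\<integral>\<^sup>+x. ennreal ((N * \<bar>g x\<bar>) powr p x) \<partial>lebesgue) \<le> 1" using Lp_norm_less[OF u(2)] by simp
    then have gM: "AE x in lebesgue. maximal g x < \<infinity>"
      "(\<integral>\<^sup>+x. ennreal (enn2real (maximal g x) powr p x) \<partial>lebesgue) \<le> ennreal C"
      using bd[rule_format, OF g] by (auto simp: N_def)
    have "f = (\<lambda>x. (N * u) * g x)" using N u by (auto simp: g_def)
    then have Mf: "maximal f x = ennreal (N * u) * maximal g x" for x
      using maximal_scale[OF g, of "N * u" x] N u by simp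
    have "(\<integral>\<^sup>+x. ennreal ((\<bar>enn2real (maximal f x)\<bar> / (N * C * u)) powr p x) \<partial>lebesgue)
        \<le> (\<integral>\<^sup>+x. ennreal (1 / C) * ennreal (enn2real (maximal g x) powr p x) \<partial>lebesgue)"
    proof (rule nn_integral_mono)
      fix x
      have "\<bar>enn2real (maximal f x)\<bar> / (N * C * u) = 1 / C * enn2real (maximal g x)"
        using N u C by (simp add: Mf enn2real_mult)
      then have "(\<bar>enn2real (maximal f x)\<bar> / (N * C * u)) powr p x \<le> 1 / C * enn2real (maximal g x) powr p x"
        using powr_scale_down[of "1 / C" "enn2real (maximal g x)" x] C by simp
      then show "ennreal ((\<bar>enn2real (maximal f x)\<bar> / (N * C * u)) powr p x) \<le> ennreal (1 / C) * ennreal (enn2real (maximal g x) powr p x)"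
        using C by (simp add: ennreal_mult[symmetric] ennreal_leI)
    qed
    also have "\<dots> = ennreal (1 / C) * (\<integral>\<^sup>+x. ennreal (enn2real (maximal g x) powr p x) \<partial>lebesgue)"
      by (rule nn_integral_cmult) simp
    also have "\<dots> \<le> ennreal (1 / C) * ennreal C" using gM(2) by (rule mult_left_mono) simp
    also have "\<dots> = 1" using C by (simp add: ennreal_mult[symmetric])
    finally have "Lp_norm p (\<lambda>x. enn2real (maximal f x)) \<le> ennreal (N * C * u)"
      using N C u by (intro Lp_norm_le) auto
    moreover have "AE x in lebesgue. maximal f x < \<infinity>"
      using gM(1) unfolding Mf by eventually_elim (simp add: ennreal_mult_less_top)
    ultimately show ?thesis by blast
  qed
  show ?thesis unfolding maximal_bounded_def
  proof (intro exI[of _ "N * C"] conjI ballI)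
    show "0 \<le> N * C" using N C by simp
    fix f assume f: "f \<in> Lp_space p"
    then have fm [measurable]: "f \<in> borel_measurable lebesgue" and fin: "Lp_norm p f < \<infinity>" by (auto simp: Lp_space_def)
    obtain \<nu> where \<nu>: "Lp_norm p f = ennreal \<nu>" "0 \<le> \<nu>" using fin by (cases "Lp_norm p f") auto
    have e: "(AE x in lebesgue. maximal f x < \<infinity>) \<and> Lp_norm p (\<lambda>x. enn2real (maximal f x)) \<le> ennreal (N * C * (\<nu> + e))" if "0 < e" for e
      using that \<nu> by (intro main fm) (auto simp: ennreal_less_iff simp del: ennreal_plus)
    show "AE x in lebesgue. maximal f x < \<infinity>" using e[of 1] by simp
    have "Lp_norm p (\<lambda>x. enn2real (maximal f x)) < \<infinity>" using e[of 1] by (auto intro: le_less_trans)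
    moreover have "(\<lambda>x. enn2real (maximal f x)) \<in> borel_measurable lebesgue" by measurable
    ultimately show "(\<lambda>x. enn2real (maximal f x)) \<in> Lp_space p" by (simp add: Lp_space_def)
    have "Lp_norm p (\<lambda>x. enn2real (maximal f x)) \<le> ennreal (N * C * \<nu>)"
    proof (rule ennreal_le_epsilon)
      fix d :: real assume d: "0 < d"
      have "Lp_norm p (\<lambda>x. enn2real (maximal f x)) \<le> ennreal (N * C * (\<nu> + d / (N * C)))"
        using e[of "d / (N * C)"] d N C by simp
      also have "N * C * (\<nu> + d / (N * C)) = N * C * \<nu> + d" using N C by (simp add: distrib_left)
      also have "ennreal (N * C * \<nu> + d) = ennreal (N * C * \<nu>) + ennreal d" using N C \<nu> d by (intro ennreal_plus) auto
      finally show "Lp_norm p (\<lambda>x. enn2real (maximal f x)) \<le> ennreal (N * C * \<nu>) + ennreal d" .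
    qed
    then show "Lp_norm p (\<lambda>x. enn2real (maximal f x)) \<le> ennreal (N * C) * Lp_norm p f"
      unfolding \<nu>(1) using N C \<nu>(2) by (simp add: ennreal_mult)
  qed
qed

theorem maximal_bounded_iff:
  "maximal_bounded p \<longleftrightarrow> A_condition p \<and> S_infty_condition p"
  using maximal_bounded_imp_A_condition maximal_bounded_imp_S_infty_condition A_and_S_imp_maximal_bounded by blast

end

subsection \<open>Essential bounds\<close>

text \<open>All three conditions see the exponent only through integrals; this justifies replacing
  it by one whose bounds hold everywhere.\<close>

lemma AE_cong_conditions:
  fixes p p' :: "real ^ 'n \<Rightarrow> real"
  assumes eq: "AE x in lebesgue. p x = p' x"
  shows "maximal_bounded p \<longleftrightarrow> maximal_bounded p'" "A_condition p \<longleftrightarrow> A_condition p'"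
    "S_infty_condition p \<longleftrightarrow> S_infty_condition p'"
proof -
  have Lp: "Lp_norm q f = Lp_norm q' f" if "AE x in lebesgue. q x = q' x" for q q' f :: "real ^ 'n \<Rightarrow> real"
  proof -
    have "(\<integral>\<^sup>+x. ennreal ((\<bar>f x\<bar> / t) powr q x) \<partial>lebesgue) = (\<integral>\<^sup>+x. ennreal ((\<bar>f x\<bar> / t) powr q' x) \<partial>lebesgue)" for t
      using that by (intro nn_integral_cong_AE) (auto elim!: eventually_mono)
    then show ?thesis by (simp add: Lp_norm_def)
  qed
  have n: "Lp_norm p = Lp_norm p'" using Lp[OF eq] by blast
  have "AE x in lebesgue. conj_exponent p x = conj_exponent p' x"
    using eq by eventually_elim (simp add: conj_exponent_def)
  then have n': "Lp_norm (conj_exponent p) = Lp_norm (conj_exponent p')" using Lp by blast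
  show "maximal_bounded p \<longleftrightarrow> maximal_bounded p'" unfolding maximal_bounded_def Lp_space_def n ..
  show "A_condition p \<longleftrightarrow> A_condition p'" unfolding A_condition_def n n' ..
  have i: "(\<integral>\<^sup>+x\<in>E. ennreal (t powr p x) \<partial>lebesgue) = (\<integral>\<^sup>+x\<in>E. ennreal (t powr p' x) \<partial>lebesgue)" for E t
    using eq by (intro nn_integral_cong_AE) (auto elim!: eventually_mono)
  show "S_infty_condition p \<longleftrightarrow> S_infty_condition p'" unfolding S_infty_condition_def i ..
qed

theorem theorem4p2:
  fixes p :: "real ^ 'n \<Rightarrow> real"
  assumes "p \<in> borel_measurable lebesgue"
    and "\<And>x. 1 \<le> p x"
    and "1 < p_minus p" and "p_minus p \<le> p_plus p" and "p_plus p < \<infinity>"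
  shows "maximal_bounded p \<longleftrightarrow> A_condition p \<and> S_infty_condition p"
proof -
  obtain a where a: "1 < a" "ereal a < p_minus p"
    using ereal_dense2[OF assms(3)] by (auto simp: one_ereal_def)
  obtain b0 where b0: "p_plus p < ereal b0" using ereal_dense2[OF assms(5)] by blast
  \<comment> \<open>The maximum ensures \<open>a \<le> b\<close>, so that clipping between
    \<open>a\<close> and \<open>b\<close> respects both bounds.\<close>
  define b where "b = max a b0"
  have lo: "AE x in lebesgue. a \<le> p x"
    using esssup_AE[of "\<lambda>x. - ereal (p x)" lebesgue]
  proof eventually_elim
    case (elim x)
    then have "p_minus p \<le> ereal (p x)" unfolding p_minus_def by (simp add: ereal_uminus_le_reorder)
    then have "ereal a < ereal (p x)" using a(2) by (rule less_le_trans[rotated])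
    then show ?case by simp
  qed
  have hi: "AE x in lebesgue. p x \<le> b"
    using esssup_AE[of "\<lambda>x. ereal (p x)" lebesgue]
  proof eventually_elim
    case (elim x)
    then have "ereal (p x) < ereal b0" using b0 unfolding p_plus_def by (rule le_less_trans)
    then show ?case by (simp add: b_def)
  qed
  define p' where "p' = (\<lambda>x. max a (min b (p x)))"
  have eq: "AE x in lebesgue. p x = p' x"
    using lo hi by eventually_elim (simp add: p'_def)
  interpret exponent p' a b
  proof
    show "p' \<in> borel_measurable lebesgue" unfolding p'_def using assms(1) by measurable
  qed (use a in \<open>auto simp: p'_def b_def\<close>)
  show ?thesis using maximal_bounded_iff AE_cong_conditions[OF eq] by simp
qed

end
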